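(* Let $f:\mathbb{Z}\to[0,1]$ be given by $$f(k)=\prod_{j=1}^{\infty}\cos^2\left(2\pi\frac{k}{3^j}\right).$$ Then the following statements hold: 1. $f\in(\mathcal{H}_0(\mathbb{Z})\cap\mathcal{W}(\mathbb{Z}))\setminus(AP(\mathbb{Z})\oplus C_0(\mathbb{Z}))$. 2. $m_{\mathbb{Z}}(f)=0$ for $m_{\mathbb{Z}}$ the unique invariant mean on $\mathcal{H}(\mathbb{Z})$. 3. $f$ can be realized by a Riemann integrable function on the 3-adic compactification $\overline{\mathbb{Z}}^{(3)}$ of $\mathbb{Z}$. 4. $f$ is the Fourier-Stieltjes transform of the singular measure $\mu_3$ corresponding to the ternary Cantor set canonically embedded into $\mathbb{T}$.
   Context: Compact spaces are Hausdorff. A group compactification of $\mathbb{Z}$ is a pair $(\iota,C)$ where $C$ is a compact topological group and $\iota:\mathbb{Z}\to C$ is a homomorphism with dense image; $\mu_C$ is the (completed) normalized Haar measure on $C$. A bounded $F:C\to\mathbb{C}$ is ($\mu_C$-)Riemann integrable if its set of discontinuity points is $\mu_C$-null. $f$ is realized by $F$ on $(\iota,C)$ if $f=F\circ\iota$. $\mathcal{H}(\mathbb{Z})$ is the set of Hartman functions, i.e. functions $F\circ\iota$ with $F$ Riemann integrable on some group compactification; the unique invariant mean on $\mathcal{H}(\mathbb{Z})$ is $m_{\mathbb{Z}}(F\circ\iota)=\int_C F\,d\mu_C$. $\mathcal{H}_0(\mathbb{Z})$ is the set of $f\in\mathcal{H}(\mathbb{Z})$ such that for some (equivalently, every) Riemann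 integrable realization $F$ of $f$ on a group compactification $(\iota,C)$, the set $\{F\neq0\}$ is a meager $\mu_C$-null set. $B(\mathbb{Z})$ denotes the bounded functions $\mathbb{Z}\to\mathbb{C}$ with the supremum norm. $AP(\mathbb{Z})$ (resp. $\mathcal{W}(\mathbb{Z})$) is the set of $f\in B(\mathbb{Z})$ whose set of translates is relatively compact in the norm (resp. weak) topology of $B(\mathbb{Z})$. $C_0(\mathbb{Z})$ is the set of functions $\mathbb{Z}\to\mathbb{C}$ tending to $0$ at $\pm\infty$. $AP(\mathbb{Z})\oplus C_0(\mathbb{Z})$ is the set of sums $f_a+f_0$ with $f_a\in AP(\mathbb{Z})$, $f_0\in C_0(\mathbb{Z})$. The 3-adic compactification is $(\iota,\overline{\mathbb{Z}}^{(3)})$ with $\overline{\mathbb{Z}}^{(3)}=\varprojlim\mathbb{Z}/3^n\mathbb{Z}$ the compact group of 3-adic integers and $\iota(k)=(k\bmod 3^n)_{n\ge1}$. Let $\mathbb{T}=\mathbb{R}/\mathbb{Z}$ and let $\lambda$ be Lebesgue measure on $[0,1)$. Let $\phi$ be the $\lambda$-a.e. uniquely defined map $\phi\left(\sum_{i\ge1}a_i2^{-i}\right)=\sum_{i\ge1}2a_i3^{-i}$, $a_i\in\{0,1\}$. The measure $\mu_3$ is the image measure on $\mathbb{T}$ of $\lambda$ under $x\mapsto\phi(x)+\mathbb{Z}$. The Fourier-Stieltjes transform of a finite complex Borel measure $\mu$ on $\mathbb{T}$ is $\hat\mu(k)=\int_{\mathbb{T}}e^{2\pi ikx}\,d\mu(x)$,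 $k\in\mathbb{Z}$.
   Formalization: Item 4 is false as printed: the transform of μ_3 at k is (-1)^k ∏cos(2πk/3^j), whose square is f(k), and 0<f(1)≤1/4. It is replaced by: f is the Fourier-Stieltjes transform of the convolution square μ_3*μ_3, with both μ_3 and μ_3*μ_3 singular. *)

theory Defs
  imports "HOL-Analysis.Analysis" "HOL-Algebra.Elementary_Groups" "HOL-Algebra.Product_Groups"
begin

section \<open>Group compactifications of the integers and Haar measure\<close>

definition compact_group :: "'c monoid \<Rightarrow> 'c topology \<Rightarrow> bool" where
  "compact_group G T \<longleftrightarrow>
     group G \<and> topspace T = carrier G \<and> compact_space T \<and> Hausdorff_space T \<and>
     continuous_map (prod_topology T T) T (\<lambda>(x, y). x \<otimes>\<^bsub>G\<^esub> y) \<and>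
     continuous_map T T (\<lambda>x. inv\<^bsub>G\<^esub> x)"

definition group_compactification :: "'c monoid \<Rightarrow> 'c topology \<Rightarrow> (int \<Rightarrow> 'c) \<Rightarrow> bool" where
  "group_compactification G T \<iota> \<longleftrightarrow>
     compact_group G T \<and> \<iota> \<in> hom integer_group G \<and> T closure_of (range \<iota>) = topspace T"

text \<open>The Haar measure is the unique invariant Radon probability measure on the Borel sets;
  inner regularity has to be demanded because the group need not be metrizable.
  The completed Haar measure is \<open>completion M\<close>.\<close>

definition normalized_haar_measure :: "'c monoid \<Rightarrow> 'c topology \<Rightarrow> 'c measure \<Rightarrow> bool" where
  "normalized_haar_measure G T M \<longleftrightarrow>
     space M = topspace T \<and> sets M = sigma_sets (topspace T) {U. openin T U} \<and>
     emeasure M (space M) = 1 \<and>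
     (\<forall>g\<in>carrier G. \<forall>A\<in>sets M. emeasure M ((\<lambda>x. g \<otimes>\<^bsub>G\<^esub> x) ` A) = emeasure M A) \<and>
     (\<forall>A\<in>sets M. emeasure M A = (SUP K\<in>{K. compactin T K \<and> K \<subseteq> A}. emeasure M K))"

definition riemann_integrable :: "'c topology \<Rightarrow> 'c measure \<Rightarrow> ('c \<Rightarrow> complex) \<Rightarrow> bool" where
  "riemann_integrable T M F \<longleftrightarrow>
     bounded (F ` topspace T) \<and>
     {x \<in> topspace T. \<not> topcontinuous_at T euclidean F x} \<in> null_sets (completion M)"

definition realized_by ::
  "(int \<Rightarrow> complex) \<Rightarrow> 'c monoid \<Rightarrow> 'c topology \<Rightarrow> (int \<Rightarrow> 'c) \<Rightarrow> 'c measure \<Rightarrow> ('c \<Rightarrow> complex) \<Rightarrow> bool"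
  where
  "realized_by f G T \<iota> M F \<longleftrightarrow>
     group_compactification G T \<iota> \<and> normalized_haar_measure G T M \<and>
     riemann_integrable T M F \<and> f = F \<circ> \<iota>"

text \<open>HOL does not quantify over types, so ``some group compactification'' ranges over those
  carried by subsets of one fixed type. Nothing is lost: by density of the image of \<open>\<iota>\<close>, a point
  of any group compactification is determined by the traces on the integers of its open
  neighbourhoods, so that every group compactification has an isomorphic copy in this type.\<close>

type_synonym compactification_point = "int set set"

lemma inj_on_neighbourhood_traces:
  assumes "group_compactification G T \<iota>"
  shows "inj_on (\<lambda>x. {\<iota> -` U |U. openin T U \<and> x \<in> U} :: compactification_point) (topspace T)"
proof (rule inj_onI, rule ccontr)
  fix x y
  assume x: "x \<in> topspace T" and y: "y \<in> topspace T" and "x \<noteq> y"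
    and eq: "{\<iota> -` U |U. openin T U \<and> x \<in> U} = {\<iota> -` U |U. openin T U \<and> y \<in> U}"
  have H: "Hausdorff_space T" and D: "T closure_of (range \<iota>) = topspace T"
    using assms by (auto simp: group_compactification_def compact_group_def)
  obtain U V where UV: "openin T U" "openin T V" "x \<in> U" "y \<in> V" "disjnt U V"
    using H x y \<open>x \<noteq> y\<close> unfolding Hausdorff_space_def by metis
  have "\<iota> -` U \<in> {\<iota> -` U |U. openin T U \<and> y \<in> U}"
    using UV eq by blast
  then obtain W where W: "openin T W" "y \<in> W" "\<iota> -` U = \<iota> -` W"
    by blast
  have "y \<in> T closure_of (range \<iota>)" "openin T (V \<inter> W)" "y \<in> V \<inter> W"
    using D y UV W by auto
  then obtain k where "\<iota> k \<in> V \<inter> W"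
    unfolding in_closure_of by blast
  moreover from this have "\<iota> k \<in> U"
    using W by blast
  ultimately show False
    using UV by (auto simp: disjnt_def)
qed

section \<open>Hartman functions\<close>

definition hartman_functions :: "(int \<Rightarrow> complex) set" where
  "hartman_functions =
     {f. \<exists>(G :: compactification_point monoid) T \<iota> M F. realized_by f G T \<iota> M F}"

definition hartman_mean :: "(int \<Rightarrow> complex) \<Rightarrow> complex" where
  "hartman_mean f =
     (THE c. \<exists>(G :: compactification_point monoid) T \<iota> M F.
        realized_by f G T \<iota> M F \<and> c = integral\<^sup>L (completion M) F)"

definition meager_in :: "'c topology \<Rightarrow> 'c set \<Rightarrow> bool" where
  "meager_in T A \<longleftrightarrow>
     (\<exists>N :: nat \<Rightarrow> 'c set. (\<forall>n. N n \<subseteq> topspace T \<and> T interior_of (T closure_of N n) = {}) \<and>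
        A = (\<Union>n. N n))"

definition hartman_functions_0 :: "(int \<Rightarrow> complex) set" where
  "hartman_functions_0 =
     {f. \<exists>(G :: compactification_point monoid) T \<iota> M F.
        realized_by f G T \<iota> M F \<and>
        meager_in T {x \<in> topspace T. F x \<noteq> 0} \<and>
        {x \<in> topspace T. F x \<noteq> 0} \<in> null_sets (completion M)}"

section \<open>Almost periodicity\<close>

text \<open>As the integers are discrete, the bounded continuous functions \<^typ>\<open>int \<Rightarrow>\<^sub>C complex\<close> with
  their supremum norm are all bounded functions.\<close>

definition translates :: "(int \<Rightarrow> complex) \<Rightarrow> (int \<Rightarrow>\<^sub>C complex) set" where
  "translates f = range (\<lambda>k. Bcontfun (\<lambda>n. f (n + k)))"

text \<open>Real functionals generate the same weak topology as complex ones, a real-linear functional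
  on a complex space being the real part of a complex-linear one.\<close>

definition weak_topology :: "'a::real_normed_vector topology" where
  "weak_topology = topology_generated_by {\<phi> -` U |(\<phi> :: 'a \<Rightarrow> real) U. bounded_linear \<phi> \<and> open U}"

definition almost_periodic :: "(int \<Rightarrow> complex) set" where
  "almost_periodic = {f. bounded (range f) \<and> compact (closure (translates f))}"

definition weakly_almost_periodic :: "(int \<Rightarrow> complex) set" where
  "weakly_almost_periodic =
     {f. bounded (range f) \<and> compactin weak_topology (weak_topology closure_of translates f)}"

definition vanishing_at_infinity :: "(int \<Rightarrow> complex) set" where
  "vanishing_at_infinity = {f. (f \<longlongrightarrow> 0) at_top \<and> (f \<longlongrightarrow> 0) at_bot}"

definition almost_periodic_plus_c0 :: "(int \<Rightarrow> complex) set" where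
  "almost_periodic_plus_c0 =
     {\<lambda>k. fa k + f0 k |fa f0. fa \<in> almost_periodic \<and> f0 \<in> vanishing_at_infinity}"

section \<open>The 3-adic compactification\<close>

text \<open>Coordinate \<open>n\<close> holds the residue modulo \<open>3 ^ Suc n\<close>.\<close>

definition zadic3 :: "(nat \<Rightarrow> int) monoid" where
  "zadic3 = (product_group UNIV (\<lambda>n. integer_mod_group (3 ^ Suc n)))
     \<lparr>carrier := {x. \<forall>n. x n \<in> {0..<3 ^ Suc n} \<and> x (Suc n) mod 3 ^ Suc n = x n}\<rparr>"

definition zadic3_topology :: "(nat \<Rightarrow> int) topology" where
  "zadic3_topology =
     subtopology (product_topology (\<lambda>n. discrete_topology {0..<3 ^ Suc n}) UNIV) (carrier zadic3)"

definition zadic3_embedding :: "int \<Rightarrow> nat \<Rightarrow> int" where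
  "zadic3_embedding k = (\<lambda>n. k mod 3 ^ Suc n)"

section \<open>Measures on the circle\<close>

text \<open>Measures on the circle group of reals modulo integers live on the set \<open>{0..<1}\<close> of
  representatives, with \<^const>\<open>frac\<close> as quotient map. The bijection of \<open>{0..<1}\<close> with the circle
  is a Borel isomorphism, though not a homeomorphism.\<close>

definition circle_borel :: "real measure" where
  "circle_borel = restrict_space borel {0..<1}"

definition circle_lebesgue :: "real measure" where
  "circle_lebesgue = restrict_space lborel {0..<1}"

definition fourier_stieltjes :: "real measure \<Rightarrow> int \<Rightarrow> complex" where
  "fourier_stieltjes \<mu> k = (LINT x|\<mu>. exp (2 * of_real pi * \<i> * of_int k * of_real x))"

definition circle_convolution :: "real measure \<Rightarrow> real measure \<Rightarrow> real measure" where
  "circle_convolution \<mu> \<nu> = distr (\<mu> \<Otimes>\<^sub>M \<nu>) circle_borel (\<lambda>(x, y). frac (x + y))"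

definition circle_singular :: "real measure \<Rightarrow> bool" where
  "circle_singular \<mu> \<longleftrightarrow>
     (\<exists>N\<in>sets circle_borel. emeasure circle_lebesgue N = 0 \<and> emeasure \<mu> ({0..<1} - N) = 0)"

text \<open>\<open>binary_digit x i\<close> is the coefficient of \<open>2 ^ (- Suc i)\<close> in the binary expansion of \<open>x\<close> not
  ending in ones; the points with two expansions are countably many.\<close>

definition binary_digit :: "real \<Rightarrow> nat \<Rightarrow> int" where
  "binary_digit x i = \<lfloor>2 ^ Suc i * x\<rfloor> mod 2"

definition binary_to_cantor :: "real \<Rightarrow> real" where
  "binary_to_cantor x = (\<Sum>i. 2 * of_int (binary_digit x i) / 3 ^ Suc i)"

text \<open>The transform of the Cantor measure at \<open>k\<close> is \<open>(- 1) ^ k\<close> times the product over \<open>j \<ge> 1\<close>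
  of \<open>cos (2 * pi * k / 3 ^ j)\<close>. The product of the squared cosines is therefore the transform of
  its convolution square, not of the Cantor measure itself.\<close>

definition cantor_measure :: "real measure" where
  "cantor_measure = distr circle_lebesgue circle_borel (\<lambda>x. frac (binary_to_cantor x))"

end

theory Submission
  imports Defs "HOL-Probability.Probability"
begin

text \<open>Self-similarity of the Cantor map gives \<open>\<phi> t = (1 + cis (4 * pi * t / 3)) / 2 * \<phi> (t / 3)\<close>
  for the transform \<open>\<phi>\<close> of the Cantor measure. Iterating, \<open>\<phi>\<^sup>2\<close> is the cosine product at the
  integers, \<open>\<phi> (3 * k) = \<phi> k\<close>, and \<open>\<phi> (3 ^ n - 1)\<close> tends to the squared modulus of \<open>\<phi> 1\<close>. The last
  two facts make the means of \<open>cis (2 * pi * 3 ^ j * x)\<close> converge to different constants almost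
  everywhere for Lebesgue measure and for the Cantor measure (or its convolution square), which are
  therefore mutually singular.

  The partial products have period \<open>3 ^ n\<close> and sum to \<open>(3 / 2) ^ n\<close> over any period, so the function
  has mean \<open>0\<close> uniformly. Hence every Riemann integrable realization vanishes almost everywhere, and
  the almost periodic part of a decomposition with a \<open>C\<^sub>0\<close> part would vanish, contradicting the
  constant nonzero value at the powers of \<open>3\<close>. On the 3-adic integers, extending by \<open>0\<close> gives a
  realization, continuous wherever the partial products tend to \<open>0\<close>.

  Weak almost periodicity holds for all Fourier-Stieltjes transforms: the translates lie in the image
  of a ball under a bounded operator defined on a pre-Hilbert space.\<close>

section \<open>The cosine product\<close>

text \<open>The mean is a definite description over realizations on arbitrary compactifications, so
  the 3-adic one alone decides nothing: each realization has to be shown to vanish almost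
  everywhere. All they share is the values at the integers, and density turns the visits of an orbit
  to an open set into visits at integers \<open>m + k\<close> with no control of \<open>m\<close>.
  Hence the estimate \<open>sum_cos_product_le\<close> is uniform in \<open>m\<close>; its gain is
  (3/2)^n against the window length 3^n.

  Squaring the cosines matters on the Fourier side: without it the phases of the self-similarity
  recursion leave the sign (-1)^k. The square belongs to the convolution square of the Cantor
  measure, and since such a square can be absolutely continuous for a singular measure, its
  singularity needs an argument of its own; the criterion is therefore stated for any measure with
  the two properties at powers of 3.

  The 3-adic realization lives on integer sequences, while the Hartman classes quantify over one
  fixed type; realizations are therefore carried along an injection of the group.\<close>

definition cos_product :: "int \<Rightarrow> real" where
  "cos_product k = (\<Prod>j. (cos (2 * pi * (of_int k / 3 ^ Suc j)))\<^sup>2)"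

definition cos_partial_product :: "nat \<Rightarrow> int \<Rightarrow> real" where
  "cos_partial_product n k = (\<Prod>j<n. (cos (2 * pi * (of_int k / 3 ^ Suc j)))\<^sup>2)"

text \<open>A zero would make 4k an odd multiple of 3^(j+1), impossible by parity. Convergence of an
  infinite product includes a nonzero limit once zero factors are removed, so nonzero factors give a
  nonzero product.\<close>

lemma cos_factor_nonzero: "cos (2 * pi * (of_int k / 3 ^ Suc j)) \<noteq> (0::real)"
proof
  assume "cos (2 * pi * (of_int k / 3 ^ Suc j)) = (0::real)"
  then obtain n :: int where n: "odd n" "2 * pi * (of_int k / 3 ^ Suc j) = of_int n * (pi / 2)"
    unfolding cos_zero_iff_int by blast
  have "4 * pi * (of_int k :: real) = of_int n * pi * 3 ^ Suc j"
    using n(2) by (simp add: field_simps)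
  then have "of_int (4 * k) = (of_int (n * 3 ^ Suc j) :: real)"
    using pi_neq_zero by (simp add: field_simps)
  then have "4 * k = n * 3 ^ Suc j"
    by (simp only: of_int_eq_iff)
  moreover have "even (4 * k)" by simp
  ultimately have "even (n * 3 ^ Suc j)" by metis
  then show False using n(1) by simp
qed

text \<open>The factors differ from 1 by squared sines, hence by at most a constant times
  9^(-j).\<close>

lemma convergent_prod_cos_product:
  "convergent_prod (\<lambda>j. (cos (2 * pi * (of_int k / 3 ^ Suc j)) :: real)\<^sup>2)"
proof (rule abs_convergent_prod_imp_convergent_prod, rule summable_imp_abs_convergent_prod)
  let ?x = "\<lambda>j. 2 * pi * (of_int k / 3 ^ Suc j) :: real"
  have bound: "norm (norm ((cos (?x j))\<^sup>2 - 1)) \<le> (2 * pi * of_int k / 3)\<^sup>2 * (1 / 9) ^ j" for j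
  proof -
    have "norm (norm ((cos (?x j))\<^sup>2 - 1)) = (sin (?x j))\<^sup>2"
      by (simp add: cos_squared_eq)
    also have "\<dots> = \<bar>sin (?x j)\<bar>\<^sup>2" by simp
    also have "\<dots> \<le> \<bar>?x j\<bar>\<^sup>2"
      by (rule power_mono[OF abs_sin_x_le_abs_x]) simp
    also have "\<dots> = (2 * pi * of_int k / 3)\<^sup>2 * (1 / 9) ^ j"
    proof -
      have "(9::real) ^ j = (3 * 3) ^ j" by simp
      also have "\<dots> = (3 ^ j)\<^sup>2" by (simp only: power_mult_distrib power2_eq_square)
      finally have "(9::real) ^ j = (3 ^ j)\<^sup>2" .
      then show ?thesis
        by (simp add: power_divide power_mult_distrib field_simps power2_eq_square)
    qed
    finally show ?thesis .
  qed
  show "summable (\<lambda>j. norm ((cos (?x j))\<^sup>2 - 1))"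
    by (rule summable_comparison_test'[OF _ bound]) (intro summable_mult summable_geometric, simp)
qed

lemma cos_product_nonzero: "cos_product k \<noteq> 0"
  unfolding cos_product_def
  by (rule prodinf_nonzero[OF convergent_prod_cos_product]) (use cos_factor_nonzero in auto)

lemma cos_partial_product_tendsto:
  "(\<lambda>n. cos_partial_product n k) \<longlonglongrightarrow> cos_product k"
proof -
  have "(\<lambda>n. cos_partial_product (Suc n) k) \<longlonglongrightarrow> cos_product k"
    using convergent_prod_LIMSEQ[OF convergent_prod_cos_product[of k]]
    unfolding cos_partial_product_def cos_product_def lessThan_Suc_atMost .
  then show ?thesis by (rule LIMSEQ_imp_Suc)
qed

lemma cos_partial_product_nonneg: "0 \<le> cos_partial_product n k"
  unfolding cos_partial_product_def by (intro prod_nonneg) auto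

lemma cos_partial_product_Suc_le: "cos_partial_product (Suc n) k \<le> cos_partial_product n k"
proof -
  have "(cos (2 * pi * (of_int k / 3 ^ Suc n)))\<^sup>2 \<le> (1::real)"
    using abs_square_le_1 abs_cos_le_one by blast
  then show ?thesis
    using cos_partial_product_nonneg[of n k] unfolding cos_partial_product_def
    by (simp add: mult_left_le)
qed

lemma cos_partial_product_antimono: "decseq (\<lambda>n. cos_partial_product n k)"
  by (rule decseq_SucI) (rule cos_partial_product_Suc_le)

lemma cos_product_le_partial: "cos_product k \<le> cos_partial_product n k"
  by (rule decseq_ge[OF cos_partial_product_antimono cos_partial_product_tendsto])

lemma cos_product_nonneg: "0 \<le> cos_product k"
  by (rule LIMSEQ_le_const[OF cos_partial_product_tendsto]) (use cos_partial_product_nonneg in blast)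

lemma cos_product_le_1: "cos_product k \<le> 1"
  using cos_product_le_partial[of k 0] by (simp add: cos_partial_product_def)

lemma cos_period_int: "cos (x + 2 * pi * of_int m) = cos (x :: real)"
  using cos.plus_of_int[of x m] by (simp add: mult_ac)

lemma cos_partial_product_periodic:
  "cos_partial_product n (k + 3 ^ n * m) = cos_partial_product n k"
  unfolding cos_partial_product_def
proof (rule prod.cong[OF refl])
  fix j assume "j \<in> {..<n}"
  then have "(3::real) ^ n = 3 ^ Suc j * 3 ^ (n - Suc j)"
    by (simp flip: power_add power_Suc)
  then have "2 * pi * (of_int (k + 3 ^ n * m) / 3 ^ Suc j)
    = 2 * pi * (of_int k / 3 ^ Suc j) + 2 * pi * (of_int (3 ^ (n - Suc j) * m) :: real)"
    by (simp add: field_simps)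
  then show "(cos (2 * pi * (of_int (k + 3 ^ n * m) / 3 ^ Suc j)))\<^sup>2
    = (cos (2 * pi * (of_int k / 3 ^ Suc j)) :: real)\<^sup>2"
    by (simp only: cos_period_int)
qed

text \<open>With cos^2 y = (1 + cos 2y) / 2, the doubled angles are again equally spaced around the
  circle, so their cosines cancel. Each factor of the product thus has average 1/2 over thirds of a
  turn, the origin of 3/2 against 3.\<close>

lemma sum_cos_squared_thirds:
  "(\<Sum>r<3. (cos (x + 2 * pi * real r / 3))\<^sup>2) = 3 / 2"
proof -
  have c: "cos (2 * pi / 3) = - 1 / 2" "sin (2 * pi / 3) = sqrt 3 / 2"
    using cos_120 sin_120 by (simp_all add: mult.commute)
  have e: "2 * pi * 2 / 3 = 2 * pi - 2 * pi / 3" by simp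
  have d: "cos (2 * pi * 2 / 3) = - 1 / 2" "sin (2 * pi * 2 / 3) = - sqrt 3 / 2"
    unfolding e cos_diff sin_diff using c by simp_all
  have "(\<Sum>r<3. (cos (x + 2 * pi * real r / 3))\<^sup>2)
    = (cos x)\<^sup>2 + (cos (x + 2 * pi / 3))\<^sup>2 + (cos (x + 2 * pi * 2 / 3))\<^sup>2"
    by (simp add: numeral_3_eq_3)
  also have "\<dots> = 3 / 2 * ((cos x)\<^sup>2 + (sin x)\<^sup>2)"
    unfolding cos_add c d by (simp add: power2_eq_square algebra_simps del: sin_cos_squared_add3)
  finally show ?thesis by simp
qed

text \<open>A window of length 3^(n+1) is three consecutive windows of length 3^n. The first n
  factors repeat in each of them, while the angle of the last factor advances by a third of a turn
  from one to the next.\<close>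

lemma sum_cos_partial_product: "(\<Sum>i<3 ^ n. cos_partial_product n (m + int i)) = (3 / 2) ^ n"
proof (induction n)
  case 0
  then show ?case by (simp add: cos_partial_product_def)
next
  case (Suc n)
  let ?g = "\<lambda>i. cos_partial_product (Suc n) (m + int i)"
  have "(\<Sum>i<3 ^ Suc n. ?g i) = (\<Sum>r<3. sum ?g {r * 3 ^ n..<r * 3 ^ n + 3 ^ n})"
    by (simp add: sum.nat_group)
  also have "\<dots> = (\<Sum>r<3. \<Sum>i<3 ^ n. ?g (i + r * 3 ^ n))"
  proof (rule sum.cong[OF refl])
    fix r
    show "sum ?g {r * 3 ^ n..<r * 3 ^ n + 3 ^ n} = (\<Sum>i<3 ^ n. ?g (i + r * 3 ^ n))"
      using sum.shift_bounds_nat_ivl[of ?g 0 "r * 3 ^ n" "3 ^ n"]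
      by (simp only: lessThan_atLeast0 add_0 add.commute[of "3 ^ n"])
  qed
  also have "\<dots> = (\<Sum>i<3 ^ n. \<Sum>r<3. ?g (i + r * 3 ^ n))"
    by (rule sum.swap)
  also have "\<dots> = (\<Sum>i<3 ^ n. cos_partial_product n (m + int i) * (3 / 2))"
  proof (rule sum.cong[OF refl])
    fix i
    let ?x = "2 * pi * (of_int (m + int i) / 3 ^ Suc n) :: real"
    have "?g (i + r * 3 ^ n) = cos_partial_product n (m + int i) * (cos (?x + 2 * pi * real r / 3))\<^sup>2" for r
    proof -
      have "cos_partial_product n (m + int (i + r * 3 ^ n)) = cos_partial_product n (m + int i)"
        using cos_partial_product_periodic[of n "m + int i" "int r"] by (simp add: mult.commute add.assoc)
      moreover have "2 * pi * (of_int (m + int (i + r * 3 ^ n)) / 3 ^ Suc n) = ?x + 2 * pi * real r / 3"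
        by (simp add: field_simps)
      ultimately show ?thesis
        unfolding cos_partial_product_def prod.lessThan_Suc by (simp only:)
    qed
    then show "(\<Sum>r<3. ?g (i + r * 3 ^ n)) = cos_partial_product n (m + int i) * (3 / 2)"
      by (simp only: sum_cos_squared_thirds flip: sum_distrib_left)
  qed
  also have "\<dots> = (3 / 2) ^ Suc n"
    by (simp only: Suc.IH power_Suc2 flip: sum_distrib_right)
  finally show ?case .
qed

lemma sum_cos_product_le: "(\<Sum>i<3 ^ n. cos_product (m + int i)) \<le> (3 / 2) ^ n"
  unfolding sum_cos_partial_product[of n m, symmetric] by (intro sum_mono cos_product_le_partial)

section \<open>The Cantor measure and its transform\<close>

lemma exp_eq_cis: "exp (2 * of_real pi * \<i> * of_int k * of_real x) = cis (2 * pi * (of_int k * x))"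
  by (simp add: cis_conv_exp mult_ac)

lemma fourier_stieltjes_cis: "fourier_stieltjes \<mu> k = (LINT x|\<mu>. cis (2 * pi * (of_int k * x)))"
  by (simp add: fourier_stieltjes_def exp_eq_cis)

lemma borel_measurable_cis [measurable]: "cis \<in> borel_measurable borel"
  by (intro borel_measurable_continuous_onI continuous_intros)

lemma borel_measurable_frac [measurable]: "(frac :: real \<Rightarrow> real) \<in> borel_measurable borel"
  unfolding frac_def by measurable

lemma cis_frac: "cis (2 * pi * (of_int k * frac x)) = cis (2 * pi * (of_int k * x))"
proof -
  have "2 * pi * (of_int k * frac x) = 2 * pi * (of_int k * x) - 2 * pi * of_int (k * \<lfloor>x\<rfloor>)"
    by (simp add: frac_def algebra_simps)
  also have "cis \<dots> = cis (2 * pi * (of_int k * x))"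
    by (simp only: cis_multiple_2pi[of "of_int (k * \<lfloor>x\<rfloor>)", simplified] flip: cis_divide) simp
  finally show ?thesis .
qed

lemma space_circle_borel [simp]: "space circle_borel = {0..<1}"
  by (simp add: circle_borel_def space_restrict_space)

lemma space_circle_lebesgue [simp]: "space circle_lebesgue = {0..<1}"
  by (simp add: circle_lebesgue_def space_restrict_space)

lemma sets_circle_lebesgue [measurable_cong]: "sets circle_lebesgue = sets circle_borel"
  unfolding circle_lebesgue_def circle_borel_def by (intro sets_restrict_space_cong) simp

lemma borel_measurable_circle [measurable (raw)]:
  "f \<in> borel_measurable borel \<Longrightarrow> f \<in> borel_measurable circle_borel"
  unfolding circle_borel_def by (rule measurable_restrict_space1)

lemma measurable_circle_frac [measurable]: "frac \<in> measurable borel circle_borel"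
  unfolding circle_borel_def
  by (rule measurable_restrict_space2) (auto simp: frac_lt_1)

lemma prob_space_circle_lebesgue: "prob_space circle_lebesgue"
  by (rule prob_spaceI) (simp, simp add: circle_lebesgue_def emeasure_restrict_space)

lemma integral_circle_lebesgue:
  fixes g :: "real \<Rightarrow> complex"
  shows "integral\<^sup>L circle_lebesgue g = (LINT x|lborel. indicator {0..<1} x *\<^sub>R g x)"
  unfolding circle_lebesgue_def by (rule integral_restrict_space) simp

lemma fourier_stieltjes_circle_lebesgue:
  assumes "k \<noteq> 0"
  shows "fourier_stieltjes circle_lebesgue k = 0"
proof -
  define F where "F = (\<lambda>x. cis (2 * pi * (of_int k * x)) / (\<i> * (2 * pi * of_int k)))"
  have "(F has_vector_derivative cis (2 * pi * (of_int k * x))) (at x within A)" for x A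
    unfolding F_def cis_conv_exp using assms
    by (auto intro!: derivative_eq_intros has_vector_derivative_real_field simp: field_simps)
  then have "(LINT x|lborel. indicator {0..1} x *\<^sub>R cis (2 * pi * (of_int k * x))) = F 1 - F 0"
    by (intro integral_FTC_atLeastAtMost) (auto intro!: continuous_intros)
  moreover have "F 1 = F 0"
    by (simp add: F_def cis_multiple_2pi)
  moreover have "fourier_stieltjes circle_lebesgue k
    = (LINT x|lborel. indicator {0..1} x *\<^sub>R cis (2 * pi * (of_int k * x)))"
    unfolding fourier_stieltjes_cis integral_circle_lebesgue
  proof (rule integral_cong_AE)
    have "AE x in lborel. x \<noteq> (1::real)"
      by (rule AE_lborel_singleton)
    then show "AE x in lborel. indicat_real {0..<1} x *\<^sub>R cis (2 * pi * (of_int k * x))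
      = indicat_real {0..1} x *\<^sub>R cis (2 * pi * (of_int k * x))"
      by eventually_elim (auto simp: indicator_def)
  qed measurable
  ultimately show ?thesis by simp
qed

section \<open>Self-similarity of the Cantor map and the recursion for its transform\<close>

lemma binary_to_cantor_summable: "summable (\<lambda>i. 2 * of_int (binary_digit x i) / (3::real) ^ Suc i)"
proof (rule summable_comparison_test')
  show "summable (\<lambda>i. (2 / 3) * (1 / 3 :: real) ^ i)"
    by (intro summable_mult summable_geometric) simp
  show "norm (2 * of_int (binary_digit x i) / (3::real) ^ Suc i) \<le> (2 / 3) * (1 / 3) ^ i" for i
  proof -
    have "0 \<le> binary_digit x i" "binary_digit x i \<le> 1"
      unfolding binary_digit_def by presburger+
    then show ?thesis
      by (simp add: field_simps power_one_over)
  qed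
qed

lemma borel_measurable_binary_to_cantor [measurable]: "binary_to_cantor \<in> borel_measurable borel"
proof -
  have [measurable]: "(\<lambda>x. real_of_int (binary_digit x i)) \<in> borel_measurable borel" for i
    unfolding binary_digit_def by measurable
  show ?thesis
    unfolding binary_to_cantor_def by (intro borel_measurable_suminf) measurable
qed

text \<open>Halving \<open>x\<close> or \<open>1 + x\<close> prepends the binary digit 0 or 1; on
  the ternary side the new digit is 0 or 2 and the rest is divided by 3. These are the two
  contractions that generate the Cantor set.\<close>

lemma binary_to_cantor_half:
  assumes "0 \<le> x" "x < 1"
  shows "binary_to_cantor (x / 2) = binary_to_cantor x / 3"
    and "binary_to_cantor ((1 + x) / 2) = 2 / 3 + binary_to_cantor x / 3"
proof -
  have 1: "binary_to_cantor y = 2 * of_int (binary_digit y 0) / 3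
      + (\<Sum>i. 2 * of_int (binary_digit y (Suc i)) / 3 ^ Suc (Suc i))" for y
    unfolding binary_to_cantor_def
    using suminf_split_head[OF binary_to_cantor_summable[of y]] by simp
  have 2: "(\<Sum>i. 2 * of_int (binary_digit x i) / 3 ^ Suc (Suc i)) = binary_to_cantor x / 3"
    using suminf_divide[OF binary_to_cantor_summable[of x], of 3]
    by (simp add: binary_to_cantor_def field_simps)
  have "binary_digit (x / 2) 0 = 0"
    using assms by (simp add: binary_digit_def floor_eq_iff)
  moreover have "binary_digit (x / 2) (Suc i) = binary_digit x i" for i
  proof -
    have "2 ^ Suc (Suc i) * (x / 2) = 2 ^ Suc i * x" by simp
    then show ?thesis unfolding binary_digit_def by (simp only:)
  qed
  ultimately show "binary_to_cantor (x / 2) = binary_to_cantor x / 3"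
    using 1[of "x / 2"] 2 by simp
  have "binary_digit ((1 + x) / 2) 0 = 1"
  proof -
    have "\<lfloor>1 + x\<rfloor> = 1" using assms by (simp add: floor_eq_iff)
    moreover have "2 ^ Suc 0 * ((1 + x) / 2) = 1 + x" by simp
    ultimately show ?thesis unfolding binary_digit_def by (simp only:) simp
  qed
  moreover have "binary_digit ((1 + x) / 2) (Suc i) = binary_digit x i" for i
  proof -
    have "2 ^ Suc (Suc i) * ((1 + x) / 2) = 2 ^ Suc i * x + of_int (2 ^ Suc i)"
      by (simp add: algebra_simps)
    then have "\<lfloor>2 ^ Suc (Suc i) * ((1 + x) / 2)\<rfloor> = \<lfloor>2 ^ Suc i * x\<rfloor> + 2 ^ Suc i"
      by (simp only: floor_add_int)
    then show ?thesis
      unfolding binary_digit_def by simp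
  qed
  ultimately show "binary_to_cantor ((1 + x) / 2) = 2 / 3 + binary_to_cantor x / 3"
    using 1[of "(1 + x) / 2"] 2 by simp
qed

text \<open>The interval is cut at 1/2 and each half rescaled to \<open>{0..<1}\<close>, with
  Jacobian 1/2. The norm bound supplies integrability.\<close>

lemma integral_circle_lebesgue_halves:
  fixes g :: "real \<Rightarrow> complex"
  assumes [measurable]: "g \<in> borel_measurable borel" and "\<And>x. norm (g x) \<le> 1"
  shows "integral\<^sup>L circle_lebesgue g
    = (LINT x|circle_lebesgue. g (x / 2)) / 2 + (LINT x|circle_lebesgue. g ((1 + x) / 2)) / 2"
proof -
  have int: "integrable lborel (\<lambda>x. indicator {a..<b} x *\<^sub>R g x)" for a b :: real
  proof (rule Bochner_Integration.integrable_bound)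
    show "integrable lborel (indicat_real {a..<b})"
      by (cases "a \<le> b") (simp_all add: integrable_indicator_iff)
    show "AE x in lborel. norm (indicator {a..<b} x *\<^sub>R g x) \<le> norm (indicat_real {a..<b} x)"
      using assms(2) by (auto simp: indicator_def)
  qed measurable
  have "integral\<^sup>L circle_lebesgue g
    = (LINT x|lborel. indicator {0..<1/2} x *\<^sub>R g x + indicator {1/2..<1} x *\<^sub>R g x)"
    unfolding integral_circle_lebesgue
    by (intro Bochner_Integration.integral_cong) (auto simp: indicator_def)
  also have "\<dots> = (LINT x|lborel. indicator {0..<1/2} x *\<^sub>R g x) + (LINT x|lborel. indicator {1/2..<1} x *\<^sub>R g x)"
    by (rule Bochner_Integration.integral_add[OF int int])
  also have "(LINT x|lborel. indicator {0..<1/2} x *\<^sub>R g x) = (LINT x|circle_lebesgue. g (x / 2)) / 2"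
    by (subst lborel_integral_real_affine[of "1/2" _ 0])
      (auto simp: integral_circle_lebesgue indicator_def scaleR_conv_of_real intro!: Bochner_Integration.integral_cong)
  also have "(LINT x|lborel. indicator {1/2..<1} x *\<^sub>R g x) = (LINT x|circle_lebesgue. g ((1 + x) / 2)) / 2"
    by (subst lborel_integral_real_affine[of "1/2" _ "1/2"])
      (auto simp: integral_circle_lebesgue indicator_def scaleR_conv_of_real field_simps intro!: Bochner_Integration.integral_cong)
  finally show ?thesis .
qed

text \<open>The argument is real because the recursion divides it by 3; at integers this is the
  transform of \<open>cantor_measure\<close>.\<close>

definition cantor_transform :: "real \<Rightarrow> complex" where
  "cantor_transform t = (LINT x|circle_lebesgue. cis (2 * pi * (t * binary_to_cantor x)))"

lemma cantor_transform_0: "cantor_transform 0 = 1"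
proof -
  interpret prob_space circle_lebesgue by (rule prob_space_circle_lebesgue)
  show ?thesis using prob_space by (simp add: cantor_transform_def)
qed

lemma cantor_transform_rec:
  "cantor_transform t = (1 + cis (2 * pi * (2 * t / 3))) / 2 * cantor_transform (t / 3)"
proof -
  have "cantor_transform t = (LINT x|circle_lebesgue. cis (2 * pi * (t * binary_to_cantor (x / 2)))) / 2
      + (LINT x|circle_lebesgue. cis (2 * pi * (t * binary_to_cantor ((1 + x) / 2)))) / 2"
    unfolding cantor_transform_def by (rule integral_circle_lebesgue_halves) simp_all
  also have "(LINT x|circle_lebesgue. cis (2 * pi * (t * binary_to_cantor (x / 2)))) = cantor_transform (t / 3)"
    unfolding cantor_transform_def
    by (intro Bochner_Integration.integral_cong) (auto simp: binary_to_cantor_half)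
  also have "(LINT x|circle_lebesgue. cis (2 * pi * (t * binary_to_cantor ((1 + x) / 2))))
    = (LINT x|circle_lebesgue. cis (2 * pi * (2 * t / 3)) * cis (2 * pi * (t / 3 * binary_to_cantor x)))"
  proof (rule Bochner_Integration.integral_cong[OF refl])
    fix x assume "x \<in> space circle_lebesgue"
    then have "binary_to_cantor ((1 + x) / 2) = 2 / 3 + binary_to_cantor x / 3"
      by (simp add: binary_to_cantor_half)
    then show "cis (2 * pi * (t * binary_to_cantor ((1 + x) / 2)))
      = cis (2 * pi * (2 * t / 3)) * cis (2 * pi * (t / 3 * binary_to_cantor x))"
      by (simp add: cis_mult algebra_simps)
  qed
  also have "\<dots> = cis (2 * pi * (2 * t / 3)) * cantor_transform (t / 3)"
    unfolding cantor_transform_def by simp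
  finally show ?thesis by (simp add: field_simps)
qed

text \<open>Continuity is what closes the recursion: the remaining factors have arguments such as k
  / 3^n or 1 - 3^(-n), with limits 0 and 1. The integrands are dominated by 1.\<close>

lemma cantor_transform_tendsto:
  assumes "t \<longlonglongrightarrow> s"
  shows "(\<lambda>n. cantor_transform (t n)) \<longlonglongrightarrow> cantor_transform s"
  unfolding cantor_transform_def
proof (rule integral_dominated_convergence)
  interpret prob_space circle_lebesgue by (rule prob_space_circle_lebesgue)
  show "integrable circle_lebesgue (\<lambda>_. 1 :: real)" by simp
  show "AE x in circle_lebesgue. (\<lambda>n. cis (2 * pi * (t n * binary_to_cantor x)))
      \<longlonglongrightarrow> cis (2 * pi * (s * binary_to_cantor x))"
    by (intro AE_I2 tendsto_intros assms)
qed simp_all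

lemma fourier_stieltjes_cantor_measure: "fourier_stieltjes cantor_measure k = cantor_transform (of_int k)"
  unfolding fourier_stieltjes_cis cantor_measure_def cantor_transform_def
  by (subst integral_distr) (measurable, simp add: cis_frac)

text \<open>At \<open>3 * k\<close> the factor of the recursion is (1 + cis (4 pi k)) / 2, which is
  1 for an integer \<open>k\<close>.\<close>

lemma cantor_transform_mult_3: "cantor_transform (3 * of_int k) = cantor_transform (of_int k)"
  using cantor_transform_rec[of "3 * of_int k"] cis_multiple_2pi[of "2 * of_int k"] by simp

lemma cantor_transform_prod:
  "cantor_transform t = (\<Prod>j<n. (1 + cis (2 * pi * (2 * t / 3 ^ Suc j))) / 2) * cantor_transform (t / 3 ^ n)"
proof (induction n)
  case (Suc n)
  then show ?case using cantor_transform_rec[of "t / 3 ^ n"] by (simp add: mult.commute mult.assoc)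
qed simp

text \<open>Half-angle factorization 1 + cis (2y) = 2 cos y cis y; its square is one factor of the
  cosine product times a phase.\<close>

lemma one_plus_cis_squared: "((1 + cis (2 * y)) / 2)\<^sup>2 = cis (2 * y) * of_real ((cos y)\<^sup>2)"
proof -
  have "1 + cis (2 * y) = cis y * (cis (- y) + cis y)"
    by (simp add: distrib_left cis_mult)
  also have "cis (- y) + cis y = 2 * of_real (cos y)"
    by (simp add: complex_eq_iff)
  finally have "(1 + cis (2 * y)) / 2 = cis y * of_real (cos y)" by simp
  moreover have "(cis y)\<^sup>2 = cis (2 * y)"
    by (simp add: power2_eq_square cis_mult)
  ultimately show ?thesis by (simp add: power_mult_distrib)
qed

text \<open>By the geometric sum of 2 / 3^(j+1), the phases of the first n squared factors add up to
  2 pi k (1 - 3^(-n)) and tend to a full number of turns. The rest is the squared transform at k /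
  3^n, which tends to 1.\<close>

lemma cantor_transform_squared: "(cantor_transform (of_int k))\<^sup>2 = of_real (cos_product k)"
proof -
  let ?c = "\<lambda>n. cis (2 * pi * (of_int k * (1 - 1 / 3 ^ n)))"
  have prod: "(\<Prod>j<n. ((1 + cis (2 * pi * (2 * of_int k / 3 ^ Suc j))) / 2)\<^sup>2)
    = ?c n * of_real (cos_partial_product n k)" for n
  proof (induction n)
    case (Suc n)
    have "((1 + cis (2 * pi * (2 * of_int k / 3 ^ Suc n))) / 2)\<^sup>2
      = cis (2 * pi * (2 * of_int k / 3 ^ Suc n)) * of_real ((cos (2 * pi * (of_int k / 3 ^ Suc n)))\<^sup>2)"
      using one_plus_cis_squared[of "2 * pi * (of_int k / 3 ^ Suc n)"] by (simp add: mult_ac)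
    moreover have "?c n * cis (2 * pi * (2 * of_int k / 3 ^ Suc n)) = ?c (Suc n)"
      unfolding cis_mult by (rule arg_cong[of _ _ cis]) (simp add: field_simps)
    ultimately show ?case
      using Suc.IH by (simp add: cos_partial_product_def mult_ac)
  qed (simp add: cos_partial_product_def)
  have inv: "(\<lambda>n. of_int k / 3 ^ n) \<longlonglongrightarrow> (0::real)"
    using LIMSEQ_divide_realpow_zero[of 3 "of_int k"] by simp
  have c: "?c \<longlonglongrightarrow> cis (2 * pi * (of_int k - 0))"
    unfolding right_diff_distrib[of "of_int k"] mult_1_right times_divide_eq_right
    by (intro tendsto_intros inv)
  have "(\<lambda>n. ?c n * of_real (cos_partial_product n k) * (cantor_transform (of_int k / 3 ^ n))\<^sup>2)
    \<longlonglongrightarrow> cis (2 * pi * (of_int k - 0)) * of_real (cos_product k) * (cantor_transform 0)\<^sup>2"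
    by (intro tendsto_mult tendsto_power cantor_transform_tendsto tendsto_of_real
      cos_partial_product_tendsto c inv)
  \<comment> \<open>By the n-fold recursion the sequence is constant in \<open>n\<close>, so its
    limit is the squared transform itself.\<close>
  moreover have "?c n * of_real (cos_partial_product n k) * (cantor_transform (of_int k / 3 ^ n))\<^sup>2
    = (cantor_transform (of_int k))\<^sup>2" for n
    by (subst (2) cantor_transform_prod[of _ n]) (simp only: power_mult_distrib prod_power_distrib prod)
  ultimately show ?thesis
    by (simp add: cantor_transform_0 cis_multiple_2pi LIMSEQ_const_iff)
qed

lemma cantor_transform_nonzero: "cantor_transform (of_int k) \<noteq> 0"
  using cantor_transform_squared[of k] cos_product_nonzero[of k] by auto

lemma prob_space_cantor_measure: "prob_space cantor_measure"
  unfolding cantor_measure_def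
  by (rule prob_space.prob_space_distr[OF prob_space_circle_lebesgue]) measurable

lemma sets_cantor_measure [measurable_cong]: "sets cantor_measure = sets circle_borel"
  by (simp add: cantor_measure_def)

lemma fourier_stieltjes_convolution:
  assumes "prob_space \<mu>" "prob_space \<nu>"
    and [measurable_cong]: "sets \<mu> = sets circle_borel" "sets \<nu> = sets circle_borel"
  shows "fourier_stieltjes (circle_convolution \<mu> \<nu>) k = fourier_stieltjes \<mu> k * fourier_stieltjes \<nu> k"
proof -
  interpret \<mu>: prob_space \<mu> by fact
  interpret \<nu>: prob_space \<nu> by fact
  interpret pair_prob_space \<mu> \<nu> ..
  have [measurable]: "(\<lambda>x. x) \<in> borel_measurable \<mu>" "(\<lambda>x. x) \<in> borel_measurable \<nu>"
    by measurable
  have "fourier_stieltjes (circle_convolution \<mu> \<nu>) k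
    = (LINT z|(\<mu> \<Otimes>\<^sub>M \<nu>). cis (2 * pi * (of_int k * fst z)) * cis (2 * pi * (of_int k * snd z)))"
    unfolding fourier_stieltjes_cis circle_convolution_def
    by (subst integral_distr) (measurable, simp only: cis_frac case_prod_beta cis_mult distrib_left)
  also have "\<dots> = (LINT x|\<mu>. LINT y|\<nu>. cis (2 * pi * (of_int k * x)) * cis (2 * pi * (of_int k * y)))"
  proof (subst integral_fst'[symmetric])
    show "integrable (\<mu> \<Otimes>\<^sub>M \<nu>) (\<lambda>z. cis (2 * pi * (of_int k * fst z)) * cis (2 * pi * (of_int k * snd z)))"
      by (rule P.integrable_const_bound[of _ 1]) (auto simp: norm_mult)
  qed simp
  also have "\<dots> = fourier_stieltjes \<mu> k * fourier_stieltjes \<nu> k"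
    unfolding fourier_stieltjes_cis by simp
  finally show ?thesis .
qed

section \<open>Singularity\<close>

lemma Cesaro_tendsto_0:
  fixes g :: "nat \<Rightarrow> real"
  assumes "g \<longlonglongrightarrow> 0" "\<And>n. 0 \<le> g n"
  shows "(\<lambda>n. (\<Sum>d<Suc n. g d) / real (Suc n)) \<longlonglongrightarrow> 0"
proof (rule LIMSEQ_I)
  fix e :: real assume "0 < e"
  then obtain D where D: "\<And>d. d \<ge> D \<Longrightarrow> g d < e / 2"
    using LIMSEQ_D[OF assms(1), of "e / 2"] assms(2) by auto
  define S where "S = (\<Sum>d<D. g d)"
  obtain N where N: "2 * S / e < real N"
    using reals_Archimedean2 by blast
  have "norm ((\<Sum>d<Suc n. g d) / real (Suc n) - 0) < e" if n: "n \<ge> N" for n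
  proof -
    have "(\<Sum>d<Suc n. g d) \<le> (\<Sum>d<Suc n. (if d < D then g d else 0) + e / 2)"
      using D \<open>0 < e\<close> assms(2) by (intro sum_mono) (auto simp: not_less intro: less_imp_le)
    also have "\<dots> = (\<Sum>d\<in>{..<Suc n} \<inter> {..<D}. g d) + real (Suc n) * (e / 2)"
      by (simp only: sum.distrib sum_constant card_lessThan lessThan_iff
        flip: sum.inter_restrict[OF finite_lessThan]) (simp add: sum.inter_restrict)
    also have "(\<Sum>d\<in>{..<Suc n} \<inter> {..<D}. g d) \<le> S"
      unfolding S_def by (rule sum_mono2) (use assms(2) in auto)
    also have "S < real (Suc n) * (e / 2)"
    proof -
      have "S < real N * (e / 2)"
        using N \<open>0 < e\<close> by (simp add: field_simps)
      also have "\<dots> \<le> real (Suc n) * (e / 2)"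
        using n \<open>0 < e\<close> by (intro mult_right_mono) auto
      finally show ?thesis .
    qed
    finally have "(\<Sum>d<Suc n. g d) < real (Suc n) * e" by (simp add: mult.commute)
    moreover have "0 \<le> (\<Sum>d<Suc n. g d)" using assms(2) by (rule sum_nonneg)
    ultimately have "0 \<le> (\<Sum>d<Suc n. g d) / real (Suc n)" "(\<Sum>d<Suc n. g d) / real (Suc n) < e"
      using pos_divide_less_eq[of "real (Suc n)" "\<Sum>d<Suc n. g d" e] by (simp, simp only: of_nat_0_less_iff zero_less_Suc mult.commute[of e])
    then show ?thesis by (simp only: real_norm_def diff_zero abs_of_nonneg)
  qed
  then show "\<exists>no. \<forall>n\<ge>no. norm ((\<Sum>d<Suc n. g d) / real (Suc n) - 0) < e" by blast
qed

text \<open>Around \<open>i\<close> each distance occurs at most once on either side, hence the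
  factor 2 and a bound independent of \<open>i\<close>.\<close>

lemma sum_abs_diff_le:
  fixes g :: "nat \<Rightarrow> real"
  assumes "\<And>n. 0 \<le> g n" and "i < N"
  shows "(\<Sum>j<N. g (nat \<bar>int i - int j\<bar>)) \<le> 2 * (\<Sum>d<N. g d)"
proof -
  have "(\<Sum>j<N. g (nat \<bar>int i - int j\<bar>))
    = (\<Sum>j\<in>{..i}. g (nat \<bar>int i - int j\<bar>)) + (\<Sum>j\<in>{Suc i..<N}. g (nat \<bar>int i - int j\<bar>))"
    using assms(2) by (subst sum.union_disjoint[symmetric]) (auto intro: sum.cong)
  also have "(\<Sum>j\<in>{..i}. g (nat \<bar>int i - int j\<bar>)) = (\<Sum>d\<in>{..i}. g d)"
    by (rule sum.reindex_bij_witness[of _ "\<lambda>d. i - d" "\<lambda>d. i - d"]) (auto simp: of_nat_diff intro: arg_cong)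
  also have "(\<Sum>d\<in>{..i}. g d) \<le> (\<Sum>d<N. g d)"
    by (rule sum_mono2) (use assms in auto)
  also have "(\<Sum>j\<in>{Suc i..<N}. g (nat \<bar>int i - int j\<bar>)) = (\<Sum>d\<in>{1..<N - i}. g d)"
    by (rule sum.reindex_bij_witness[of _ "\<lambda>d. i + d" "\<lambda>d. d - i"]) (auto simp: of_nat_diff intro: arg_cong)
  also have "(\<Sum>d\<in>{1..<N - i}. g d) \<le> (\<Sum>d<N. g d)"
    by (rule sum_mono2) (use assms in auto)
  finally show ?thesis by simp
qed

lemma fourier_stieltjes_minus: "fourier_stieltjes \<mu> (- k) = cnj (fourier_stieltjes \<mu> k)"
proof -
  have "fourier_stieltjes \<mu> (- k) = (LINT x|\<mu>. cnj (cis (2 * pi * (of_int k * x))))"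
    unfolding fourier_stieltjes_cis by (simp add: cis_cnj)
  then show ?thesis
    unfolding fourier_stieltjes_cis by (simp only: Bochner_Integration.integral_cnj)
qed

text \<open>Birkhoff average of the character of frequency 1 along the tripling map of the circle;
  \<open>Suc n\<close> terms exclude the empty mean.\<close>

definition lacunary_mean :: "nat \<Rightarrow> real \<Rightarrow> complex" where
  "lacunary_mean n x = (\<Sum>j<Suc n. cis (2 * pi * (3 ^ j * x))) / of_nat (Suc n)"

lemma borel_measurable_lacunary_mean [measurable]: "lacunary_mean n \<in> borel_measurable borel"
  unfolding lacunary_mean_def by measurable

text \<open>A mean ergodic theorem by correlations. Invariance under tripling makes the correlation
  of the centred characters \<open>Y i\<close> and \<open>Y j\<close> depend, up to conjugation, on
  the lag alone, and \<open>mix\<close> sends it to 0 as the lag grows. The mean square is the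
  average of all correlations, hence at most twice a Cesaro mean of their moduli
  \<open>g d\<close>.\<close>

lemma lacunary_mean_L2:
  assumes "prob_space \<mu>" and [measurable_cong]: "sets \<mu> = sets circle_borel"
    and inv: "\<And>k. fourier_stieltjes \<mu> (3 * k) = fourier_stieltjes \<mu> k"
    and a: "a = fourier_stieltjes \<mu> 1"
    and mix: "(\<lambda>n. fourier_stieltjes \<mu> (3 ^ n - 1)) \<longlonglongrightarrow> a * cnj a"
  shows "(\<lambda>n. LINT x|\<mu>. (norm (lacunary_mean n x - a))\<^sup>2) \<longlonglongrightarrow> 0"
proof -
  interpret prob_space \<mu> by fact
  let ?h = "fourier_stieltjes \<mu>"
  define g where "g d = norm (?h (3 ^ d - 1) - a * cnj a)" for d
  define Y where "Y j x = cis (2 * pi * (3 ^ j * x)) - a" for j :: nat and x :: real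
  have [measurable]: "Y j \<in> borel_measurable borel" for j
    unfolding Y_def by measurable
  have inv': "?h (3 ^ n * k) = ?h k" for n k
    by (induction n) (simp_all add: inv mult.assoc)
  have int1: "integrable \<mu> (\<lambda>x. cis (2 * pi * (r * x)))" for r
    by (rule integrable_const_bound[of _ 1]) simp_all
  have h: "(LINT x|\<mu>. cis (2 * pi * ((3 ^ j) * x))) = a" for j
    using inv'[of j 1] a by (simp add: fourier_stieltjes_cis)
  have intY: "integrable \<mu> (\<lambda>x. Y i x * cnj (Y j x))" for i j
  proof (rule integrable_const_bound[of _ "(1 + norm a) * (1 + norm a)"])
    have "norm (Y i x) \<le> 1 + norm a" for i x
      unfolding Y_def using norm_triangle_ineq4[of "cis (2 * pi * (3 ^ i * x))" a] by simp
    then show "AE x in \<mu>. norm (Y i x * cnj (Y j x)) \<le> (1 + norm a) * (1 + norm a)"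
      by (intro AE_I2) (simp add: norm_mult mult_mono')
    have [measurable]: "cnj \<in> borel_measurable borel"
      by (intro borel_measurable_continuous_onI continuous_intros)
    show "(\<lambda>x. Y i x * cnj (Y j x)) \<in> borel_measurable \<mu>"
      by measurable
  qed
  have cov: "(LINT x|\<mu>. Y i x * cnj (Y j x)) = ?h (3 ^ i - 3 ^ j) - a * cnj a" for i j
  proof -
    have "Y i x * cnj (Y j x) = cis (2 * pi * ((3 ^ i - 3 ^ j) * x)) - a * cnj (cis (2 * pi * (3 ^ j * x)))
      - cnj a * cis (2 * pi * (3 ^ i * x)) + a * cnj a" for x
      unfolding Y_def by (simp add: algebra_simps cis_cnj cis_mult)
    then have "(LINT x|\<mu>. Y i x * cnj (Y j x)) = (LINT x|\<mu>. cis (2 * pi * ((3 ^ i - 3 ^ j) * x)))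
      - a * (LINT x|\<mu>. cnj (cis (2 * pi * (3 ^ j * x))))
      - cnj a * (LINT x|\<mu>. cis (2 * pi * (3 ^ i * x))) + a * cnj a"
      using int1 by (simp add: prob_space)
    also have "(LINT x|\<mu>. cnj (cis (2 * pi * (3 ^ j * x)))) = cnj a"
      by (simp only: Bochner_Integration.integral_cnj h)
    finally show ?thesis by (simp add: h fourier_stieltjes_cis)
  qed
  have norm_cov: "norm (LINT x|\<mu>. Y i x * cnj (Y j x)) = g (nat \<bar>int i - int j\<bar>)" for i j
  proof (cases "j \<le> i")
    case True
    then have "(3::int) ^ i - 3 ^ j = 3 ^ j * (3 ^ (i - j) - 1)"
      by (simp add: right_diff_distrib flip: power_add)
    with True show ?thesis
      by (simp add: cov inv' g_def nat_diff_distrib flip: of_nat_diff)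
  next
    case False
    then have "(3::int) ^ i - 3 ^ j = - (3 ^ i * (3 ^ (j - i) - 1))"
      by (simp add: right_diff_distrib flip: power_add)
    then have "(LINT x|\<mu>. Y i x * cnj (Y j x)) = cnj (?h (3 ^ (j - i) - 1) - a * cnj a)"
      unfolding cov by (simp add: fourier_stieltjes_minus inv')
    moreover have "nat \<bar>int i - int j\<bar> = j - i" using False by simp
    ultimately show ?thesis unfolding g_def by (simp only: complex_mod_cnj)
  qed
  have bound: "(LINT x|\<mu>. (norm (lacunary_mean n x - a))\<^sup>2) \<le> 2 * ((\<Sum>d<Suc n. g d) / real (Suc n))" for n
  proof -
    let ?N = "Suc n"
    have mean: "lacunary_mean n x - a = (\<Sum>j<?N. Y j x) / of_nat ?N" for x
      unfolding lacunary_mean_def Y_def sum_subtractf by (simp add: field_simps del: sum.lessThan_Suc of_nat_Suc)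
    have sq: "complex_of_real ((norm (lacunary_mean n x - a))\<^sup>2)
      = (\<Sum>i<?N. \<Sum>j<?N. Y i x * cnj (Y j x)) / of_nat (?N * ?N)" for x
      unfolding complex_norm_square mean
      by (simp add: sum_product del: sum.lessThan_Suc of_nat_Suc mult_Suc mult_Suc_right)
    have "complex_of_real (LINT x|\<mu>. (norm (lacunary_mean n x - a))\<^sup>2)
      = (LINT x|\<mu>. (\<Sum>i<?N. \<Sum>j<?N. Y i x * cnj (Y j x)) / of_nat (?N * ?N))"
      unfolding integral_complex_of_real[symmetric] sq ..
    also have "\<dots> = (\<Sum>i<?N. \<Sum>j<?N. LINT x|\<mu>. Y i x * cnj (Y j x)) / of_nat (?N * ?N)"
      using intY by (simp del: sum.lessThan_Suc of_nat_Suc of_nat_mult)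
    finally have "norm (complex_of_real (LINT x|\<mu>. (norm (lacunary_mean n x - a))\<^sup>2))
      = norm (\<Sum>i<?N. \<Sum>j<?N. LINT x|\<mu>. Y i x * cnj (Y j x)) / real (?N * ?N)"
      by (simp only: norm_divide norm_of_nat)
    also have "\<dots> \<le> (\<Sum>i<?N. \<Sum>j<?N. g (nat \<bar>int i - int j\<bar>)) / real (?N * ?N)"
      unfolding norm_cov[symmetric]
      by (intro divide_right_mono order_trans[OF norm_sum] sum_mono norm_sum order_refl) simp
    also have "\<dots> \<le> (\<Sum>i<?N. 2 * (\<Sum>d<?N. g d)) / real (?N * ?N)"
      by (intro divide_right_mono sum_mono sum_abs_diff_le) (auto simp: g_def)
    also have "\<dots> = 2 * ((\<Sum>d<?N. g d) / real ?N)"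
      by (simp only: sum_constant card_lessThan of_nat_mult) (simp add: field_simps del: sum.lessThan_Suc of_nat_Suc)
    finally show ?thesis by simp
  qed
  have "g \<longlonglongrightarrow> 0"
    unfolding g_def using tendsto_norm_zero[OF LIM_zero[OF mix]] .
  then have "(\<lambda>n. (\<Sum>d<Suc n. g d) / real (Suc n)) \<longlonglongrightarrow> 0"
    by (rule Cesaro_tendsto_0) (simp add: g_def)
  then have "(\<lambda>n. 2 * ((\<Sum>d<Suc n. g d) / real (Suc n))) \<longlonglongrightarrow> 2 * 0"
    by (rule tendsto_mult_left)
  then show ?thesis
    unfolding mult_zero_right
    by (rule tendsto_sandwich[OF _ _ tendsto_const, rotated 2])
      (use bound in \<open>auto simp del: sum.lessThan_Suc of_nat_Suc\<close>)
qed

lemma integrable_lacunary_mean_diff: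
  assumes "prob_space \<mu>" and [measurable_cong]: "sets \<mu> = sets circle_borel"
  shows "integrable \<mu> (\<lambda>x. (norm (lacunary_mean n x - a))\<^sup>2)"
proof -
  interpret prob_space \<mu> by fact
  show ?thesis
  proof (rule integrable_const_bound[of _ "(1 + norm a)\<^sup>2"])
    have "norm (lacunary_mean n x) \<le> 1" for x
    proof -
      have "norm (\<Sum>j<Suc n. cis (2 * pi * (3 ^ j * x))) \<le> (\<Sum>j<Suc n. 1)"
        by (rule sum_norm_le) simp
      then show ?thesis
        by (simp add: lacunary_mean_def norm_divide del: sum.lessThan_Suc of_nat_Suc)
    qed
    then have "norm (lacunary_mean n x - a) \<le> 1 + norm a" for x
      by (meson add_right_mono norm_triangle_ineq4 order_trans)
    then show "AE x in \<mu>. norm ((norm (lacunary_mean n x - a))\<^sup>2) \<le> (1 + norm a)\<^sup>2"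
      by (intro AE_I2) (simp add: power_mono)
  qed measurable
qed

text \<open>The lacunary means converge to \<open>0\<close> in \<open>L\<^sup>2\<close> of Lebesgue measure and to \<open>a\<close> in
  \<open>L\<^sup>2\<close> of \<open>\<mu>\<close>, so the two measures live on disjoint sets.\<close>

lemma circle_singularI:
  assumes "prob_space \<mu>" and sets: "sets \<mu> = sets circle_borel"
    and "\<And>k. fourier_stieltjes \<mu> (3 * k) = fourier_stieltjes \<mu> k"
    and a: "a = fourier_stieltjes \<mu> 1" "a \<noteq> 0"
    and "(\<lambda>n. fourier_stieltjes \<mu> (3 ^ n - 1)) \<longlonglongrightarrow> a * cnj a"
  shows "circle_singular \<mu>"
proof -
  note [measurable_cong] = sets
  interpret \<mu>: prob_space \<mu> by fact
  define u where "u b n x = (norm (lacunary_mean n x - b))\<^sup>2" for b n x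
  have conv_mu: "(\<lambda>n. LINT x|\<mu>. norm (u a n x)) \<longlonglongrightarrow> 0"
    using lacunary_mean_L2[OF assms(1,2,3) a(1) assms(6)] by (simp add: u_def)
  \<comment> \<open>For n = 0 the frequency is 0 and the transform is 1, so the sequence vanishes
    only from n = 1 on.\<close>
  have "fourier_stieltjes circle_lebesgue (3 ^ n - 1) = 0" if "n \<ge> 1" for n
    using that one_less_power[of "3::int" n] by (intro fourier_stieltjes_circle_lebesgue) auto
  then have "(\<lambda>n. fourier_stieltjes circle_lebesgue (3 ^ n - 1)) \<longlonglongrightarrow> 0"
    by (intro tendsto_eventually) (auto simp: eventually_sequentially)
  moreover have "fourier_stieltjes circle_lebesgue (3 * k) = fourier_stieltjes circle_lebesgue k" for k
    by (cases "k = 0") (simp_all add: fourier_stieltjes_circle_lebesgue)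
  ultimately have conv_leb: "(\<lambda>n. LINT x|circle_lebesgue. norm (u 0 n x)) \<longlonglongrightarrow> 0"
    using lacunary_mean_L2[OF prob_space_circle_lebesgue sets_circle_lebesgue, of 0]
    by (simp add: u_def fourier_stieltjes_circle_lebesgue)
  have int_leb: "integrable circle_lebesgue (u b n)" for b n
    unfolding u_def by (intro integrable_lacunary_mean_diff prob_space_circle_lebesgue sets_circle_lebesgue)
  have int_mu: "integrable \<mu> (u b n)" for b n
    unfolding u_def by (intro integrable_lacunary_mean_diff assms(1,2))
  obtain r where r: "strict_mono r" "AE x in circle_lebesgue. (\<lambda>n. u 0 (r n) x) \<longlonglongrightarrow> 0"
    using tendsto_L1_AE_subseq[OF int_leb conv_leb] by blast
  \<comment> \<open>Convergence in the mean gives pointwise limits only along subsequences. The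
    second is extracted from the first, so that both limits hold along the same indices
    \<open>r (s n)\<close>.\<close>
  have "(\<lambda>n. LINT x|\<mu>. norm (u a (r n) x)) \<longlonglongrightarrow> 0"
    using LIMSEQ_subseq_LIMSEQ[OF conv_mu r(1)] by (simp add: o_def)
  then obtain s where s: "strict_mono s" "AE x in \<mu>. (\<lambda>n. u a (r (s n)) x) \<longlonglongrightarrow> 0"
    using tendsto_L1_AE_subseq[of \<mu> "\<lambda>n. u a (r n)", OF int_mu] by blast
  define N where "N = {x \<in> space circle_borel. (\<lambda>n. u a (r (s n)) x) \<longlonglongrightarrow> 0}"
  have norm_sq: "(\<lambda>n. (norm (v n))\<^sup>2) \<longlonglongrightarrow> 0 \<longleftrightarrow> v \<longlonglongrightarrow> 0" for v :: "nat \<Rightarrow> complex"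
  proof
    assume "(\<lambda>n. (norm (v n))\<^sup>2) \<longlonglongrightarrow> 0"
    then have "(\<lambda>n. sqrt ((norm (v n))\<^sup>2)) \<longlonglongrightarrow> sqrt 0" by (rule tendsto_real_sqrt)
    then show "v \<longlonglongrightarrow> 0" by (simp add: tendsto_norm_zero_iff)
  next
    assume "v \<longlonglongrightarrow> 0"
    then show "(\<lambda>n. (norm (v n))\<^sup>2) \<longlonglongrightarrow> 0"
      using tendsto_power[OF tendsto_norm_zero, of v sequentially 2] by simp
  qed
  have u_iff: "(\<lambda>n. u b (q n) x) \<longlonglongrightarrow> 0 \<longleftrightarrow> (\<lambda>n. lacunary_mean (q n) x) \<longlonglongrightarrow> b" for b q x
    unfolding u_def norm_sq by (rule LIM_zero_iff)
  have [measurable]: "u b n \<in> borel_measurable circle_borel" for b n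
    unfolding u_def by measurable
  have N: "N \<in> sets circle_borel"
    unfolding N_def by measurable
  have "AE x in circle_lebesgue. x \<notin> N"
    using r(2)
  proof eventually_elim
    case (elim x)
    have "(\<lambda>n. lacunary_mean (r (s n)) x) \<longlonglongrightarrow> 0"
      using LIMSEQ_subseq_LIMSEQ[OF elim[unfolded u_iff] s(1)] by (simp add: o_def)
    then show ?case
      using a(2) LIMSEQ_unique unfolding N_def u_iff by blast
  qed
  then have "emeasure circle_lebesgue N = 0"
    using N AE_iff_measurable[of N circle_lebesgue "\<lambda>x. x \<notin> N"] sets.sets_into_space[OF N]
    by (simp add: sets_circle_lebesgue Collect_conj_eq Int_absorb1 flip: Int_def atLeastLessThan_iff)
  moreover have "emeasure \<mu> ({0..<1} - N) = 0"
  proof -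
    have [simp]: "space \<mu> = {0..<1}"
      using sets_eq_imp_space_eq[OF sets] by simp
    have "AE x in \<mu>. x \<in> N"
      using s(2) by (rule AE_mp) (auto simp: N_def)
    moreover have "{0..<1} - N = {x \<in> space \<mu>. \<not> x \<in> N}"
      by auto
    ultimately show ?thesis
      using N AE_iff_measurable[of "{0..<1} - N" \<mu> "\<lambda>x. x \<in> N"] sets.compl_sets[OF N] by (simp add: sets)
  qed
  ultimately show ?thesis
    unfolding circle_singular_def using N by blast
qed

text \<open>The frequencies 3^n - 1 and -1 differ by 3^n, so the first n factors of their product
  expansions agree; what remains is the transform at 1 - 3^(-n) and at -3^(-n). The identity
  \<open>eq\<close> is cross-multiplied, and division is legitimate for large n because the
  transform at -3^(-n) tends to 1.\<close>

lemma cantor_transform_mixing: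
  "(\<lambda>n. cantor_transform (of_int (3 ^ n - 1))) \<longlonglongrightarrow> cantor_transform 1 * cnj (cantor_transform 1)"
proof -
  let ?\<phi> = cantor_transform
  have cnj: "?\<phi> (- 1) = cnj (?\<phi> 1)"
    using fourier_stieltjes_minus[of cantor_measure 1] by (simp add: fourier_stieltjes_cantor_measure)
  have inv: "(\<lambda>n. 1 / 3 ^ n) \<longlonglongrightarrow> (0::real)"
    using LIMSEQ_divide_realpow_zero[of 3 1] by simp
  have eq: "?\<phi> (3 ^ n - 1) * ?\<phi> (- 1 / 3 ^ n) = ?\<phi> (- 1) * ?\<phi> (1 - 1 / 3 ^ n)" for n :: nat
  proof -
    let ?P = "\<lambda>t. \<Prod>j<n. (1 + cis (2 * pi * (2 * t / 3 ^ Suc j))) / 2"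
    have "?P (3 ^ n - 1) = ?P (- 1)"
    proof (rule prod.cong[OF refl])
      fix j assume "j \<in> {..<n}"
      then have "(3::real) ^ n = 3 ^ Suc j * 3 ^ (n - Suc j)"
        by (simp flip: power_add power_Suc)
      then have "2 * pi * (2 * (3 ^ n - 1) / 3 ^ Suc j)
          = 2 * pi * (2 * - 1 / 3 ^ Suc j) + 2 * pi * of_int (2 * 3 ^ (n - Suc j))"
        by (simp add: field_simps)
      moreover have "cis (2 * pi * of_int (2 * 3 ^ (n - Suc j))) = 1"
        by (rule cis_multiple_2pi) simp
      ultimately have "cis (2 * pi * (2 * (3 ^ n - 1) / 3 ^ Suc j)) = cis (2 * pi * (2 * - 1 / 3 ^ Suc j))"
        by (simp only: mult_1_right flip: cis_mult)
      then show "(1 + cis (2 * pi * (2 * (3 ^ n - 1) / 3 ^ Suc j))) / 2 = (1 + cis (2 * pi * (2 * - 1 / 3 ^ Suc j))) / 2"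
        by (simp only:)
    qed
    then have "?\<phi> (3 ^ n - 1) = ?P (- 1) * ?\<phi> (1 - 1 / 3 ^ n)"
      using cantor_transform_prod[of "3 ^ n - 1" n] by (simp add: diff_divide_distrib)
    moreover have "?\<phi> (- 1) = ?P (- 1) * ?\<phi> (- 1 / 3 ^ n)"
      by (rule cantor_transform_prod)
    ultimately show ?thesis by (simp only: mult_ac)
  qed
  have "(\<lambda>n. - 1 / 3 ^ n) \<longlonglongrightarrow> (0::real)"
    using tendsto_minus[OF inv] by simp
  then have lim: "(\<lambda>n. ?\<phi> (- 1 / 3 ^ n)) \<longlonglongrightarrow> 1"
    using cantor_transform_tendsto cantor_transform_0 by metis
  have "(\<lambda>n. ?\<phi> (1 - 1 / 3 ^ n)) \<longlonglongrightarrow> ?\<phi> (1 - 0)"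
    by (intro cantor_transform_tendsto tendsto_intros inv)
  then have "(\<lambda>n. ?\<phi> (- 1) * ?\<phi> (1 - 1 / 3 ^ n) / ?\<phi> (- 1 / 3 ^ n)) \<longlonglongrightarrow> ?\<phi> (- 1) * ?\<phi> (1 - 0) / 1"
    by (intro tendsto_divide tendsto_mult tendsto_const lim) simp_all
  moreover have "\<forall>\<^sub>F n in sequentially. ?\<phi> (- 1) * ?\<phi> (1 - 1 / 3 ^ n) / ?\<phi> (- 1 / 3 ^ n) = ?\<phi> (3 ^ n - 1)"
    using tendsto_imp_eventually_ne[OF lim one_neq_zero]
    by eventually_elim (subst eq[symmetric], simp)
  ultimately have "(\<lambda>n. ?\<phi> (3 ^ n - 1)) \<longlonglongrightarrow> ?\<phi> (- 1) * ?\<phi> (1 - 0) / 1"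
    by (rule Lim_transform_eventually)
  then show ?thesis by (simp add: cnj mult.commute)
qed

lemma circle_singular_cantor_measure: "circle_singular cantor_measure"
proof (rule circle_singularI[OF prob_space_cantor_measure sets_cantor_measure _ refl])
  show "(\<lambda>n. fourier_stieltjes cantor_measure (3 ^ n - 1))
    \<longlonglongrightarrow> fourier_stieltjes cantor_measure 1 * cnj (fourier_stieltjes cantor_measure 1)"
    using cantor_transform_mixing by (simp add: fourier_stieltjes_cantor_measure)
qed (use cantor_transform_nonzero[of 1] in \<open>simp_all add: fourier_stieltjes_cantor_measure cantor_transform_mult_3\<close>)

lemma prob_space_circle_convolution:
  assumes "prob_space \<mu>" "prob_space \<nu>"
    and [measurable_cong]: "sets \<mu> = sets circle_borel" "sets \<nu> = sets circle_borel"
  shows "prob_space (circle_convolution \<mu> \<nu>)"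
proof -
  interpret \<mu>: prob_space \<mu> by fact
  interpret \<nu>: prob_space \<nu> by fact
  interpret pair_prob_space \<mu> \<nu> ..
  have [measurable]: "(\<lambda>x. x) \<in> borel_measurable \<mu>" "(\<lambda>x. x) \<in> borel_measurable \<nu>"
    by measurable
  show ?thesis
    unfolding circle_convolution_def by (rule prob_space_distr) measurable
qed

lemma fourier_stieltjes_cantor_convolution:
  "fourier_stieltjes (circle_convolution cantor_measure cantor_measure) k = (cantor_transform (of_int k))\<^sup>2"
  by (simp add: fourier_stieltjes_convolution prob_space_cantor_measure sets_cantor_measure
    fourier_stieltjes_cantor_measure power2_eq_square)

lemma sets_circle_convolution: "sets (circle_convolution \<mu> \<nu>) = sets circle_borel"
  by (simp add: circle_convolution_def)

text \<open>Both properties asked for by \<open>circle_singularI\<close> survive squaring of the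
  transform: invariance under tripling, and the mixing limit, whose square is again a constant times
  its conjugate.\<close>

lemma circle_singular_cantor_convolution:
  "circle_singular (circle_convolution cantor_measure cantor_measure)"
proof (rule circle_singularI[OF prob_space_circle_convolution sets_circle_convolution _ refl])
  show "(\<lambda>n. fourier_stieltjes (circle_convolution cantor_measure cantor_measure) (3 ^ n - 1))
    \<longlonglongrightarrow> fourier_stieltjes (circle_convolution cantor_measure cantor_measure) 1
      * cnj (fourier_stieltjes (circle_convolution cantor_measure cantor_measure) 1)"
    unfolding fourier_stieltjes_cantor_convolution
    using tendsto_power[OF cantor_transform_mixing, of 2] by (simp add: power_mult_distrib)
qed (use cantor_transform_nonzero[of 1] in
  \<open>simp_all add: fourier_stieltjes_cantor_convolution cantor_transform_mult_3
    prob_space_cantor_measure sets_cantor_measure\<close>)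

section \<open>Weak almost periodicity\<close>

text \<open>Only semidefinite, because a continuous function may be nonzero and yet vanish almost
  everywhere for the measure; real-valued, because the weak topology is generated by real
  functionals. No quotient or completion is formed.\<close>

locale semi_inner =
  fixes form :: "'v::real_vector \<Rightarrow> 'v \<Rightarrow> real"
  assumes add_left: "form (x + y) z = form x z + form y z"
    and scale_left: "form (r *\<^sub>R x) z = r * form x z"
    and sym: "form x y = form y x"
    and nonneg: "0 \<le> form x x"
begin

definition seminorm :: "'v \<Rightarrow> real" where
  "seminorm x = sqrt (form x x)"

lemma linear_form: "linear (form x)"
  by (rule linearI) (simp_all add: sym[of x] add_left scale_left)

lemma seminorm_nonneg: "0 \<le> seminorm x"
  by (simp add: seminorm_def nonneg)

lemma seminorm_squared: "(seminorm x)\<^sup>2 = form x x"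
  by (simp add: seminorm_def nonneg)

lemma form_add_scale: "form (p + t *\<^sub>R q) (p + t *\<^sub>R q) = form p p + 2 * t * form p q + t\<^sup>2 * form q q"
  using sym[of q p] linear_add[OF linear_form] linear_scale[OF linear_form]
  by (simp add: add_left scale_left power2_eq_square algebra_simps)

text \<open>The quadratic is evaluated at its minimum \<open>t = - d / b\<close>; for
  \<open>b = 0\<close> a nonzero \<open>d\<close> would make it unbounded below. The lower bound
  -c^2/2 serves both Cauchy-Schwarz, with \<open>c\<close> the seminorm of \<open>p\<close>, and
  almost minimizers, with \<open>c\<close> the tolerance \<epsilon>.\<close>

lemma quadratic_bound:
  fixes b c d :: real
  assumes "0 \<le> b" and "0 \<le> c" and q: "\<And>t. - (c\<^sup>2 / 2) \<le> t * d + t\<^sup>2 * (b / 2)"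
  shows "\<bar>d\<bar> \<le> c * sqrt b"
proof (cases "b = 0")
  case True
  have "d = 0"
  proof (rule ccontr)
    assume "d \<noteq> 0"
    then show False
      using q[of "- (c\<^sup>2 + 1) / d"] True zero_le_power2[of c] by simp
  qed
  then show ?thesis using True by simp
next
  case False
  then have "- (c\<^sup>2 / 2) \<le> - (d\<^sup>2 / (2 * b))"
    using q[of "- d / b"] by (simp add: power2_eq_square field_simps)
  then have "d\<^sup>2 \<le> (c * sqrt b)\<^sup>2"
    using False \<open>0 \<le> b\<close> by (simp add: power_mult_distrib field_simps)
  then show ?thesis
    using \<open>0 \<le> c\<close> \<open>0 \<le> b\<close> abs_le_square_iff[of d "c * sqrt b"] by simp
qed

lemma Cauchy_Schwarz: "\<bar>form p q\<bar> \<le> seminorm p * seminorm q"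
  unfolding seminorm_def[of q]
proof (rule quadratic_bound[OF nonneg seminorm_nonneg])
  fix t
  show "- ((seminorm p)\<^sup>2 / 2) \<le> t * form p q + t\<^sup>2 * (form q q / 2)"
    using nonneg[of "p + t *\<^sub>R q"] unfolding form_add_scale seminorm_squared by simp
qed

text \<open>Without completeness the Riesz representation holds up to \<open>\<epsilon>\<close>: take an almost minimizer
  of \<open>form p p / 2 - L p\<close>.\<close>

lemma approximate_Riesz:
  assumes L: "linear L" and bound: "\<And>q. \<bar>L q\<bar> \<le> C * seminorm q" and "0 < \<epsilon>"
  obtains p where "\<And>q. \<bar>L q - form p q\<bar> \<le> \<epsilon> * seminorm q"
proof -
  define J where "J p = form p p / 2 - L p" for p
  \<comment> \<open>With s the seminorm of \<open>p\<close>, \<open>bound\<close> gives J p \<ge>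
    s^2/2 - C s; completing the square finishes.\<close>
  have "- (C\<^sup>2 / 2) \<le> J p" for p
  proof -
    have "0 \<le> (seminorm p - C)\<^sup>2" by simp
    then show ?thesis
      using bound[of p] unfolding J_def
      by (simp add: power2_diff seminorm_squared) (simp add: mult.commute[of C])
  qed
  then have bdd: "bdd_below (range J)" by (rule bdd_belowI2)
  then obtain p where p: "J p < (INF p. J p) + \<epsilon>\<^sup>2 / 2"
    using cINF_less_iff[OF _ bdd, of "(INF p. J p) + \<epsilon>\<^sup>2 / 2"] \<open>0 < \<epsilon>\<close> by auto
  have "\<bar>L q - form p q\<bar> \<le> \<epsilon> * seminorm q" for q
    unfolding seminorm_def abs_minus_commute[of "L q"]
  proof (rule quadratic_bound[OF nonneg])
    fix t
    \<comment> \<open>Minimality up to \<epsilon>^2/2 bounds every variation from below, as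
      \<open>quadratic_bound\<close> requires with \<open>c\<close> = \<epsilon>.\<close>
    have "J p - \<epsilon>\<^sup>2 / 2 \<le> J (p + t *\<^sub>R q)"
      using p cINF_lower[OF bdd, of "p + t *\<^sub>R q"] by simp
    then show "- (\<epsilon>\<^sup>2 / 2) \<le> t * (form p q - L q) + t\<^sup>2 * (form q q / 2)"
      by (simp add: J_def form_add_scale linear_add[OF L] linear_scale[OF L] algebra_simps)
  qed (use \<open>0 < \<epsilon>\<close> in simp)
  then show ?thesis by (rule that)
qed

definition dual_ball :: "('v \<Rightarrow> real) set" where
  "dual_ball = {L. linear L \<and> (\<forall>q. \<bar>L q\<bar> \<le> seminorm q)}"

text \<open>Banach-Alaoglu by way of Tychonoff: functions carry the topology of pointwise
  convergence, in which linearity is a closed condition on a product of compact intervals.\<close>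

lemma compact_dual_ball: "compact dual_ball"
proof -
  let ?P = "\<Pi>\<^sub>E q\<in>UNIV. {- seminorm q..seminorm q}"
  have "compactin (product_topology (\<lambda>_. euclideanreal) UNIV) ?P"
    by (simp add: compactin_PiE)
  then have P: "compact ?P"
    by (simp add: euclidean_product_topology)
  have "closed {L :: 'v \<Rightarrow> real. (\<forall>x y. L (x + y) = L x + L y) \<and> (\<forall>r x. L (r *\<^sub>R x) = r *\<^sub>R L x)}"
    by (intro closed_Collect_conj closed_Collect_all closed_Collect_eq continuous_intros
      continuous_on_product_coordinates)
  moreover have "dual_ball
    = ?P \<inter> {L. (\<forall>x y. L (x + y) = L x + L y) \<and> (\<forall>r x. L (r *\<^sub>R x) = r *\<^sub>R L x)}"
    by (auto simp: dual_ball_def linear_iff abs_le_iff PiE_iff minus_le_iff)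
  ultimately show ?thesis
    using P by (simp add: compact_Int_closed)
qed

lemma form_in_dual_ball: "seminorm p \<le> 1 \<Longrightarrow> form p \<in> dual_ball"
  using mult_right_mono[OF _ seminorm_nonneg, of "seminorm p" 1] Cauchy_Schwarz[of p]
  by (auto simp: dual_ball_def linear_form intro: order_trans)

text \<open>Both estimates are tested at \<open>p - p'\<close>, where the two forms differ by the
  squared seminorm. This makes the values of \<open>T\<close> at ever finer approximants Cauchy, and
  their limit independent of the approximants when \<open>L\<close> is itself a form.\<close>

lemma approximations_close:
  assumes "\<And>q. \<bar>L q - form p q\<bar> \<le> \<delta> * seminorm q" "\<And>q. \<bar>L q - form p' q\<bar> \<le> \<delta>' * seminorm q"
    and "0 \<le> \<delta>" "0 \<le> \<delta>'"
  shows "seminorm (p - p') \<le> \<delta> + \<delta>'"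
proof -
  let ?d = "p - p'"
  have "form p ?d = form ?d ?d + form p' ?d"
    by (simp flip: add_left)
  then have "(seminorm ?d)\<^sup>2 \<le> (\<delta> + \<delta>') * seminorm ?d"
    using assms(1)[of ?d] assms(2)[of ?d] by (simp add: seminorm_squared distrib_right)
  then show ?thesis
    using seminorm_nonneg[of ?d] assms(3,4)
    by (cases "seminorm ?d = 0") (auto simp: power2_eq_square)
qed

text \<open>A bounded operator from a pre-Hilbert space is weakly compact: \<open>T\<close> extends from the unit
  ball to the functionals bounded by the seminorm, a compact space in the topology of pointwise
  convergence, and the extension is continuous into the weak topology.\<close>

theorem weakly_compact_superset:
  fixes T :: "'v \<Rightarrow> 'x::real_normed_vector"
  assumes complete: "\<And>X :: nat \<Rightarrow> 'x. Cauchy X \<Longrightarrow> convergent X"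
    and T: "linear T" and T_le: "\<And>p. norm (T p) \<le> seminorm p"
  obtains K where "compactin weak_topology K" and "\<And>p. seminorm p \<le> 1 \<Longrightarrow> T p \<in> K"
proof -
  \<comment> \<open>\<open>x\<close> plays the value at \<open>L\<close> of the extended operator:
    one \<open>x\<close> has to work for all tolerances \<delta>, with \<open>p\<close> representing
    \<open>L\<close> and \<open>T p\<close> approaching \<open>x\<close>.\<close>
  define approx where
    "approx L x \<delta> p \<longleftrightarrow> (\<forall>q. \<bar>L q - form p q\<bar> \<le> \<delta> * seminorm q) \<and> norm (x - T p) \<le> \<delta>" for L x \<delta> p
  have "\<exists>x. \<forall>\<delta>>0. \<exists>p. approx L x \<delta> p" if "L \<in> dual_ball" for L
  proof -
    have L: "linear L" "\<And>q. \<bar>L q\<bar> \<le> 1 * seminorm q"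
      using that by (auto simp: dual_ball_def)
    have "\<exists>p. \<forall>q. \<bar>L q - form p q\<bar> \<le> inverse (real (Suc n)) * seminorm q" for n
      by (rule approximate_Riesz[OF L, of "inverse (real (Suc n))"]) auto
    then obtain p where p: "\<And>n q. \<bar>L q - form (p n) q\<bar> \<le> inverse (real (Suc n)) * seminorm q"
      by metis
    have "Cauchy (\<lambda>n. T (p n))"
    proof (rule metric_CauchyI)
      fix e :: real assume "0 < e"
      then obtain M where M: "inverse (real (Suc M)) < e / 2"
        using reals_Archimedean[of "e / 2"] by auto
      have "dist (T (p m)) (T (p n)) < e" if "m \<ge> M" "n \<ge> M" for m n
      proof -
        have "dist (T (p m)) (T (p n)) \<le> seminorm (p m - p n)"
          using T_le[of "p m - p n"] by (simp add: dist_norm linear_diff[OF T])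
        also have "\<dots> \<le> inverse (real (Suc m)) + inverse (real (Suc n))"
          by (rule approximations_close[OF p p]) simp_all
        also have "\<dots> \<le> inverse (real (Suc M)) + inverse (real (Suc M))"
          using that by (intro add_mono le_imp_inverse_le) auto
        finally show ?thesis using M by simp
      qed
      then show "\<exists>M. \<forall>m\<ge>M. \<forall>n\<ge>M. dist (T (p m)) (T (p n)) < e" by blast
    qed
    then obtain x where x: "(\<lambda>n. T (p n)) \<longlonglongrightarrow> x"
      using complete convergentD by blast
    have "\<exists>p. approx L x \<delta> p" if "0 < \<delta>" for \<delta>
    proof -
      obtain N where N: "\<And>n. n \<ge> N \<Longrightarrow> norm (T (p n) - x) < \<delta>"
        using LIMSEQ_D[OF x \<open>0 < \<delta>\<close>] by blast
      obtain M where M: "inverse (real (Suc M)) < \<delta>"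
        using reals_Archimedean[OF \<open>0 < \<delta>\<close>] by auto
      let ?n = "max M N"
      have "inverse (real (Suc ?n)) \<le> inverse (real (Suc M))"
        by (intro le_imp_inverse_le) auto
      then have "inverse (real (Suc ?n)) * seminorm q \<le> \<delta> * seminorm q" for q
        using M by (intro mult_right_mono seminorm_nonneg) linarith
      then have "\<bar>L q - form (p ?n) q\<bar> \<le> \<delta> * seminorm q" for q
        using p[of q ?n] by (rule order_trans[rotated])
      then show ?thesis
        using N[of ?n] unfolding approx_def by (auto simp: norm_minus_commute intro!: exI[of _ "p ?n"])
    qed
    then show ?thesis by blast
  qed
  then obtain \<Psi> where \<Psi>: "\<And>L \<delta>. L \<in> dual_ball \<Longrightarrow> 0 < \<delta> \<Longrightarrow> \<exists>p. approx L (\<Psi> L) \<delta> p"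
    by metis
  have \<Psi>_form: "\<Psi> (form p) = T p" if "seminorm p \<le> 1" for p
  proof -
    have "norm (\<Psi> (form p) - T p) \<le> 0 + e" if "0 < e" for e
    proof -
      obtain p' where p': "\<And>q. \<bar>form p q - form p' q\<bar> \<le> e / 2 * seminorm q"
        "norm (\<Psi> (form p) - T p') \<le> e / 2"
        using \<Psi>[OF form_in_dual_ball[OF \<open>seminorm p \<le> 1\<close>], of "e / 2"] \<open>0 < e\<close>
        unfolding approx_def by auto
      have "seminorm (p' - p) \<le> e / 2 + 0"
        by (rule approximations_close[of "form p"]) (use p' \<open>0 < e\<close> in auto)
      then have "norm (T p' - T p) \<le> e / 2"
        using T_le[of "p' - p"] by (simp add: linear_diff[OF T])
      then show ?thesis
        using p'(2) norm_triangle_ineq[of "\<Psi> (form p) - T p'" "T p' - T p"] by simp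
    qed
    then have "norm (\<Psi> (form p) - T p) \<le> 0"
      by (rule field_le_epsilon)
    then show ?thesis by simp
  qed
  have cont: "continuous_on dual_ball (\<lambda>L. \<phi> (\<Psi> L))" if \<phi>: "bounded_linear \<phi>" for \<phi> :: "'x \<Rightarrow> real"
  proof -
    interpret \<phi>: bounded_linear \<phi> by fact
    obtain M where M: "0 \<le> M" "\<And>x. norm (\<phi> x) \<le> norm x * M"
      using \<phi>.nonneg_bounded by blast
    \<comment> \<open>Up to a small error, \<phi> after \<Psi> is evaluation at a single
      \<open>p\<close>, the one representing \<phi> after \<open>T\<close>. If \<open>p'\<close>
      represents \<open>L\<close>, then \<phi> (\<Psi> L) is close to \<phi> (T p'), this to
      \<open>form p p'\<close>, and this to \<open>L p\<close>.\<close>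
    have close: "\<exists>p. \<forall>L\<in>dual_ball. \<bar>\<phi> (\<Psi> L) - L p\<bar> \<le> e" if "0 < e" for e
    proof -
      have "linear (\<lambda>q. \<phi> (T q))"
        using linear_compose[OF T \<phi>.linear_axioms] by (simp add: o_def)
      moreover have "\<bar>\<phi> (T q)\<bar> \<le> M * seminorm q" for q
        using M(2)[of "T q"] mult_left_mono[OF T_le[of q] M(1)] by (simp add: mult.commute)
      ultimately obtain p where p: "\<And>q. \<bar>\<phi> (T q) - form p q\<bar> \<le> e * seminorm q"
        using approximate_Riesz[of "\<lambda>q. \<phi> (T q)" M e] \<open>0 < e\<close> by blast
      have "\<bar>\<phi> (\<Psi> L) - L p\<bar> \<le> e" if L: "L \<in> dual_ball" for L
      proof (rule field_le_epsilon)
        fix d :: real assume "0 < d"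
        \<comment> \<open>Chosen so that the errors \<open>e * \<delta>\<close>,
          \<open>M * \<delta>\<close> and \<open>\<delta> * seminorm p\<close> together are at most
          \<open>d\<close>.\<close>
        define \<delta> where "\<delta> = d / (M + e + seminorm p + 1)"
        have pos: "0 < M + e + seminorm p + 1"
          using M(1) \<open>0 < e\<close> seminorm_nonneg[of p] by linarith
        then have "0 < \<delta>" using \<open>0 < d\<close> by (simp add: \<delta>_def)
        then obtain p' where p': "\<And>q. \<bar>L q - form p' q\<bar> \<le> \<delta> * seminorm q" "norm (\<Psi> L - T p') \<le> \<delta>"
          using \<Psi>[OF L] unfolding approx_def by blast
        \<comment> \<open>Testing at \<open>p'\<close> itself: its form is within \<delta> of
          \<open>L\<close>, which is bounded by the seminorm.\<close>
        have "seminorm p' \<le> 1 + \<delta>"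
        proof (cases "seminorm p' = 0")
          case False
          have "L p' \<le> seminorm p'" using L by (auto simp: dual_ball_def abs_le_iff)
          then have "seminorm p' * seminorm p' \<le> (1 + \<delta>) * seminorm p'"
            using p'(1)[of p'] seminorm_squared[of p'] by (simp add: power2_eq_square distrib_right)
          then show ?thesis
            using False seminorm_nonneg[of p'] by (simp add: mult_le_cancel_right)
        qed (use \<open>0 < \<delta>\<close> in simp)
        then have "e * seminorm p' \<le> e + e * \<delta>"
          using mult_left_mono[of "seminorm p'" "1 + \<delta>" e] \<open>0 < e\<close> by (simp add: distrib_left)
        then have "\<bar>\<phi> (T p') - form p p'\<bar> \<le> e + e * \<delta>"
          using p[of p'] by linarith
        moreover have "\<bar>\<phi> (\<Psi> L) - \<phi> (T p')\<bar> \<le> M * \<delta>"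
          using M(2)[of "\<Psi> L - T p'"] mult_left_mono[OF p'(2) M(1)] by (simp add: \<phi>.diff mult.commute)
        moreover have "\<bar>L p - form p p'\<bar> \<le> \<delta> * seminorm p"
          using p'(1)[of p] by (simp add: sym)
        moreover have "e * \<delta> + M * \<delta> + \<delta> * seminorm p \<le> d"
        proof -
          have "e * \<delta> + M * \<delta> + \<delta> * seminorm p \<le> \<delta> * (M + e + seminorm p + 1)"
            using \<open>0 < \<delta>\<close> by (simp add: algebra_simps)
          also have "\<dots> = d" using pos by (simp add: \<delta>_def)
          finally show ?thesis .
        qed
        ultimately show "\<bar>\<phi> (\<Psi> L) - L p\<bar> \<le> e + d" by linarith
      qed
      then show ?thesis by blast
    qed
    have "\<exists>p. \<forall>L\<in>dual_ball. \<bar>\<phi> (\<Psi> L) - L p\<bar> \<le> inverse (real (Suc n))" for n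
      by (rule close) simp
    then obtain p where p: "\<And>n L. L \<in> dual_ball \<Longrightarrow> \<bar>\<phi> (\<Psi> L) - L (p n)\<bar> \<le> inverse (real (Suc n))"
      by metis
    \<comment> \<open>Evaluations are continuous for pointwise convergence, and a uniform limit
      inherits this.\<close>
    have "uniform_limit dual_ball (\<lambda>n L. L (p n)) (\<lambda>L. \<phi> (\<Psi> L)) sequentially"
    proof (rule uniform_limitI)
      fix e :: real assume "0 < e"
      then have "\<forall>\<^sub>F n in sequentially. inverse (real (Suc n)) < e"
        using order_tendstoD(2)[OF LIMSEQ_inverse_real_of_nat] by blast
      then show "\<forall>\<^sub>F n in sequentially. \<forall>L\<in>dual_ball. dist (L (p n)) (\<phi> (\<Psi> L)) < e"
        by eventually_elim (metis p dist_real_def abs_minus_commute order_le_less_trans)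
    qed
    then show ?thesis
      by (rule uniform_limit_theorem[rotated])
        (auto intro!: always_eventually intro: continuous_on_subset[OF continuous_on_product_coordinates])
  qed
  have "continuous_map (top_of_set dual_ball) weak_topology \<Psi>"
    unfolding weak_topology_def continuous_on_generated_topo_iff
  proof (intro conjI allI impI)
    fix W assume "W \<in> {\<phi> -` U |(\<phi> :: 'x \<Rightarrow> real) U. bounded_linear \<phi> \<and> open U}"
    then obtain \<phi> :: "'x \<Rightarrow> real" and U where W: "W = \<phi> -` U" "bounded_linear \<phi>" "open U"
      by blast
    have "\<Psi> -` W \<inter> topspace (top_of_set dual_ball) = dual_ball \<inter> (\<lambda>L. \<phi> (\<Psi> L)) -` U"
      by (auto simp: W)
    then show "openin (top_of_set dual_ball) (\<Psi> -` W \<inter> topspace (top_of_set dual_ball))"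
      using continuous_openin_preimage_gen[OF cont[OF W(2)] W(3)] by simp
  next
    have "(\<lambda>_. 0) -` UNIV \<in> {\<phi> -` U |(\<phi> :: 'x \<Rightarrow> real) U. bounded_linear \<phi> \<and> open U}"
      using bounded_linear_zero open_UNIV by blast
    then show "\<Psi> ` topspace (top_of_set dual_ball) \<subseteq> \<Union> {\<phi> -` U |(\<phi> :: 'x \<Rightarrow> real) U. bounded_linear \<phi> \<and> open U}"
      by auto
  qed
  moreover have "compactin (top_of_set dual_ball) dual_ball"
    using compact_dual_ball by (simp add: compactin_subtopology)
  ultimately have "compactin weak_topology (\<Psi> ` dual_ball)"
    by (metis image_compactin)
  then show ?thesis
    using \<Psi>_form form_in_dual_ball by (intro that[of "\<Psi> ` dual_ball"]) (metis imageI)+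
qed

end

section \<open>Fourier-Stieltjes transforms as images of characters\<close>

lemma convergent_bcontfun:
  fixes f :: "nat \<Rightarrow> 'a::topological_space \<Rightarrow>\<^sub>C 'b::complete_space"
  assumes "Cauchy f"
  shows "convergent f"
proof -
  from assms
  have "uniformly_Cauchy_on UNIV (\<lambda>n. apply_bcontfun (f n))"
    unfolding uniformly_Cauchy_on_def Cauchy_def
    by (meson dist_fun_lt_imp_dist_val_lt)
  then obtain l where l: "uniform_limit UNIV (\<lambda>n. apply_bcontfun (f n)) l sequentially"
    using Cauchy_uniformly_convergent uniformly_convergent_on_def by blast
  obtain g where "f \<longlonglongrightarrow> g"
    using uniform_limit_bcontfunE[OF l] by auto
  then show ?thesis by (rule convergentI)
qed

text \<open>Real and imaginary parts of point evaluations separate functions. The property makes the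
  compact set of \<open>weakly_compact_superset\<close> closed, so that it contains the closure of
  the translates.\<close>

lemma Hausdorff_weak_topology_bcontfun:
  "Hausdorff_space (weak_topology :: ('a::topological_space \<Rightarrow>\<^sub>C complex) topology)"
  unfolding Hausdorff_space_def
proof (intro allI impI)
  fix f g :: "'a \<Rightarrow>\<^sub>C complex"
  assume "f \<in> topspace weak_topology \<and> g \<in> topspace weak_topology \<and> f \<noteq> g"
  then obtain n where "apply_bcontfun f n \<noteq> apply_bcontfun g n"
    using bcontfun_eqI by blast
  have re: "bounded_linear (\<lambda>f :: 'a \<Rightarrow>\<^sub>C complex. Re (apply_bcontfun f n))"
    by (rule bounded_linear_intro[of _ 1]) (auto intro: order_trans[OF abs_Re_le_cmod norm_bounded])
  have im: "bounded_linear (\<lambda>f :: 'a \<Rightarrow>\<^sub>C complex. Im (apply_bcontfun f n))"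
    by (rule bounded_linear_intro[of _ 1]) (auto intro: order_trans[OF abs_Im_le_cmod norm_bounded])
  obtain \<phi> :: "('a \<Rightarrow>\<^sub>C complex) \<Rightarrow> real" where \<phi>: "bounded_linear \<phi>" "\<phi> f \<noteq> \<phi> g"
    using re im \<open>apply_bcontfun f n \<noteq> apply_bcontfun g n\<close> complex_eqI by metis
  obtain U V where UV: "open U" "open V" "\<phi> f \<in> U" "\<phi> g \<in> V" "U \<inter> V = {}"
    using hausdorff[OF \<phi>(2)] by blast
  have "openin weak_topology (\<phi> -` W)" if "open W" for W
    unfolding weak_topology_def
    by (rule topology_generated_by_Basis) (use \<phi>(1) that in blast)
  then show "\<exists>U V. openin weak_topology U \<and> openin weak_topology V \<and> f \<in> U \<and> g \<in> V \<and> disjnt U V"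
    using UV by (intro exI[of _ "\<phi> -` U"] exI[of _ "\<phi> -` V"]) (auto simp: disjnt_def)
qed

text \<open>The variance of the modulus is nonnegative. This bounds the transform of a density,
  uniformly over frequencies, by the L2 norm of the density.\<close>

lemma (in prob_space) expectation_norm_le_sqrt:
  fixes X :: "'a \<Rightarrow> complex"
  assumes [measurable]: "random_variable borel X" and "\<And>x. norm (X x) \<le> b"
  shows "norm (expectation X) \<le> sqrt (expectation (\<lambda>x. (norm (X x))\<^sup>2))"
proof -
  have "integrable M (\<lambda>x. norm (X x))"
    by (rule integrable_const_bound[of _ b]) (use assms(2) in auto)
  moreover have "integrable M (\<lambda>x. (norm (X x))\<^sup>2)"
    by (rule integrable_const_bound[of _ "b\<^sup>2"]) (use assms(2) in \<open>auto intro!: AE_I2 power_mono\<close>)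
  ultimately have "(expectation (\<lambda>x. norm (X x)))\<^sup>2 \<le> expectation (\<lambda>x. (norm (X x))\<^sup>2)"
    using variance_positive[of "\<lambda>x. norm (X x)"] variance_eq[of "\<lambda>x. norm (X x)"] by simp
  then show ?thesis
    using integral_norm_bound[of M X] real_le_rsqrt by (meson order_trans)
qed

text \<open>The operator \<open>T\<close> sends a density \<open>p\<close> to the transform of
  \<open>p\<close> times the measure. Multiplying the measure by the character of frequency
  \<open>k\<close> shifts its transform by \<open>k\<close>, and characters, being unimodular, have
  L2 seminorm 1.\<close>

lemma weakly_almost_periodic_fourier_stieltjes:
  assumes "prob_space \<nu>" and [measurable_cong]: "sets \<nu> = sets circle_borel"
  shows "fourier_stieltjes \<nu> \<in> weakly_almost_periodic"
proof -
  interpret prob_space \<nu> by fact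
  have [measurable]: "apply_bcontfun p \<in> borel_measurable borel" for p :: "real \<Rightarrow>\<^sub>C complex"
    by (rule borel_measurable_continuous_onI) simp
  have [measurable]: "cnj \<in> borel_measurable borel"
    by (intro borel_measurable_continuous_onI continuous_intros)
  define F where "F p q = (LINT x|\<nu>. Re (apply_bcontfun p x * cnj (apply_bcontfun q x)))"
    for p q :: "real \<Rightarrow>\<^sub>C complex"
  have int: "integrable \<nu> (\<lambda>x. Re (apply_bcontfun p x * cnj (apply_bcontfun q x)))" for p q :: "real \<Rightarrow>\<^sub>C complex"
  proof (rule integrable_const_bound[of _ "norm p * norm q"])
    have "\<bar>Re (apply_bcontfun p x * cnj (apply_bcontfun q x))\<bar> \<le> norm p * norm q" for x
      using abs_Re_le_cmod[of "apply_bcontfun p x * cnj (apply_bcontfun q x)"]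
        mult_mono[OF norm_bounded[of p x] norm_bounded[of q x] norm_ge_zero norm_ge_zero]
      by (simp only: norm_mult complex_mod_cnj)
    then show "AE x in \<nu>. norm (Re (apply_bcontfun p x * cnj (apply_bcontfun q x))) \<le> norm p * norm q"
      by simp
  qed measurable
  interpret semi_inner F
  proof
    fix p q r :: "real \<Rightarrow>\<^sub>C complex" and t :: real
    show "F (p + q) r = F p r + F q r"
      unfolding F_def Bochner_Integration.integral_add[OF int int, symmetric]
      by (simp add: distrib_right)
    show "F (t *\<^sub>R p) r = t * F p r"
      unfolding F_def integral_mult_right_zero[symmetric] by simp
    show "F p q = F q p"
      unfolding F_def by (simp add: mult.commute)
    show "0 \<le> F p p"
      unfolding F_def by (rule integral_nonneg_AE) simp
  qed
  have seminorm: "seminorm p = sqrt (expectation (\<lambda>x. (norm (apply_bcontfun p x))\<^sup>2))" for p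
    unfolding seminorm_def F_def by (simp add: complex_norm_square[symmetric] flip: cmod_power2 power2_eq_square)
  define t where "t p n = (LINT x|\<nu>. cis (2 * pi * (of_int n * x)) * apply_bcontfun p x)"
    for p :: "real \<Rightarrow>\<^sub>C complex" and n :: int
  have int_t: "integrable \<nu> (\<lambda>x. cis (2 * pi * (of_int n * x)) * apply_bcontfun p x)"
    for p :: "real \<Rightarrow>\<^sub>C complex" and n :: int
    by (rule integrable_const_bound[of _ "norm p"]) (auto simp: norm_mult norm_bounded)
  have t_le: "norm (t p n) \<le> seminorm p" for p n
    using expectation_norm_le_sqrt[of "\<lambda>x. cis (2 * pi * (of_int n * x)) * apply_bcontfun p x" "norm p"]
    unfolding t_def seminorm by (simp add: norm_mult norm_bounded)
  define T where "T p = Bcontfun (t p)" for p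
  have T_apply: "apply_bcontfun (T p) = t p" for p
    unfolding T_def by (rule Bcontfun_inverse, rule bcontfun_normI[OF _ t_le]) simp
  have "linear T"
  proof (rule linearI)
    fix p q :: "real \<Rightarrow>\<^sub>C complex" and r :: real
    show "T (p + q) = T p + T q"
      by (rule bcontfun_eqI) (simp add: T_apply t_def distrib_left int_t)
    show "T (r *\<^sub>R p) = r *\<^sub>R T p"
      by (rule bcontfun_eqI) (simp add: T_apply t_def)
  qed
  moreover have T_le: "norm (T p) \<le> seminorm p" for p
    by (rule norm_bound) (simp add: T_apply t_le)
  ultimately obtain K where K: "compactin weak_topology K" "\<And>p. seminorm p \<le> 1 \<Longrightarrow> T p \<in> K"
    using weakly_compact_superset[OF convergent_bcontfun _ T_le] by metis
  have "Bcontfun (\<lambda>n. fourier_stieltjes \<nu> (n + k)) \<in> K" for k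
  proof -
    let ?e = "Bcontfun (\<lambda>x. cis (2 * pi * (of_int k * x)))"
    have e: "apply_bcontfun ?e x = cis (2 * pi * (of_int k * x))" for x
      by (subst Bcontfun_inverse) (auto intro!: bcontfun_normI[of _ 1] continuous_intros)
    have "seminorm ?e = 1"
      by (simp add: seminorm e prob_space)
    moreover have "t ?e = (\<lambda>n. fourier_stieltjes \<nu> (n + k))"
      by (rule ext) (simp only: t_def e fourier_stieltjes_cis cis_mult of_int_add distrib_left distrib_right)
    ultimately show ?thesis
      using K(2)[of ?e] by (simp add: T_def)
  qed
  then have "translates (fourier_stieltjes \<nu>) \<subseteq> K"
    by (auto simp: translates_def)
  moreover have "closedin weak_topology K"
    by (rule compactin_imp_closedin[OF Hausdorff_weak_topology_bcontfun K(1)])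
  ultimately have "compactin weak_topology (weak_topology closure_of translates (fourier_stieltjes \<nu>))"
    by (intro closed_compactin[OF K(1)] closure_of_minimal closedin_closure_of)
  moreover have "bounded (range (fourier_stieltjes \<nu>))"
  proof -
    have "norm (fourier_stieltjes \<nu> k) \<le> 1" for k
    proof -
      have "norm (fourier_stieltjes \<nu> k) \<le> (LINT x|\<nu>. norm (cis (2 * pi * (of_int k * x))))"
        unfolding fourier_stieltjes_cis by (rule integral_norm_bound)
      then show ?thesis by (simp add: prob_space)
    qed
    then show ?thesis by (auto simp: bounded_iff)
  qed
  ultimately show ?thesis
    by (simp add: weakly_almost_periodic_def)
qed

section \<open>Functions of uniform mean zero\<close>

text \<open>All translates of the open set where the realization exceeds \<epsilon> have equal
  measure, so this measure is the integral of the frequency of visits along an orbit segment of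
  length 3^n. The window sums of \<open>f\<close> bound this frequency by (1/2)^n / \<epsilon> at
  each point. A point with nonzero value is a discontinuity or lies inside such an open set.\<close>

lemma realization_AE_zero:
  assumes real: "realized_by f G T \<iota> M F"
    and sum_le: "\<And>m n. (\<Sum>i<3 ^ n. norm (f (m + int i))) \<le> (3 / 2) ^ n"
  shows "AE x in completion M. F x = 0"
proof -
  have comp: "group_compactification G T \<iota>" and haar: "normalized_haar_measure G T M"
    and disc: "{x \<in> topspace T. \<not> topcontinuous_at T euclidean F x} \<in> null_sets (completion M)"
    and f: "f = F \<circ> \<iota>"
    using real by (auto simp: realized_by_def riemann_integrable_def)
  have "group G" and top: "topspace T = carrier G"
    and mult: "continuous_map (prod_topology T T) T (\<lambda>(x, y). x \<otimes>\<^bsub>G\<^esub> y)"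
    and hom: "\<iota> \<in> hom integer_group G" and dense: "T closure_of (range \<iota>) = topspace T"
    using comp by (auto simp: group_compactification_def compact_group_def)
  interpret G: group G by fact
  have space: "space M = topspace T" and sets: "sets M = sigma_sets (topspace T) {U. openin T U}"
    and one: "emeasure M (space M) = 1"
    and invariant: "\<And>g A. g \<in> carrier G \<Longrightarrow> A \<in> sets M \<Longrightarrow> emeasure M ((\<lambda>x. g \<otimes>\<^bsub>G\<^esub> x) ` A) = emeasure M A"
    using haar by (auto simp: normalized_haar_measure_def)
  interpret prob_space M by (rule prob_spaceI) (rule one)
  have open_sets: "openin T U \<Longrightarrow> U \<in> sets M" for U
    unfolding sets by (rule sigma_sets.Basic) simp
  have iota: "\<iota> k \<in> carrier G" "\<iota> (k + l) = \<iota> k \<otimes>\<^bsub>G\<^esub> \<iota> l" for k l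
    using hom by (auto simp: hom_def Pi_iff)
  \<comment> \<open>The interior, since density of the integers detects only open
    conditions.\<close>
  define U where "U \<epsilon> = T interior_of {x \<in> topspace T. \<epsilon> < norm (F x)}" for \<epsilon>
  have null: "U \<epsilon> \<in> null_sets M" if "0 < \<epsilon>" for \<epsilon> :: real
  proof -
    have U: "openin T (U \<epsilon>)" "U \<epsilon> \<subseteq> carrier G"
      using interior_of_subset_topspace[of T] unfolding U_def top[symmetric] by auto
    define V where "V k = {x \<in> topspace T. \<iota> (int k) \<otimes>\<^bsub>G\<^esub> x \<in> U \<epsilon>}" for k
    have V_open: "openin T (V k)" for k
    proof -
      have "continuous_map T (prod_topology T T) (\<lambda>x. (\<iota> (int k), x))"
        by (simp add: continuous_map_pairwise o_def top iota)
      then have "continuous_map T T ((\<lambda>(x, y). x \<otimes>\<^bsub>G\<^esub> y) \<circ> (\<lambda>x. (\<iota> (int k), x)))"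
        by (rule continuous_map_compose[OF _ mult])
      then show ?thesis
        unfolding V_def using U(1) by (auto simp: o_def dest: openin_continuous_map_preimage)
    qed
    have V_integrable: "integrable M (indicat_real (V k))" for k
      using open_sets[OF V_open] by (intro integrable_real_indicator) (auto simp: emeasure_eq_measure)
    have V_measure: "measure M (V k) = measure M (U \<epsilon>)" for k
    proof -
      have "V k = (\<lambda>x. inv\<^bsub>G\<^esub> \<iota> (int k) \<otimes>\<^bsub>G\<^esub> x) ` U \<epsilon>"
      proof (intro equalityI subsetI)
        fix x assume x: "x \<in> V k"
        then have "x = inv\<^bsub>G\<^esub> \<iota> (int k) \<otimes>\<^bsub>G\<^esub> (\<iota> (int k) \<otimes>\<^bsub>G\<^esub> x)"
          by (simp add: V_def top iota(1) flip: G.m_assoc)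
        then show "x \<in> (\<lambda>x. inv\<^bsub>G\<^esub> \<iota> (int k) \<otimes>\<^bsub>G\<^esub> x) ` U \<epsilon>"
          using x by (auto simp: V_def)
      next
        fix x assume "x \<in> (\<lambda>x. inv\<^bsub>G\<^esub> \<iota> (int k) \<otimes>\<^bsub>G\<^esub> x) ` U \<epsilon>"
        then obtain y where y: "y \<in> U \<epsilon>" "x = inv\<^bsub>G\<^esub> \<iota> (int k) \<otimes>\<^bsub>G\<^esub> y" by blast
        then have "y \<in> carrier G" using U(2) by blast
        with y show "x \<in> V k"
          by (simp add: V_def top iota(1) flip: G.m_assoc)
      qed
      then show ?thesis
        using invariant[of "inv\<^bsub>G\<^esub> \<iota> (int k)" "U \<epsilon>"] open_sets[OF U(1)] iota(1)
        by (simp add: measure_def)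
    qed
    have count: "(\<Sum>k<3 ^ n. indicat_real (V k) x) \<le> (3 / 2) ^ n / \<epsilon>" if x: "x \<in> topspace T" for n x
    proof -
      \<comment> \<open>The times at which the orbit of \<open>x\<close> visits
        \<open>U \<epsilon>\<close>. Visiting at all of them is an open condition on the starting
        point, so some integer point \<open>\<iota> m\<close> satisfies it too.\<close>
      define S where "S = {k. k < 3 ^ n \<and> x \<in> V k}"
      have "finite S" by (simp add: S_def)
      have "openin T (topspace T \<inter> (\<Inter>k\<in>S. V k))"
        using \<open>finite S\<close> V_open by (intro openin_Int_Inter) auto
      moreover have "x \<in> topspace T \<inter> (\<Inter>k\<in>S. V k)"
        using x by (auto simp: S_def)
      moreover have "x \<in> T closure_of (range \<iota>)"
        using dense x by simp
      ultimately have "\<exists>y. y \<in> range \<iota> \<and> y \<in> topspace T \<inter> (\<Inter>k\<in>S. V k)"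
        unfolding in_closure_of by (elim conjE allE impE) (intro conjI)
      then obtain m where m: "\<And>k. k \<in> S \<Longrightarrow> \<iota> m \<in> V k"
        by auto
      have large: "\<epsilon> < norm (f (m + int k))" if "k \<in> S" for k
      proof -
        have "\<iota> (int k + m) \<in> U \<epsilon>"
          using m[OF that] by (simp add: V_def iota)
        then show ?thesis
          using interior_of_subset[of T "{x \<in> topspace T. \<epsilon> < norm (F x)}"]
          by (auto simp: U_def f add.commute)
      qed
      have "real (card S) * \<epsilon> = (\<Sum>k\<in>S. \<epsilon>)" by simp
      also have "\<dots> \<le> (\<Sum>k\<in>S. norm (f (m + int k)))"
        by (rule sum_mono) (rule less_imp_le[OF large])
      also have "\<dots> \<le> (\<Sum>k<3 ^ n. norm (f (m + int k)))"
        by (rule sum_mono2) (auto simp: S_def)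
      also have "\<dots> \<le> (3 / 2) ^ n" by (rule sum_le)
      finally have "real (card S) \<le> (3 / 2) ^ n / \<epsilon>"
        using \<open>0 < \<epsilon>\<close> by (simp add: field_simps)
      moreover have "(\<Sum>k<3 ^ n. indicat_real (V k) x) = real (card S)"
      proof -
        have "(\<Sum>k<3 ^ n. indicat_real (V k) x) = (\<Sum>k<3 ^ n. if k \<in> {k. x \<in> V k} then 1 else 0)"
          by (intro sum.cong) (auto simp: indicator_def)
        also have "\<dots> = (\<Sum>k\<in>{..<3 ^ n} \<inter> {k. x \<in> V k}. 1)"
          by (rule sum.inter_restrict[symmetric]) simp
        also have "{..<3 ^ n} \<inter> {k. x \<in> V k} = S" by (auto simp: S_def)
        finally show ?thesis by simp
      qed
      ultimately show ?thesis by simp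
    qed
    have "measure M (U \<epsilon>) \<le> (1 / 2) ^ n / \<epsilon>" for n
    proof -
      have "3 ^ n * measure M (U \<epsilon>) = (\<Sum>k<(3::nat) ^ n. measure M (V k))"
        by (simp add: V_measure)
      also have "\<dots> = (LINT x|M. (\<Sum>k<3 ^ n. indicat_real (V k) x))"
        using open_sets[OF V_open] by (subst Bochner_Integration.integral_sum) (simp_all add: V_integrable)
      also have "\<dots> \<le> (LINT x|M. (3 / 2) ^ n / \<epsilon>)"
        using count by (intro integral_mono) (simp_all add: V_integrable space)
      finally have "3 ^ n * measure M (U \<epsilon>) \<le> (3 / 2) ^ n / \<epsilon>"
        by (simp add: prob_space)
      moreover have "(3 / 2) ^ n / \<epsilon> = 3 ^ n * ((1 / 2) ^ n / \<epsilon>)"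
        by (simp add: power_divide)
      ultimately have "3 ^ n * measure M (U \<epsilon>) \<le> 3 ^ n * ((1 / 2) ^ n / \<epsilon>)"
        by (simp only:)
      then show ?thesis by (rule mult_left_le_imp_le) simp
    qed
    moreover have "(\<lambda>n. (1 / 2) ^ n / \<epsilon>) \<longlonglongrightarrow> 0 / \<epsilon>"
      using \<open>0 < \<epsilon>\<close> by (intro tendsto_divide tendsto_const LIMSEQ_power_zero) auto
    ultimately have "measure M (U \<epsilon>) \<le> 0"
      using LIMSEQ_le_const[of _ "0 / \<epsilon>"] by simp
    then show ?thesis
      using open_sets[OF U(1)] by (simp add: null_sets_def emeasure_eq_measure measure_le_0_iff)
  qed
  let ?N = "{x \<in> topspace T. \<not> topcontinuous_at T euclidean F x} \<union> (\<Union>n. U (inverse (real (Suc n))))"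
  show ?thesis
  proof (rule AE_I')
    have "U (inverse (real (Suc n))) \<in> null_sets (completion M)" for n
      by (rule null_sets_completionI, rule null) simp
    then show "?N \<in> null_sets (completion M)"
      using disc by (intro null_sets.Un null_sets_UN) auto
    show "{x \<in> space (completion M). F x \<noteq> 0} \<subseteq> ?N"
    proof safe
      fix x assume x: "x \<in> space (completion M)" "F x \<noteq> 0"
        and notU: "x \<notin> (\<Union>n. U (inverse (real (Suc n))))"
      show "x \<in> topspace T" using x by (simp add: space)
      assume cont: "topcontinuous_at T euclidean F x"
      obtain n where n: "inverse (real (Suc n)) < norm (F x)"
        using reals_Archimedean[of "norm (F x)"] x by auto
      have "open {z :: complex. inverse (real (Suc n)) < norm z}"
        by (intro open_Collect_less continuous_intros)
      moreover have "\<And>Z. open Z \<Longrightarrow> F x \<in> Z \<Longrightarrow> \<exists>W. openin T W \<and> x \<in> W \<and> (\<forall>y\<in>W. F y \<in> Z)"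
        using cont by (simp add: topcontinuous_at_def)
      ultimately obtain W where "openin T W" "x \<in> W" "\<forall>y\<in>W. F y \<in> {z. inverse (real (Suc n)) < norm z}"
        using n by (metis mem_Collect_eq)
      then have "x \<in> U (inverse (real (Suc n)))"
        using openin_subset[of T W] unfolding U_def interior_of_def by blast
      then show False using notU by blast
    qed
  qed
qed

text \<open>Compactness yields a finite \<open>K\<close> such that each translate of the almost
  periodic part is close to a translate by an element of \<open>K\<close>. A nonzero value therefore
  recurs at every position up to a shift from \<open>K\<close>; where the part in C_0 is small, this
  makes window sums of \<open>f\<close> grow like 3^n.\<close>

lemma not_almost_periodic_plus_c0:
  assumes sum_le: "\<And>m n. (\<Sum>i<3 ^ n. norm (f (m + int i))) \<le> (3 / 2) ^ n"
    and f3: "\<And>k. f (3 * k) = f k" and f1: "f 1 \<noteq> 0"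
  shows "f \<notin> almost_periodic_plus_c0"
proof
  assume "f \<in> almost_periodic_plus_c0"
  then obtain fa f0 where f: "\<And>k. f k = fa k + f0 k" and fa: "fa \<in> almost_periodic"
    and f0: "(f0 \<longlongrightarrow> 0) at_top"
    unfolding almost_periodic_plus_c0_def vanishing_at_infinity_def by auto
  obtain b where b: "\<And>k. norm (fa k) \<le> b"
    using fa by (auto simp: almost_periodic_def bounded_iff)
  define tr where "tr k = Bcontfun (\<lambda>n. fa (n + k))" for k
  have tr: "apply_bcontfun (tr k) n = fa (n + k)" for k n
    unfolding tr_def by (subst Bcontfun_inverse) (auto intro: bcontfun_normI[OF _ b])
  have fa_0: "fa k0 = 0" for k0
  proof (rule ccontr)
    define \<delta> where "\<delta> = norm (fa k0)"
    assume "fa k0 \<noteq> 0"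
    then have "0 < \<delta>" by (simp add: \<delta>_def)
    have "compact (closure (range tr))"
      using fa by (simp add: almost_periodic_def translates_def tr_def)
    moreover have "closure (range tr) \<subseteq> (\<Union>k\<in>UNIV. ball (tr k) (\<delta> / 2))"
    proof
      fix t assume "t \<in> closure (range tr)"
      moreover have "0 < \<delta> / 2" using \<open>0 < \<delta>\<close> by simp
      ultimately obtain y where "y \<in> range tr" "dist y t < \<delta> / 2"
        unfolding closure_approachable by blast
      then show "t \<in> (\<Union>k\<in>UNIV. ball (tr k) (\<delta> / 2))" by auto
    qed
    ultimately obtain K where K: "finite K" "closure (range tr) \<subseteq> (\<Union>k\<in>K. ball (tr k) (\<delta> / 2))"
      using compactE_image[of "closure (range tr)" UNIV "\<lambda>k. ball (tr k) (\<delta> / 2)"]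
      by (metis open_ball)
    have big: "\<exists>\<kappa>\<in>K. \<delta> / 2 < norm (fa (k0 - \<kappa> + m))" for m
    proof -
      have "tr m \<in> closure (range tr)"
        by (rule subsetD[OF closure_subset rangeI])
      then obtain \<kappa> where \<kappa>: "\<kappa> \<in> K" "dist (tr \<kappa>) (tr m) < \<delta> / 2"
        using K(2) by auto
      \<comment> \<open>Evaluation at \<open>k0 - \<kappa>\<close>, where the translate by \<kappa>
        takes the value \<open>fa k0\<close>.\<close>
      have "dist (fa k0) (fa (k0 - \<kappa> + m)) \<le> dist (tr \<kappa>) (tr m)"
        using dist_bounded[of "tr \<kappa>" "k0 - \<kappa>" "tr m"] by (simp add: tr)
      then have "\<delta> - norm (fa (k0 - \<kappa> + m)) < \<delta> / 2"
        using \<kappa>(2) norm_triangle_ineq2[of "fa k0" "fa (k0 - \<kappa> + m)"] by (simp add: \<delta>_def dist_norm)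
      then show ?thesis using \<kappa>(1) by (intro bexI[of _ \<kappa>]) auto
    qed
    have "\<forall>\<^sub>F k in at_top. norm (f0 k) < \<delta> / 4"
      using tendstoD[OF f0, of "\<delta> / 4"] \<open>0 < \<delta>\<close> by simp
    then obtain L where L: "\<And>k. k \<ge> L \<Longrightarrow> norm (f0 k) < \<delta> / 4"
      by (auto simp: eventually_at_top_linorder)
    \<comment> \<open>Moves the window so far to the right that
      \<open>k0 - \<kappa> + L' + int i\<close> is at least \<open>L\<close> for all \<kappa> in
      \<open>K\<close> at once.\<close>
    define L' where "L' = L - k0 + (\<Sum>\<kappa>\<in>K. \<bar>\<kappa>\<bar>)"
    have bound: "\<delta> / 4 \<le> (\<Sum>\<kappa>\<in>K. norm (f (k0 - \<kappa> + L' + int i)))" for i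
    proof -
      obtain \<kappa> where \<kappa>: "\<kappa> \<in> K" "\<delta> / 2 < norm (fa (k0 - \<kappa> + (L' + int i)))"
        using big by blast
      have "\<bar>\<kappa>\<bar> \<le> (\<Sum>\<kappa>\<in>K. \<bar>\<kappa>\<bar>)"
        by (rule member_le_sum) (use \<kappa>(1) K(1) in auto)
      then have "norm (f0 (k0 - \<kappa> + (L' + int i))) < \<delta> / 4"
        by (intro L) (simp add: L'_def)
      then have "\<delta> / 4 \<le> norm (f (k0 - \<kappa> + (L' + int i)))"
        using \<kappa>(2) norm_diff_ineq[of "fa (k0 - \<kappa> + (L' + int i))" "f0 (k0 - \<kappa> + (L' + int i))"]
        by (simp add: f)
      also have "\<dots> \<le> (\<Sum>\<kappa>\<in>K. norm (f (k0 - \<kappa> + (L' + int i))))"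
        using \<kappa>(1) K(1) by (intro member_le_sum[of _ _ "\<lambda>\<kappa>. norm (f (k0 - \<kappa> + (L' + int i)))"]) auto
      finally show ?thesis by (simp add: add.assoc)
    qed
    have "2 ^ n \<le> 4 * real (card K) / \<delta>" for n
    proof -
      have "3 ^ n * (\<delta> / 4) = (\<Sum>i<(3::nat) ^ n. \<delta> / 4)" by simp
      also have "\<dots> \<le> (\<Sum>i<3 ^ n. \<Sum>\<kappa>\<in>K. norm (f (k0 - \<kappa> + L' + int i)))"
        by (rule sum_mono) (rule bound)
      also have "\<dots> = (\<Sum>\<kappa>\<in>K. \<Sum>i<3 ^ n. norm (f (k0 - \<kappa> + L' + int i)))"
        by (rule sum.swap)
      also have "\<dots> \<le> (\<Sum>\<kappa>\<in>K. (3 / 2) ^ n)"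
        by (rule sum_mono) (rule sum_le)
      finally have "3 ^ n * (\<delta> / 4) \<le> real (card K) * (3 / 2) ^ n" by simp
      then show ?thesis
        using \<open>0 < \<delta>\<close> by (simp add: power_divide field_simps)
    qed
    moreover obtain n where "4 * real (card K) / \<delta> < 2 ^ n"
      using real_arch_pow[of 2] by auto
    ultimately show False by (meson not_le)
  qed
  have "f (3 ^ n) = f 1" for n
    by (induction n) (simp_all add: f3)
  then have const: "f0 (3 ^ n) = f 1" for n
    using f[of "3 ^ n"] by (simp add: fa_0)
  have "filterlim (\<lambda>n. (3::int) ^ n) at_top sequentially"
    unfolding filterlim_at_top
  proof
    fix Z :: int
    have "Z \<le> 3 ^ n" if "n \<ge> nat Z" for n
    proof -
      have "n < 3 ^ n"
        by (rule order_less_le_trans[OF less_exp]) (simp add: power_mono)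
      then have "int n < 3 ^ n"
        using of_nat_less_iff[of n "3 ^ n", where 'a=int] by simp
      then show ?thesis using that by linarith
    qed
    then show "\<forall>\<^sub>F n in sequentially. Z \<le> 3 ^ n"
      by (auto simp: eventually_sequentially)
  qed
  then have "(\<lambda>n. f0 (3 ^ n)) \<longlonglongrightarrow> 0"
    by (rule filterlim_compose[OF f0])
  then show False
    using f1 by (simp add: const LIMSEQ_const_iff)
qed

section \<open>The 3-adic integers\<close>

lemma carrier_zadic3:
  "x \<in> carrier zadic3 \<longleftrightarrow> (\<forall>n. x n \<in> {0..<3 ^ Suc n} \<and> x (Suc n) mod 3 ^ Suc n = x n)"
  by (simp add: zadic3_def)

lemma mult_zadic3: "x \<otimes>\<^bsub>zadic3\<^esub> y = (\<lambda>n. (x n + y n) mod 3 ^ Suc n)"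
  by (simp add: zadic3_def fun_eq_iff)

lemma one_zadic3: "\<one>\<^bsub>zadic3\<^esub> = (\<lambda>n. 0)"
  by (simp add: zadic3_def fun_eq_iff)

lemma mod_power_Suc_mod: "a mod 3 ^ Suc (Suc n) mod 3 ^ Suc n = (a :: int) mod 3 ^ Suc n"
  by (rule mod_mod_cancel) (simp add: le_imp_power_dvd)

lemma carrier_zadic3I:
  assumes "\<And>n. x (Suc n) mod 3 ^ Suc n = x n mod 3 ^ Suc n"
  shows "(\<lambda>n. x n mod 3 ^ Suc n) \<in> carrier zadic3"
  unfolding carrier_zadic3 using assms by (simp only: mod_power_Suc_mod) simp

lemma carrier_zadic3_mod:
  assumes "x \<in> carrier zadic3" "m \<le> n"
  shows "x n mod 3 ^ Suc m = x m"
  using assms(2)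
proof (induction n rule: dec_induct)
  case base
  have "x m \<in> {0..<3 ^ Suc m}" using assms(1) unfolding carrier_zadic3 by blast
  then show ?case by simp
next
  case (step n)
  have "x (Suc n) mod 3 ^ Suc n mod 3 ^ Suc m = x (Suc n) mod 3 ^ Suc m"
    using step by (intro mod_mod_cancel le_imp_power_dvd) auto
  then show ?case
    using assms(1) step by (simp add: carrier_zadic3)
qed

lemma group_zadic3: "group zadic3"
proof (rule groupI)
  fix x y z assume x: "x \<in> carrier zadic3" and y: "y \<in> carrier zadic3" and z: "z \<in> carrier zadic3"
  have "(x (Suc n) + y (Suc n)) mod 3 ^ Suc n = (x n + y n) mod 3 ^ Suc n" for n
    using x y unfolding carrier_zadic3 by (metis mod_add_eq)
  then show "x \<otimes>\<^bsub>zadic3\<^esub> y \<in> carrier zadic3"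
    unfolding mult_zadic3 by (rule carrier_zadic3I)
  show "x \<otimes>\<^bsub>zadic3\<^esub> y \<otimes>\<^bsub>zadic3\<^esub> z = x \<otimes>\<^bsub>zadic3\<^esub> (y \<otimes>\<^bsub>zadic3\<^esub> z)"
    by (simp add: mult_zadic3 mod_simps add.assoc del: power_Suc)
  show "\<one>\<^bsub>zadic3\<^esub> \<otimes>\<^bsub>zadic3\<^esub> x = x"
    using carrier_zadic3_mod[OF x order_refl] by (simp add: mult_zadic3 one_zadic3 del: power_Suc)
  have "- x (Suc n) mod 3 ^ Suc n = - x n mod 3 ^ Suc n" for n
    using x unfolding carrier_zadic3 by (metis mod_minus_eq)
  then have "(\<lambda>n. - x n mod 3 ^ Suc n) \<in> carrier zadic3"
    by (rule carrier_zadic3I)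
  moreover have "(\<lambda>n. - x n mod 3 ^ Suc n) \<otimes>\<^bsub>zadic3\<^esub> x = \<one>\<^bsub>zadic3\<^esub>"
    by (simp add: mult_zadic3 one_zadic3 mod_simps del: power_Suc)
  ultimately show "\<exists>y\<in>carrier zadic3. y \<otimes>\<^bsub>zadic3\<^esub> x = \<one>\<^bsub>zadic3\<^esub>" by blast
qed (simp add: one_zadic3 carrier_zadic3)

lemma inv_zadic3:
  assumes x: "x \<in> carrier zadic3"
  shows "inv\<^bsub>zadic3\<^esub> x = (\<lambda>n. - x n mod 3 ^ Suc n)"
proof (rule group.inv_equality[OF group_zadic3 _ x])
  have "- x (Suc n) mod 3 ^ Suc n = - x n mod 3 ^ Suc n" for n
    using x unfolding carrier_zadic3 by (metis mod_minus_eq)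
  then show "(\<lambda>n. - x n mod 3 ^ Suc n) \<in> carrier zadic3"
    by (rule carrier_zadic3I)
  show "(\<lambda>n. - x n mod 3 ^ Suc n) \<otimes>\<^bsub>zadic3\<^esub> x = \<one>\<^bsub>zadic3\<^esub>"
    by (simp add: mult_zadic3 one_zadic3 mod_simps del: power_Suc)
qed

section \<open>The topology of the 3-adic integers and the density of the integers\<close>

lemma carrier_zadic3_subset: "carrier zadic3 \<subseteq> (\<Pi>\<^sub>E n\<in>UNIV. {0..<3 ^ Suc n})"
  by (auto simp: carrier_zadic3)

text \<open>The finite discrete factors are subspaces of the integers, so the topology is induced
  from all integer sequences; compactness and continuity become questions about
  \<open>compact\<close> and \<open>continuous_on\<close>.\<close>

lemma zadic3_topology_eq: "zadic3_topology = top_of_set (carrier zadic3)"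
proof -
  have "discrete_topology S = top_of_set S" for S :: "int set"
  proof -
    have "openin (top_of_set S) U \<longleftrightarrow> U \<subseteq> S" for U
    proof
      assume "U \<subseteq> S"
      then have "U = S \<inter> U" by blast
      moreover have "openin (top_of_set S) (S \<inter> U)"
        by (rule openin_open_Int[OF discrete_topology_class.open_discrete])
      ultimately show "openin (top_of_set S) U" by simp
    qed (rule openin_imp_subset)
    then show ?thesis by (simp add: topology_eq)
  qed
  then have "zadic3_topology = subtopology (subtopology (product_topology (\<lambda>n. euclidean) UNIV)
      (\<Pi>\<^sub>E n\<in>UNIV. {0..<3 ^ Suc n})) (carrier zadic3)"
    unfolding zadic3_topology_def by (simp only: subtopology_product_topology)
  also have "\<dots> = subtopology euclidean ((\<Pi>\<^sub>E n\<in>UNIV. {0..<3 ^ Suc n}) \<inter> carrier zadic3)"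
    by (simp only: euclidean_product_topology subtopology_subtopology)
  finally show ?thesis
    using carrier_zadic3_subset by (simp only: Int_absorb1)
qed

lemma topspace_zadic3 [simp]: "topspace zadic3_topology = carrier zadic3"
  by (simp add: zadic3_topology_eq)

lemma continuous_on_coordinate:
  "continuous_on S (\<lambda>x :: nat \<Rightarrow> int. h (x i))"
proof (rule continuous_on_compose2[where f = "\<lambda>x. x i"])
  show "continuous_on UNIV h"
    by (rule Topological_Spaces.continuous_on_discrete)
  show "continuous_on S (\<lambda>x :: nat \<Rightarrow> int. x i)"
    by (rule continuous_on_subset[OF continuous_on_product_coordinates]) simp
qed simp

lemma compact_carrier_zadic3: "compact (carrier zadic3)"
proof -
  have "compactin (product_topology (\<lambda>_. euclidean) UNIV) (\<Pi>\<^sub>E n\<in>UNIV. {0..<3 ^ Suc n :: int})"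
    by (simp add: compactin_PiE finite_imp_compact)
  then have "compact (\<Pi>\<^sub>E n\<in>UNIV. {0..<3 ^ Suc n :: int})"
    by (simp add: euclidean_product_topology)
  moreover have "closed (\<Inter>n. {x :: nat \<Rightarrow> int. x (Suc n) mod 3 ^ Suc n = x n})"
    by (intro closed_INT ballI closed_Collect_eq continuous_on_coordinate continuous_on_product_coordinates)
  moreover have "carrier zadic3 = (\<Pi>\<^sub>E n\<in>UNIV. {0..<3 ^ Suc n :: int})
      \<inter> (\<Inter>n. {x. x (Suc n) mod 3 ^ Suc n = x n})"
    by (auto simp: carrier_zadic3 PiE_iff)
  ultimately show ?thesis by (simp only: compact_Int_closed)
qed

text \<open>A coset of 3^(n+1) times the 3-adic integers, or empty if \<open>a\<close> is outside
  \<open>{0..<3 ^ Suc n}\<close>.\<close>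

definition zadic3_ball :: "nat \<Rightarrow> int \<Rightarrow> (nat \<Rightarrow> int) set" where
  "zadic3_ball n a = {x \<in> carrier zadic3. x n = a}"

lemma openin_zadic3_ball: "openin zadic3_topology (zadic3_ball n a)"
proof -
  have "open ((\<lambda>x :: nat \<Rightarrow> int. x n) -` {a})"
    by (intro open_vimage continuous_on_product_coordinates discrete_topology_class.open_discrete)
  moreover have "zadic3_ball n a = carrier zadic3 \<inter> (\<lambda>x. x n) -` {a}"
    unfolding zadic3_ball_def by blast
  ultimately show ?thesis
    unfolding zadic3_topology_eq by (simp only: openin_open_Int)
qed

lemma zadic3_ball_antimono:
  assumes "x \<in> carrier zadic3" "m \<le> n"
  shows "zadic3_ball n (x n) \<subseteq> zadic3_ball m (x m)"
proof
  fix y assume "y \<in> zadic3_ball n (x n)"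
  then show "y \<in> zadic3_ball m (x m)"
    using carrier_zadic3_mod[of x m n] carrier_zadic3_mod[of y m n] assms
    by (auto simp: zadic3_ball_def simp del: power_Suc)
qed

text \<open>A basic open set of the product restricts finitely many coordinates, and in the inverse
  limit a coordinate beyond them determines them all.\<close>

lemma zadic3_ball_base:
  assumes "openin zadic3_topology U" "x \<in> U"
  obtains n where "zadic3_ball n (x n) \<subseteq> U"
proof -
  obtain V where V: "open V" "U = carrier zadic3 \<inter> V"
    using assms(1) unfolding zadic3_topology_eq openin_open by blast
  then have "openin (product_topology (\<lambda>_ :: nat. euclidean :: int topology) UNIV) V"
    by (simp add: euclidean_product_topology)
  then obtain W where W: "finite {i. W i \<noteq> UNIV}" "x \<in> PiE UNIV W" "PiE UNIV W \<subseteq> V"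
    using bspec[OF openin_product_topology_alt[THEN iffD1], of "\<lambda>_. euclidean" UNIV V x] assms(2) V(2) by auto
  obtain n where n: "\<And>i. W i \<noteq> UNIV \<Longrightarrow> i \<le> n"
    using W(1) unfolding finite_nat_set_iff_bounded_le by blast
  have x: "x \<in> carrier zadic3" using assms(2) V by blast
  have "zadic3_ball n (x n) \<subseteq> U"
  proof
    fix y assume y: "y \<in> zadic3_ball n (x n)"
    have "y i \<in> W i" for i
    proof (cases "W i = UNIV")
      case False
      then have "y \<in> zadic3_ball i (x i)"
        using n y zadic3_ball_antimono[OF x] by blast
      then show ?thesis using W(2) by (auto simp: zadic3_ball_def PiE_iff)
    qed simp
    then show "y \<in> U"
      using W(3) V(2) y by (auto simp: zadic3_ball_def)
  qed
  then show ?thesis by (rule that)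
qed

lemma zadic3_embedding_in_carrier: "zadic3_embedding k \<in> carrier zadic3"
  unfolding zadic3_embedding_def by (rule carrier_zadic3I) simp

lemma compact_group_zadic3: "compact_group zadic3 zadic3_topology"
  unfolding compact_group_def
proof (intro conjI)
  show "compact_space zadic3_topology"
    using compact_carrier_zadic3 by (simp add: zadic3_topology_eq compact_space_subtopology)
  show "Hausdorff_space zadic3_topology"
    unfolding Hausdorff_space_def
  proof (intro allI impI)
    fix x y assume xy: "x \<in> topspace zadic3_topology \<and> y \<in> topspace zadic3_topology \<and> x \<noteq> y"
    then obtain n where "x n \<noteq> y n" by blast
    then show "\<exists>U V. openin zadic3_topology U \<and> openin zadic3_topology V \<and> x \<in> U \<and> y \<in> V \<and> disjnt U V"
      using xy openin_zadic3_ball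
      by (intro exI[of _ "zadic3_ball n (x n)"] exI[of _ "zadic3_ball n (y n)"])
        (auto simp: zadic3_ball_def disjnt_def)
  qed
  have eq: "(\<lambda>(x, y). x \<otimes>\<^bsub>zadic3\<^esub> y) = (\<lambda>p n. (fst p n + snd p n) mod 3 ^ Suc n)"
    by (simp add: fun_eq_iff mult_zadic3)
  have coord: "continuous_on S (\<lambda>p :: (nat \<Rightarrow> int) \<times> (nat \<Rightarrow> int). fst p n)"
    "continuous_on S (\<lambda>p :: (nat \<Rightarrow> int) \<times> (nat \<Rightarrow> int). snd p n)" for S n
    by (rule continuous_on_compose2[where g = "\<lambda>x. x n", OF continuous_on_product_coordinates];
      simp add: continuous_on_fst continuous_on_snd)+
  have "continuous_on (carrier zadic3 \<times> carrier zadic3)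
      (\<lambda>p n. (fst p n + snd p n) mod 3 ^ Suc n)"
  proof (rule continuous_on_coordinatewise_then_product)
    fix n
    show "continuous_on (carrier zadic3 \<times> carrier zadic3) (\<lambda>p. (fst p n + snd p n) mod 3 ^ Suc n)"
      by (rule continuous_on_compose2[where g = "\<lambda>k. k mod 3 ^ Suc n",
        OF Topological_Spaces.continuous_on_discrete[of UNIV] continuous_on_add[OF coord]]) simp
  qed
  moreover have "(\<lambda>(x, y). x \<otimes>\<^bsub>zadic3\<^esub> y) ` (carrier zadic3 \<times> carrier zadic3) \<subseteq> carrier zadic3"
    using group.is_monoid[OF group_zadic3, THEN monoid.m_closed] by auto
  ultimately show "continuous_map (prod_topology zadic3_topology zadic3_topology) zadic3_topology
      (\<lambda>(x, y). x \<otimes>\<^bsub>zadic3\<^esub> y)"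
    unfolding zadic3_topology_eq prod_topology_subtopology_eu continuous_map_in_subtopology
      continuous_map_iff_continuous eq by auto
  have "continuous_on (carrier zadic3) (\<lambda>x n. - x n mod 3 ^ Suc n)"
  proof (rule continuous_on_coordinatewise_then_product)
    fix n
    show "continuous_on (carrier zadic3) (\<lambda>x. - x n mod 3 ^ Suc n)"
      by (rule continuous_on_coordinate)
  qed
  then have "continuous_on (carrier zadic3) (\<lambda>x. inv\<^bsub>zadic3\<^esub> x)"
    by (subst continuous_on_cong[OF refl inv_zadic3])
  moreover have "(\<lambda>x. inv\<^bsub>zadic3\<^esub> x) ` carrier zadic3 \<subseteq> carrier zadic3"
    using group.inv_closed[OF group_zadic3] by auto
  ultimately show "continuous_map zadic3_topology zadic3_topology (\<lambda>x. inv\<^bsub>zadic3\<^esub> x)"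
    unfolding zadic3_topology_eq continuous_map_in_subtopology continuous_map_iff_continuous by auto
qed (simp_all add: group_zadic3)

lemma group_compactification_zadic3: "group_compactification zadic3 zadic3_topology zadic3_embedding"
  unfolding group_compactification_def
proof (intro conjI compact_group_zadic3)
  show "zadic3_embedding \<in> hom integer_group zadic3"
    by (rule homI) (simp_all add: zadic3_embedding_in_carrier,
      simp only: zadic3_embedding_def mult_zadic3 mod_add_eq)
  show "zadic3_topology closure_of (range zadic3_embedding) = topspace zadic3_topology"
  proof (intro equalityI closure_of_subset_topspace subsetI)
    fix x assume x: "x \<in> topspace zadic3_topology"
    show "x \<in> zadic3_topology closure_of (range zadic3_embedding)"
      unfolding in_closure_of
    proof (intro conjI x allI impI)
      fix U assume "x \<in> U \<and> openin zadic3_topology U"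
      then obtain n where "zadic3_ball n (x n) \<subseteq> U"
        using zadic3_ball_base by blast
      \<comment> \<open>The residue \<open>x n\<close>, read as an integer, is the required
        approximation.\<close>
      moreover have "zadic3_embedding (x n) n = x n"
        using carrier_zadic3_mod[of x n n] x by (simp add: zadic3_embedding_def)
      then have "zadic3_embedding (x n) \<in> zadic3_ball n (x n)"
        by (simp add: zadic3_ball_def zadic3_embedding_in_carrier)
      ultimately show "\<exists>y. y \<in> range zadic3_embedding \<and> y \<in> U" by blast
    qed
  qed
qed

lemma inj_zadic3_embedding: "inj zadic3_embedding"
proof (rule injI)
  fix k l assume eq: "zadic3_embedding k = zadic3_embedding l"
  obtain n where n: "\<bar>k - l\<bar> < 3 ^ Suc n"
  proof -
    have "nat \<bar>k - l\<bar> < 3 ^ Suc (nat \<bar>k - l\<bar>)"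
      by (rule order_less_le_trans[OF less_exp order_trans[OF power_mono[of 2 3] power_increasing]]) auto
    then have "\<bar>k - l\<bar> < 3 ^ Suc (nat \<bar>k - l\<bar>)"
      by (simp add: nat_less_iff)
    then show ?thesis by (rule that)
  qed
  have "k mod 3 ^ Suc n = l mod 3 ^ Suc n"
    using fun_cong[OF eq, of n] by (simp add: zadic3_embedding_def)
  then have "3 ^ Suc n dvd k - l"
    by (simp only: mod_eq_dvd_iff)
  then show "k = l"
    using n zdvd_imp_le[of "3 ^ Suc n" "\<bar>k - l\<bar>"] by (cases "k = l") (auto simp del: power_Suc)
qed

section \<open>Ternary digits and the Haar measure\<close>

lemma sum_digits_bounds:
  fixes d :: "nat \<Rightarrow> int"
  assumes "\<And>i. 0 \<le> d i \<and> d i < 3"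
  shows "(\<Sum>i\<le>n. d i * 3 ^ i) \<in> {0..<3 ^ Suc n}"
proof (induction n)
  case 0
  then show ?case using assms[of 0] by simp
next
  case (Suc n)
  have "d (Suc n) * 3 ^ Suc n \<le> 2 * 3 ^ Suc n" "0 \<le> d (Suc n) * 3 ^ Suc n"
    using assms[of "Suc n"] by (intro mult_right_mono mult_nonneg_nonneg; simp)+
  then show ?case
    using Suc unfolding sum.atMost_Suc atLeastLessThan_iff power_Suc[of 3 "Suc n"] by linarith
qed

lemma digit_of_sum_digits:
  fixes d :: "nat \<Rightarrow> int"
  assumes d: "\<And>i. 0 \<le> d i \<and> d i < 3" and "j \<le> n"
  shows "(\<Sum>i\<le>n. d i * 3 ^ i) div 3 ^ j mod 3 = d j"
  using \<open>j \<le> n\<close>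
proof (induction n)
  case 0
  then show ?case using d[of 0] by simp
next
  case (Suc n)
  let ?S = "\<Sum>i\<le>n. d i * 3 ^ i"
  show ?case
  proof (cases "j = Suc n")
    case True
    then show ?thesis
      using sum_digits_bounds[of d n, OF d] d[of "Suc n"] by (simp del: power_Suc)
  next
    case False
    then have j: "j \<le> n" using Suc.prems by simp
    then have "d (Suc n) * 3 ^ Suc n = (3 * (d (Suc n) * 3 ^ (n - j))) * (3::int) ^ j"
      by (simp flip: power_add)
    then have S: "(\<Sum>i\<le>Suc n. d i * 3 ^ i) = ?S + (3 * (d (Suc n) * 3 ^ (n - j))) * 3 ^ j"
      by (simp only: sum.atMost_Suc)
    have "(\<Sum>i\<le>Suc n. d i * 3 ^ i) div 3 ^ j = 3 * (d (Suc n) * 3 ^ (n - j)) + ?S div 3 ^ j"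
      unfolding S by (rule div_mult_self1) simp
    then show ?thesis
      using Suc.IH[OF j] by (simp only: mod_mult_self4)
  qed
qed

lemma sum_digits_eq_mod:
  fixes a :: int
  assumes "\<And>i. i \<le> n \<Longrightarrow> d i = a div 3 ^ i mod 3"
  shows "(\<Sum>i\<le>n. d i * 3 ^ i) = a mod 3 ^ Suc n"
  using assms
proof (induction n)
  case (Suc n)
  have "a mod (3 ^ Suc n * 3) = 3 ^ Suc n * (a div 3 ^ Suc n mod 3) + a mod 3 ^ Suc n"
    by (rule zmod_zmult2_eq) simp
  then show ?case
    using Suc by (simp add: mult.commute)
qed simp

text \<open>Independent digits uniform on 0, 1, 2. The Haar measure is constructed as the law of the
  3-adic integer with these random digits.\<close>

definition digit_measure :: "(nat \<Rightarrow> int) measure" where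
  "digit_measure = PiM UNIV (\<lambda>_. uniform_count_measure {0, 1, 2})"

text \<open>For digits 0, 1, 2 the sum is already reduced; the \<open>mod\<close> makes every
  integer sequence land in the carrier.\<close>

definition digits_to_zadic3 :: "(nat \<Rightarrow> int) \<Rightarrow> nat \<Rightarrow> int" where
  "digits_to_zadic3 d = (\<lambda>n. (\<Sum>i\<le>n. d i * 3 ^ i) mod 3 ^ Suc n)"

definition zadic3_haar :: "(nat \<Rightarrow> int) measure" where
  "zadic3_haar = distr digit_measure
     (sigma (carrier zadic3) {U. openin zadic3_topology U}) digits_to_zadic3"

lemma digits_to_zadic3_in_carrier: "digits_to_zadic3 d \<in> carrier zadic3"
  unfolding digits_to_zadic3_def by (rule carrier_zadic3I) simp

lemma opens_zadic3_subset: "{U. openin zadic3_topology U} \<subseteq> Pow (carrier zadic3)"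
  using openin_subset[of zadic3_topology] by auto

text \<open>Balls form a base with a countable index set, so an open set is a countable union of
  balls.\<close>

lemma sigma_opens_zadic3:
  "sigma_sets (carrier zadic3) {U. openin zadic3_topology U}
    = sigma_sets (carrier zadic3) (range (\<lambda>(n, a). zadic3_ball n a))"
proof (rule sigma_sets_eqI)
  fix U assume "U \<in> {U. openin zadic3_topology U}"
  then have U: "openin zadic3_topology U" by simp
  define I where "I = {p. zadic3_ball (fst p) (snd p) \<subseteq> U}"
  have "U = (\<Union>p\<in>I. zadic3_ball (fst p) (snd p))"
  proof (intro equalityI subsetI)
    fix x assume "x \<in> U"
    moreover obtain n where "zadic3_ball n (x n) \<subseteq> U"
      using zadic3_ball_base[OF U \<open>x \<in> U\<close>] by blast
    moreover have "x \<in> carrier zadic3"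
      using \<open>x \<in> U\<close> openin_subset[OF U] by auto
    ultimately show "x \<in> (\<Union>p\<in>I. zadic3_ball (fst p) (snd p))"
      by (intro UN_I[of "(n, x n)"]) (auto simp: I_def zadic3_ball_def)
  qed (auto simp: I_def)
  also have "\<dots> \<in> sigma_sets (carrier zadic3) (range (\<lambda>(n, a). zadic3_ball n a))"
    by (rule sigma_sets_UNION) (auto intro!: sigma_sets.Basic)
  finally show "U \<in> sigma_sets (carrier zadic3) (range (\<lambda>(n, a). zadic3_ball n a))" .
qed (auto intro: openin_zadic3_ball)

lemma space_zadic3_haar [simp]: "space zadic3_haar = carrier zadic3"
  unfolding zadic3_haar_def by (simp add: space_measure_of[OF opens_zadic3_subset])

lemma sets_zadic3_haar:
  "sets zadic3_haar = sigma_sets (carrier zadic3) {U. openin zadic3_topology U}"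
  unfolding zadic3_haar_def by (simp add: sets_measure_of[OF opens_zadic3_subset])

lemma zadic3_ball_in_sets: "zadic3_ball n a \<in> sets zadic3_haar"
  unfolding sets_zadic3_haar by (rule sigma_sets.Basic) (simp add: openin_zadic3_ball)

lemma measurable_into_zadic3:
  assumes "f \<in> space M \<rightarrow> carrier zadic3"
    and "\<And>n a. f -` zadic3_ball n a \<inter> space M \<in> sets M"
    and N: "space N = carrier zadic3" "sets N = sigma_sets (carrier zadic3) {U. openin zadic3_topology U}"
  shows "f \<in> measurable M N"
  using N(2) unfolding sigma_opens_zadic3
  by (rule measurable_sigma_sets) (use assms(1,2) in \<open>auto simp: zadic3_ball_def\<close>)

lemma prob_space_digit_measure: "prob_space digit_measure"
  unfolding digit_measure_def
  by (intro prob_space_PiM prob_space_uniform_count_measure) auto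

text \<open>Uniqueness of ternary expansions: a residue modulo 3^(n+1) and its n + 1 digits
  determine each other.\<close>

lemma digits_vimage_ball:
  assumes "a \<in> {0..<3 ^ Suc n}"
  shows "digits_to_zadic3 -` zadic3_ball n a \<inter> space digit_measure
    = {d \<in> space digit_measure. \<forall>i\<in>{..n}. d i \<in> {a div 3 ^ i mod 3}}"
proof -
  have "digits_to_zadic3 d n = a \<longleftrightarrow> (\<forall>i\<le>n. d i = a div 3 ^ i mod 3)" if "d \<in> space digit_measure" for d
  proof -
    have d: "0 \<le> d i \<and> d i < 3" for i
      using that by (auto simp: digit_measure_def space_PiM space_uniform_count_measure PiE_iff Pi_iff dest: spec[of _ i])
    have "digits_to_zadic3 d n = (\<Sum>i\<le>n. d i * 3 ^ i)"
      using sum_digits_bounds[of d n, OF d] by (simp add: digits_to_zadic3_def del: power_Suc)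
    moreover have "a mod 3 ^ Suc n = a" using assms by (simp del: power_Suc)
    ultimately show ?thesis
      using digit_of_sum_digits[of d, OF d] sum_digits_eq_mod[of n d a] by metis
  qed
  then show ?thesis
    using digits_to_zadic3_in_carrier by (auto simp: zadic3_ball_def)
qed

lemma zadic3_ball_empty: "a \<notin> {0..<3 ^ Suc n} \<Longrightarrow> zadic3_ball n a = {}"
  unfolding zadic3_ball_def carrier_zadic3 by blast

lemma measurable_digits_to_zadic3:
  "digits_to_zadic3 \<in> measurable digit_measure
    (sigma (carrier zadic3) {U. openin zadic3_topology U})"
proof (rule measurable_into_zadic3)
  fix n a
  show "digits_to_zadic3 -` zadic3_ball n a \<inter> space digit_measure \<in> sets digit_measure"
  proof (cases "a \<in> {0..<3 ^ Suc n}")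
    case True
    have meas: "(\<lambda>d. d i) \<in> measurable digit_measure (count_space UNIV)" for i
    proof -
      have "(\<lambda>d. d i) \<in> measurable digit_measure (uniform_count_measure {0, 1, 2})"
        unfolding digit_measure_def by (rule measurable_component_singleton) simp
      then have "(\<lambda>d. d i) \<in> measurable digit_measure (count_space {0, 1, 2})"
        by (simp add: measurable_cong_sets[OF refl sets_uniform_count_measure_count_space])
      then show ?thesis
        using measurable_compose[of "\<lambda>d. d i" digit_measure "count_space {0, 1, 2}" "\<lambda>x. x" "count_space UNIV"]
        by simp
    qed
    have "{d \<in> space digit_measure. d i \<in> {c}} \<in> sets digit_measure" for i and c :: int
    proof -
      have "{d \<in> space digit_measure. d i \<in> {c}} = (\<lambda>d. d i) -` {c} \<inter> space digit_measure"
        by blast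
      then show ?thesis using measurable_sets[OF meas, of "{c}" i] by simp
    qed
    then show ?thesis
      unfolding digits_vimage_ball[OF True] by (intro sets.sets_Collect_finite_All) auto
  qed (simp add: zadic3_ball_empty)
qed (auto simp: digits_to_zadic3_in_carrier sets_measure_of[OF opens_zadic3_subset]
  space_measure_of[OF opens_zadic3_subset])

lemma mod_3_cases: "(x :: int) mod 3 = 0 \<or> x mod 3 = 1 \<or> x mod 3 = 2"
  by presburger

lemma emeasure_zadic3_ball:
  assumes "a \<in> {0..<3 ^ Suc n}"
  shows "emeasure zadic3_haar (zadic3_ball n a) = ennreal (1 / 3 ^ Suc n)"
proof -
  interpret product_prob_space "\<lambda>_ :: nat. uniform_count_measure {0, 1, 2 :: int}" UNIV
    by (intro product_prob_spaceI prob_space_uniform_count_measure) auto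
  have "emeasure zadic3_haar (zadic3_ball n a)
    = emeasure digit_measure (digits_to_zadic3 -` zadic3_ball n a \<inter> space digit_measure)"
    using zadic3_ball_in_sets[of n a] unfolding zadic3_haar_def
    by (intro emeasure_distr measurable_digits_to_zadic3) simp
  also have "\<dots> = (\<Prod>i\<in>{..n}. emeasure (uniform_count_measure {0, 1, 2 :: int}) {a div 3 ^ i mod 3})"
    unfolding digits_vimage_ball[OF assms] unfolding digit_measure_def
  proof (rule emeasure_PiM_Collect)
    fix i
    show "{a div 3 ^ i mod 3} \<in> sets (uniform_count_measure {0, 1, 2})"
      using mod_3_cases[of "a div 3 ^ i"] by (auto simp: sets_uniform_count_measure)
  qed auto
  also have "\<dots> = (\<Prod>i\<in>{..n}. ennreal (1 / 3))"
  proof (rule prod.cong[OF refl])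
    fix i
    show "emeasure (uniform_count_measure {0, 1, 2}) {a div 3 ^ i mod 3} = ennreal (1 / 3)"
      using mod_3_cases[of "a div 3 ^ i"] by (subst emeasure_uniform_count_measure) auto
  qed
  also have "\<dots> = ennreal ((1 / 3) ^ Suc n)"
    by (simp only: prod_constant card_atMost ennreal_power)
  finally show ?thesis by (simp only: power_one_over)
qed

lemma prob_space_zadic3_haar: "prob_space zadic3_haar"
  unfolding zadic3_haar_def
  by (rule prob_space.prob_space_distr[OF prob_space_digit_measure measurable_digits_to_zadic3])

text \<open>Ultrametric behaviour: two balls are nested or disjoint.\<close>

lemma Int_stable_zadic3_balls: "Int_stable (range (\<lambda>(n, a). zadic3_ball n a))"
proof (rule Int_stableI, clarsimp)
  fix n a m b
  have *: "zadic3_ball n a \<inter> zadic3_ball m b \<in> {zadic3_ball m b, {}}" if "n \<le> m" for n a m b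
  proof (cases "zadic3_ball n a \<inter> zadic3_ball m b = {}")
    case False
    then obtain z where z: "z \<in> carrier zadic3" "a = z n" "b = z m"
      by (auto simp: zadic3_ball_def)
    then show ?thesis
      using zadic3_ball_antimono[OF z(1) that] by auto
  qed simp
  have range: "zadic3_ball n a \<in> range (\<lambda>(n, a). zadic3_ball n a)" for n a
    using rangeI[of "\<lambda>(n, a). zadic3_ball n a" "(n, a)"] by simp
  \<comment> \<open>A residue out of range presents the empty set as a ball, as the disjoint case
    demands.\<close>
  have "zadic3_ball 0 (- 1) = {}" by (rule zadic3_ball_empty) simp
  then have "{} \<in> range (\<lambda>(n, a). zadic3_ball n a)"
    using range[of 0 "- 1"] by simp
  then show "zadic3_ball n a \<inter> zadic3_ball m b \<in> range (\<lambda>(n, a). zadic3_ball n a)"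
    using *[of n m a b] *[of m n b a] range[of n a] range[of m b] Int_commute[of "zadic3_ball n a"]
    by (metis insertE nat_le_linear singletonD)
qed

text \<open>Translation permutes the balls of one level, which have equal mass; agreement on this
  intersection-stable generator extends to all Borel sets. The map \<open>\<tau>\<close> translates
  by the inverse, so that its preimages are the images under translation by
  \<open>g\<close>.\<close>

lemma zadic3_haar_translate:
  assumes g: "g \<in> carrier zadic3" and A: "A \<in> sets zadic3_haar"
  shows "emeasure zadic3_haar ((\<lambda>x. g \<otimes>\<^bsub>zadic3\<^esub> x) ` A) = emeasure zadic3_haar A"
proof -
  interpret group zadic3 by (rule group_zadic3)
  interpret P: prob_space zadic3_haar by (rule prob_space_zadic3_haar)
  define \<tau> where "\<tau> x = inv\<^bsub>zadic3\<^esub> g \<otimes>\<^bsub>zadic3\<^esub> x" for x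
  have vimage: "\<tau> -` B \<inter> carrier zadic3 = (\<lambda>x. g \<otimes>\<^bsub>zadic3\<^esub> x) ` B" if "B \<subseteq> carrier zadic3" for B
  proof (intro equalityI subsetI)
    fix x assume "x \<in> \<tau> -` B \<inter> carrier zadic3"
    then have "\<tau> x \<in> B" "x = g \<otimes>\<^bsub>zadic3\<^esub> \<tau> x"
      using g by (auto simp: \<tau>_def simp flip: m_assoc)
    then show "x \<in> (\<lambda>x. g \<otimes>\<^bsub>zadic3\<^esub> x) ` B" by blast
  qed (use that g in \<open>auto simp: \<tau>_def simp flip: m_assoc\<close>)
  have ball: "\<tau> -` zadic3_ball n a \<inter> carrier zadic3 = zadic3_ball n ((g n + a) mod 3 ^ Suc n)"
    if a: "a \<in> {0..<3 ^ Suc n}" for n a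
  proof (intro equalityI subsetI)
    fix x assume "x \<in> \<tau> -` zadic3_ball n a \<inter> carrier zadic3"
    then have x: "x \<in> carrier zadic3" "\<tau> x n = a" "x = g \<otimes>\<^bsub>zadic3\<^esub> \<tau> x"
      using g by (auto simp: zadic3_ball_def \<tau>_def simp flip: m_assoc)
    then have "x n = (g n + a) mod 3 ^ Suc n"
      by (metis mult_zadic3)
    then show "x \<in> zadic3_ball n ((g n + a) mod 3 ^ Suc n)"
      using x by (simp add: zadic3_ball_def)
  next
    fix x assume x: "x \<in> zadic3_ball n ((g n + a) mod 3 ^ Suc n)"
    then have "\<tau> x n = (- g n mod 3 ^ Suc n + (g n + a) mod 3 ^ Suc n) mod 3 ^ Suc n"
      by (simp add: zadic3_ball_def \<tau>_def mult_zadic3 inv_zadic3[OF g])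
    also have "\<dots> = a mod 3 ^ Suc n"
      by (simp add: mod_add_eq del: power_Suc)
    also have "\<dots> = a" using a by (simp del: power_Suc)
    finally show "x \<in> \<tau> -` zadic3_ball n a \<inter> carrier zadic3"
      using x g by (auto simp: zadic3_ball_def \<tau>_def)
  qed
  have ball': "\<tau> -` zadic3_ball n a \<inter> carrier zadic3 \<in> sets zadic3_haar" for n a
    by (cases "a \<in> {0..<3 ^ Suc n}") (simp_all only: ball zadic3_ball_in_sets, simp add: zadic3_ball_empty)
  have meas: "\<tau> \<in> measurable zadic3_haar zadic3_haar"
    by (rule measurable_into_zadic3) (use g ball' in \<open>auto simp: \<tau>_def sets_zadic3_haar\<close>)
  have "distr zadic3_haar zadic3_haar \<tau> = zadic3_haar"
  proof (rule measure_eqI_generator_eq[OF Int_stable_zadic3_balls, of "carrier zadic3" _ _ "\<lambda>a. zadic3_ball 0 (int a)"])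
    fix X assume "X \<in> range (\<lambda>(n, a). zadic3_ball n a)"
    then obtain n a where X: "X = zadic3_ball n a" by auto
    have "emeasure (distr zadic3_haar zadic3_haar \<tau>) X = emeasure zadic3_haar (\<tau> -` X \<inter> carrier zadic3)"
      using meas zadic3_ball_in_sets by (simp add: emeasure_distr X)
    also have "\<dots> = emeasure zadic3_haar X"
    proof (cases "a \<in> {0..<3 ^ Suc n}")
      case True
      moreover have "(g n + a) mod 3 ^ Suc n \<in> {0..<3 ^ Suc n}" by simp
      ultimately show ?thesis
        by (simp only: X ball emeasure_zadic3_ball)
    qed (simp add: X zadic3_ball_empty)
    finally show "emeasure (distr zadic3_haar zadic3_haar \<tau>) X = emeasure zadic3_haar X" .
  next
    show "(\<Union>a. zadic3_ball 0 (int a)) = carrier zadic3"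
    proof (intro equalityI subsetI)
      fix x assume x: "x \<in> carrier zadic3"
      then have "x 0 = int (nat (x 0))" by (simp add: carrier_zadic3)
      then show "x \<in> (\<Union>a. zadic3_ball 0 (int a))"
        using x by (intro UN_I[of "nat (x 0)"]) (simp_all add: zadic3_ball_def)
    qed (auto simp: zadic3_ball_def)
    show "emeasure (distr zadic3_haar zadic3_haar \<tau>) (zadic3_ball 0 (int i)) \<noteq> \<infinity>" for i
      using meas zadic3_ball_in_sets by (simp add: emeasure_distr)
  qed (auto simp: sets_zadic3_haar sigma_opens_zadic3 zadic3_ball_def)
  then have "emeasure zadic3_haar A = emeasure (distr zadic3_haar zadic3_haar \<tau>) A" by simp
  also have "\<dots> = emeasure zadic3_haar (\<tau> -` A \<inter> carrier zadic3)"
    using meas A by (simp add: emeasure_distr)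
  also have "\<tau> -` A \<inter> carrier zadic3 = (\<lambda>x. g \<otimes>\<^bsub>zadic3\<^esub> x) ` A"
    using sets.sets_into_space[OF A] by (intro vimage) simp
  finally show ?thesis by simp
qed

lemma compactin_zadic3: "compactin zadic3_topology K \<longleftrightarrow> compact K \<and> K \<subseteq> carrier zadic3"
  by (simp add: zadic3_topology_eq compactin_subtopology)

text \<open>Inner regularity comes from the Polish space of real sequences, in which the 3-adic integers
  are embedded as a compact set.\<close>

lemma zadic3_haar_inner_regular:
  assumes A: "A \<in> sets zadic3_haar"
  shows "emeasure zadic3_haar A
    = (SUP K\<in>{K. compactin zadic3_topology K \<and> K \<subseteq> A}. emeasure zadic3_haar K)"
proof (rule antisym)
  interpret P: prob_space zadic3_haar by (rule prob_space_zadic3_haar)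
  define e :: "(nat \<Rightarrow> int) \<Rightarrow> nat \<Rightarrow> real" where "e x = (\<lambda>n. of_int (x n))" for x
  have inj: "inj e" by (rule injI) (simp add: e_def fun_eq_iff)
  have cont: "continuous_on S e" for S
    unfolding e_def by (intro continuous_on_coordinatewise_then_product continuous_on_coordinate)
  \<comment> \<open>Balls are compact and so have compact images; injectivity of \<open>e\<close>
    lets complements through.\<close>
  have "e ` B \<in> sets borel" if "B \<in> sigma_sets (carrier zadic3) (range (\<lambda>(n, a). zadic3_ball n a))" for B
    using that
  proof induction
    case (Basic B)
    then obtain n a where B: "B = zadic3_ball n a" by auto
    have "closed ((\<lambda>x :: nat \<Rightarrow> int. x n) -` {a})"
      by (intro closed_vimage continuous_on_product_coordinates)
        (simp add: closed_def discrete_topology_class.open_discrete)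
    moreover have "B = carrier zadic3 \<inter> (\<lambda>x. x n) -` {a}"
      unfolding B zadic3_ball_def by blast
    ultimately have "compact B"
      using compact_carrier_zadic3 by (simp only: compact_Int_closed)
    then show ?case
      by (intro borel_closed compact_imp_closed compact_continuous_image cont)
  next
    case (Compl B)
    have "e ` (carrier zadic3 - B) = e ` carrier zadic3 - e ` B"
      by (rule image_set_diff[OF inj])
    moreover have "e ` carrier zadic3 \<in> sets borel"
      by (intro borel_closed compact_imp_closed compact_continuous_image cont compact_carrier_zadic3)
    ultimately show ?case using Compl by simp
  next
    case (Union B)
    then show ?case by (simp add: image_UN)
  qed simp
  then have eA: "e ` A \<in> sets borel"
    using A by (simp add: sets_zadic3_haar sigma_opens_zadic3)
  have e_meas: "e \<in> borel_measurable zadic3_haar"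
  proof (rule borel_measurableI)
    fix S :: "(nat \<Rightarrow> real) set" assume "open S"
    then have "openin zadic3_topology (carrier zadic3 \<inter> e -` S)"
      unfolding zadic3_topology_eq by (rule continuous_openin_preimage_gen[OF cont])
    then show "e -` S \<inter> space zadic3_haar \<in> sets zadic3_haar"
      unfolding sets_zadic3_haar by (intro sigma_sets.Basic) (simp add: Int_commute)
  qed
  define N where "N = distr zadic3_haar borel e"
  interpret N: prob_space N
    unfolding N_def by (rule P.prob_space_distr[OF e_meas])
  have vimage: "e -` e ` A \<inter> space zadic3_haar = A"
    using sets.sets_into_space[OF A] inj by (simp add: inj_vimage_image_eq Int_absorb2)
  have "emeasure zadic3_haar A = emeasure N (e ` A)"
    unfolding N_def by (subst emeasure_distr[OF e_meas eA]) (simp only: vimage)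
  also have "\<dots> = (SUP K\<in>{K. K \<subseteq> e ` A \<and> compact K}. emeasure N K)"
    by (rule inner_regular) (use eA N.emeasure_finite[of UNIV] in \<open>auto simp: N_def\<close>)
  also have "\<dots> \<le> (SUP K\<in>{K. compactin zadic3_topology K \<and> K \<subseteq> A}. emeasure zadic3_haar K)"
  proof (rule SUP_mono)
    fix K assume "K \<in> {K. K \<subseteq> e ` A \<and> compact K}"
    then have K: "K \<subseteq> e ` A" "compact K" by auto
    let ?K = "e -` K \<inter> carrier zadic3"
    have "closed (e -` K)"
      using K(2) by (intro closed_vimage compact_imp_closed cont)
    then have "compact ?K"
      by (rule closed_Int_compact[OF _ compact_carrier_zadic3])
    moreover have "?K \<subseteq> A" using K(1) inj by (auto dest: injD)
    moreover have "emeasure N K = emeasure zadic3_haar ?K"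
      unfolding N_def using K(2) by (subst emeasure_distr[OF e_meas]) (auto intro: borel_closed compact_imp_closed)
    ultimately show "\<exists>K'\<in>{K. compactin zadic3_topology K \<and> K \<subseteq> A}. emeasure N K \<le> emeasure zadic3_haar K'"
      by (intro bexI[of _ ?K]) (auto simp: compactin_zadic3)
  qed
  finally show "emeasure zadic3_haar A \<le> (SUP K\<in>{K. compactin zadic3_topology K \<and> K \<subseteq> A}. emeasure zadic3_haar K)" .
  show "(SUP K\<in>{K. compactin zadic3_topology K \<and> K \<subseteq> A}. emeasure zadic3_haar K) \<le> emeasure zadic3_haar A"
    by (rule SUP_least) (use A in \<open>auto intro: emeasure_mono\<close>)
qed

lemma normalized_haar_measure_zadic3: "normalized_haar_measure zadic3 zadic3_topology zadic3_haar"
  unfolding normalized_haar_measure_def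
  using prob_space.emeasure_space_1[OF prob_space_zadic3_haar] zadic3_haar_translate
    zadic3_haar_inner_regular
  by (simp add: sets_zadic3_haar)

section \<open>The Riemann integrable realization\<close>

definition zadic3_extension :: "(nat \<Rightarrow> int) \<Rightarrow> complex" where
  "zadic3_extension x =
     (if x \<in> range zadic3_embedding then of_real (cos_product (the_inv zadic3_embedding x)) else 0)"

lemma zadic3_extension_embedding: "zadic3_extension (zadic3_embedding k) = of_real (cos_product k)"
  by (simp add: zadic3_extension_def the_inv_f_f[OF inj_zadic3_embedding])

text \<open>The bound depends on the coordinate \<open>x n\<close> alone and is thus constant on a
  ball: \<open>Suc n\<close> factors have period 3^(n+1), the modulus of coordinate
  \<open>n\<close>.\<close>

lemma norm_zadic3_extension_le: "norm (zadic3_extension x) \<le> cos_partial_product (Suc n) (x n)"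
proof (cases "x \<in> range zadic3_embedding")
  case True
  then obtain k where x: "x = zadic3_embedding k" by blast
  have "cos_partial_product (Suc n) k = cos_partial_product (Suc n) (x n)"
    using cos_partial_product_periodic[of "Suc n" "k mod 3 ^ Suc n" "k div 3 ^ Suc n"]
    by (simp only: mod_mult_div_eq x zadic3_embedding_def)
  then show ?thesis
    using cos_product_le_partial[of k "Suc n"] cos_product_nonneg[of k]
    by (simp add: x zadic3_extension_embedding)
qed (simp add: zadic3_extension_def cos_partial_product_nonneg)

definition partial_level :: "real \<Rightarrow> nat \<Rightarrow> (nat \<Rightarrow> int) set" where
  "partial_level \<epsilon> n = {x \<in> carrier zadic3. \<epsilon> \<le> cos_partial_product (Suc n) (x n)}"

lemma partial_level_eq:
  "partial_level \<epsilon> n = (\<Union>a\<in>{0..<3 ^ Suc n} \<inter> {a. \<epsilon> \<le> cos_partial_product (Suc n) a}. zadic3_ball n a)"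
  unfolding partial_level_def zadic3_ball_def carrier_zadic3 by blast

lemma partial_level_in_sets: "partial_level \<epsilon> n \<in> sets zadic3_haar"
  unfolding partial_level_eq by (intro sets.finite_UN) (auto intro: zadic3_ball_in_sets)

text \<open>Markov's inequality: the set consists of balls of mass 3^(-n-1), and the partial product
  sums to (3/2)^(n+1) over all balls of this level.\<close>

lemma measure_partial_level:
  assumes "0 < \<epsilon>"
  shows "measure zadic3_haar (partial_level \<epsilon> n) \<le> (1 / 2) ^ Suc n / \<epsilon>"
proof -
  interpret prob_space zadic3_haar by (rule prob_space_zadic3_haar)
  let ?I = "{0..<3 ^ Suc n} :: int set"
  let ?J = "?I \<inter> {a. \<epsilon> \<le> cos_partial_product (Suc n) a}"
  have "measure zadic3_haar (partial_level \<epsilon> n) \<le> (\<Sum>a\<in>?J. measure zadic3_haar (zadic3_ball n a))"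
    unfolding partial_level_eq
    by (intro finite_measure_subadditive_finite) (auto intro: zadic3_ball_in_sets)
  also have "\<dots> = (\<Sum>a\<in>?J. 1 / 3 ^ Suc n)"
    by (intro sum.cong refl) (simp add: measure_def emeasure_zadic3_ball del: power_Suc)
  also have "\<dots> \<le> (\<Sum>a\<in>?J. cos_partial_product (Suc n) a / \<epsilon> / 3 ^ Suc n)"
    using assms by (intro sum_mono divide_right_mono) (auto simp: field_simps)
  also have "\<dots> \<le> (\<Sum>a\<in>?I. cos_partial_product (Suc n) a / \<epsilon> / 3 ^ Suc n)"
    using assms by (intro sum_mono2) (auto intro!: divide_nonneg_pos cos_partial_product_nonneg)
  also have "\<dots> = (\<Sum>a\<in>?I. cos_partial_product (Suc n) a) / \<epsilon> / 3 ^ Suc n"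
    by (simp only: sum_divide_distrib)
  also have "(\<Sum>a\<in>?I. cos_partial_product (Suc n) a) = (\<Sum>i<3 ^ Suc n. cos_partial_product (Suc n) (0 + int i))"
    by (rule sum.reindex_bij_witness[of _ int nat]) (auto simp: nat_less_iff simp del: power_Suc)
  also have "\<dots> = (3 / 2) ^ Suc n"
    by (rule sum_cos_partial_product)
  also have "(3 / 2) ^ Suc n / \<epsilon> / 3 ^ Suc n = (1 / 2) ^ Suc n / \<epsilon>"
    by (simp add: power_divide)
  finally show ?thesis .
qed

lemma null_partial_levels:
  assumes "0 < \<epsilon>"
  shows "(\<Inter>n. partial_level \<epsilon> n) \<in> null_sets zadic3_haar"
proof -
  interpret prob_space zadic3_haar by (rule prob_space_zadic3_haar)
  have sets: "(\<Inter>n. partial_level \<epsilon> n) \<in> sets zadic3_haar"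
    by (intro sets.countable_INT) (auto intro: partial_level_in_sets)
  have "measure zadic3_haar (\<Inter>n. partial_level \<epsilon> n) \<le> (1 / 2) ^ Suc n / \<epsilon>" for n
    using finite_measure_mono[OF _ partial_level_in_sets, of "\<Inter>n. partial_level \<epsilon> n" \<epsilon> n]
      measure_partial_level[OF assms, of n] by (meson INT_lower UNIV_I order_trans)
  moreover have "(\<lambda>n. (1 / 2) ^ Suc n / \<epsilon>) \<longlonglongrightarrow> 0 / \<epsilon>"
    using assms by (intro tendsto_divide tendsto_const LIMSEQ_Suc[OF LIMSEQ_power_zero]) auto
  ultimately have "measure zadic3_haar (\<Inter>n. partial_level \<epsilon> n) \<le> 0"
    using LIMSEQ_le_const[of _ "0 / \<epsilon>"] by simp
  then show ?thesis
    using sets by (simp add: null_sets_def emeasure_eq_measure measure_le_0_iff)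
qed

text \<open>The bound of \<open>norm_zadic3_extension_le\<close> forces the value 0 at
  \<open>x\<close> and stays below a given \<epsilon> on a whole ball around it.\<close>

lemma topcontinuous_at_zadic3_extension:
  assumes x: "x \<in> carrier zadic3"
    and small: "\<And>\<epsilon>. 0 < \<epsilon> \<Longrightarrow> \<exists>n. cos_partial_product (Suc n) (x n) < \<epsilon>"
  shows "topcontinuous_at zadic3_topology euclidean zadic3_extension x"
proof -
  have "norm (zadic3_extension x) \<le> 0 + \<epsilon>" if "0 < \<epsilon>" for \<epsilon>
    using small[OF that] norm_zadic3_extension_le[of x] by (metis add_0 less_imp_le order_trans)
  then have "norm (zadic3_extension x) \<le> 0" by (rule field_le_epsilon)
  then have zero: "zadic3_extension x = 0" by simp
  have "\<exists>U. openin zadic3_topology U \<and> x \<in> U \<and> (\<forall>y\<in>U. zadic3_extension y \<in> V)"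
    if V: "open V" "zadic3_extension x \<in> V" for V
  proof -
    obtain \<epsilon> where \<epsilon>: "0 < \<epsilon>" "ball 0 \<epsilon> \<subseteq> V"
      using open_contains_ball[of V] V zero by auto
    obtain n where n: "cos_partial_product (Suc n) (x n) < \<epsilon>"
      using small[OF \<epsilon>(1)] by blast
    have "zadic3_extension y \<in> V" if "y \<in> zadic3_ball n (x n)" for y
    proof -
      have "norm (zadic3_extension y) < \<epsilon>"
        using norm_zadic3_extension_le[of y n] n that by (simp add: zadic3_ball_def)
      then show ?thesis using \<epsilon>(2) by auto
    qed
    then show ?thesis
      using openin_zadic3_ball x by (intro exI[of _ "zadic3_ball n (x n)"]) (auto simp: zadic3_ball_def)
  qed
  then show ?thesis
    using x by (simp add: topcontinuous_at_def)
qed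

lemma realized_by_zadic3:
  "realized_by (\<lambda>k. of_real (cos_product k)) zadic3 zadic3_topology zadic3_embedding zadic3_haar zadic3_extension"
  unfolding realized_by_def riemann_integrable_def
proof (intro conjI group_compactification_zadic3 normalized_haar_measure_zadic3)
  have "norm (zadic3_extension x) \<le> 1" for x
    using cos_product_nonneg cos_product_le_1 by (simp add: zadic3_extension_def)
  then show "bounded (zadic3_extension ` topspace zadic3_topology)"
    by (auto simp: bounded_iff)
  let ?D = "{x \<in> topspace zadic3_topology. \<not> topcontinuous_at zadic3_topology euclidean zadic3_extension x}"
  let ?N = "\<Union>m. \<Inter>n. partial_level (inverse (real (Suc m))) n"
  have "?N \<in> null_sets zadic3_haar"
    by (intro null_sets_UN null_partial_levels) simp
  moreover have "?D \<subseteq> ?N"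
  proof
    fix x assume "x \<in> ?D"
    then have x: "x \<in> carrier zadic3" "\<not> topcontinuous_at zadic3_topology euclidean zadic3_extension x"
      by auto
    then obtain \<epsilon> where \<epsilon>: "0 < \<epsilon>" "\<And>n. \<epsilon> \<le> cos_partial_product (Suc n) (x n)"
      using topcontinuous_at_zadic3_extension[OF x(1)] by (meson not_le)
    then obtain m where "inverse (real (Suc m)) < \<epsilon>"
      using reals_Archimedean by blast
    then have "inverse (real (Suc m)) \<le> cos_partial_product (Suc n) (x n)" for n
      using \<epsilon>(2)[of n] by linarith
    then show "x \<in> ?N"
      using x(1) unfolding partial_level_def by blast
  qed
  ultimately show "?D \<in> null_sets (completion zadic3_haar)"
    unfolding null_sets_completion_iff2 by blast
  show "(\<lambda>k. of_real (cos_product k)) = zadic3_extension \<circ> zadic3_embedding"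
    by (simp add: fun_eq_iff zadic3_extension_embedding)
qed

text \<open>The support lies in the countable image of the integers, and singletons there are
  nowhere dense: adding 3^(m+1) to an integer gives another point in the same ball of level
  m.\<close>

lemma meager_zadic3_extension:
  "meager_in zadic3_topology {x \<in> topspace zadic3_topology. zadic3_extension x \<noteq> 0}"
  unfolding meager_in_def
proof (intro exI conjI allI)
  let ?A = "{x \<in> topspace zadic3_topology. zadic3_extension x \<noteq> 0}"
  let ?p = "\<lambda>n. zadic3_embedding (int_decode n)"
  \<comment> \<open>Intersected with the support because \<open>meager_in\<close> asks for equality
    with the union.\<close>
  let ?N = "\<lambda>n. ?A \<inter> {?p n}"
  fix n
  show "?N n \<subseteq> topspace zadic3_topology" by blast
  have "closedin zadic3_topology {?p n}"
    using compact_group_zadic3 zadic3_embedding_in_carrier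
    by (intro closedin_Hausdorff_singleton) (simp_all add: compact_group_def)
  then have "zadic3_topology closure_of ?N n \<subseteq> {?p n}"
    by (intro closure_of_minimal) auto
  moreover have "W = {}" if W: "openin zadic3_topology W" "W \<subseteq> {?p n}" for W
  proof (rule ccontr)
    assume "W \<noteq> {}"
    then have "?p n \<in> W" using W(2) by blast
    then obtain m where m: "zadic3_ball m (?p n m) \<subseteq> W"
      using zadic3_ball_base[OF W(1)] by blast
    let ?y = "zadic3_embedding (int_decode n + 3 ^ Suc m)"
    have "?y m = ?p n m" by (simp add: zadic3_embedding_def)
    then have "?y \<in> zadic3_ball m (?p n m)"
      by (simp add: zadic3_ball_def zadic3_embedding_in_carrier)
    then have "?y = ?p n" using m W(2) by blast
    then show False using injD[OF inj_zadic3_embedding] by fastforce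
  qed
  ultimately show "zadic3_topology interior_of (zadic3_topology closure_of ?N n) = {}"
    unfolding interior_of_def by blast
next
  let ?A = "{x \<in> topspace zadic3_topology. zadic3_extension x \<noteq> 0}"
  have "x \<in> range zadic3_embedding" if "x \<in> ?A" for x
    using that by (auto simp: zadic3_extension_def split: if_splits)
  then show "?A = (\<Union>n. ?A \<inter> {zadic3_embedding (int_decode n)})"
    using surj_int_decode by (auto, metis surj_def rangeE)
qed

section \<open>Transport of realizations\<close>

text \<open>Transport of structure along an injection, later the map to neighbourhood traces. The
  topology is pulled back along the inverse \<open>preimage\<close>, which makes \<open>j\<close> a
  homeomorphism onto its image.\<close>

locale transported_group =
  fixes G :: "'c monoid" and T :: "'c topology" and j :: "'c \<Rightarrow> 'd"
  assumes cg: "compact_group G T" and inj: "inj_on j (carrier G)"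
begin

definition preimage :: "'d \<Rightarrow> 'c" where
  "preimage = inv_into (carrier G) j"

definition image_group :: "'d monoid" where
  "image_group = \<lparr>carrier = j ` carrier G, monoid.mult = (\<lambda>a b. j (preimage a \<otimes>\<^bsub>G\<^esub> preimage b)), one = j \<one>\<^bsub>G\<^esub>\<rparr>"

definition image_topology :: "'d topology" where
  "image_topology = pullback_topology (j ` carrier G) preimage T"

lemma preimage_j [simp]: "x \<in> carrier G \<Longrightarrow> preimage (j x) = x"
  by (simp add: preimage_def inj)

lemma j_preimage [simp]: "y \<in> j ` carrier G \<Longrightarrow> j (preimage y) = y"
  by (simp add: preimage_def f_inv_into_f)

lemma preimage_in [simp]: "y \<in> j ` carrier G \<Longrightarrow> preimage y \<in> carrier G"
  by (simp add: preimage_def inv_into_into)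

lemma group_G: "group G" and topspace_T: "topspace T = carrier G"
  using cg by (auto simp: compact_group_def)

lemma carrier_image_group [simp]: "carrier image_group = j ` carrier G"
  and mult_image_group [simp]: "a \<otimes>\<^bsub>image_group\<^esub> b = j (preimage a \<otimes>\<^bsub>G\<^esub> preimage b)"
  and one_image_group [simp]: "\<one>\<^bsub>image_group\<^esub> = j \<one>\<^bsub>G\<^esub>"
  by (simp_all add: image_group_def)

lemma group_image_group: "group image_group"
proof -
  interpret group G by (rule group_G)
  show ?thesis
  proof (rule groupI)
    fix x assume "x \<in> carrier image_group"
    then show "\<exists>y\<in>carrier image_group. y \<otimes>\<^bsub>image_group\<^esub> x = \<one>\<^bsub>image_group\<^esub>"
      by (intro bexI[of _ "j (inv\<^bsub>G\<^esub> preimage x)"]) auto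
  qed (auto simp: m_assoc)
qed

lemma inv_image_group: "y \<in> j ` carrier G \<Longrightarrow> inv\<^bsub>image_group\<^esub> y = j (inv\<^bsub>G\<^esub> preimage y)"
proof -
  interpret group G by (rule group_G)
  assume "y \<in> j ` carrier G"
  then show ?thesis
    by (intro group.inv_equality[OF group_image_group]) auto
qed

lemma topspace_image_topology [simp]: "topspace image_topology = j ` carrier G"
  unfolding image_topology_def topspace_pullback_topology topspace_T by auto

lemma homeomorphic_maps_image_topology: "homeomorphic_maps T image_topology j preimage"
  unfolding homeomorphic_maps_def
proof (intro conjI ballI)
  have "continuous_map T T (preimage \<circ> j)"
    by (rule continuous_map_eq[OF continuous_map_id]) (simp add: topspace_T)
  then show "continuous_map T image_topology j"
    unfolding image_topology_def by (rule continuous_map_pullback') (auto simp: topspace_T)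
  have "continuous_map image_topology T (id \<circ> preimage)"
    unfolding image_topology_def by (rule continuous_map_pullback[OF continuous_map_id])
  then show "continuous_map image_topology T preimage" by simp
qed (simp_all add: topspace_T)

lemma continuous_j: "continuous_map T image_topology j"
  and continuous_preimage: "continuous_map image_topology T preimage"
  using homeomorphic_maps_image_topology by (auto simp: homeomorphic_maps_def)

lemma homeomorphic_space_image_topology: "T homeomorphic_space image_topology"
  using homeomorphic_maps_image_topology homeomorphic_space_def by blast

lemma compact_image_group: "compact_group image_group image_topology"
  unfolding compact_group_def
proof (intro conjI)
  show "compact_space image_topology"
    using homeomorphic_compact_space[OF homeomorphic_space_image_topology] cg by (simp add: compact_group_def)
  show "Hausdorff_space image_topology"
    using homeomorphic_Hausdorff_space[OF homeomorphic_space_image_topology] cg by (simp add: compact_group_def)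
  have "continuous_map (prod_topology image_topology image_topology) (prod_topology T T) (\<lambda>(a, b). (preimage a, preimage b))"
    using continuous_preimage by (simp add: continuous_map_prod_top)
  then have "continuous_map (prod_topology image_topology image_topology) image_topology
      (j \<circ> ((\<lambda>(x, y). x \<otimes>\<^bsub>G\<^esub> y) \<circ> (\<lambda>(a, b). (preimage a, preimage b))))"
    using cg by (intro continuous_map_compose[OF _ continuous_j] continuous_map_compose)
      (auto simp: compact_group_def)
  then show "continuous_map (prod_topology image_topology image_topology) image_topology (\<lambda>(a, b). a \<otimes>\<^bsub>image_group\<^esub> b)"
    by (rule continuous_map_eq) auto
  have "continuous_map image_topology image_topology (j \<circ> ((\<lambda>x. inv\<^bsub>G\<^esub> x) \<circ> preimage))"
    using cg by (intro continuous_map_compose[OF _ continuous_j] continuous_map_compose[OF continuous_preimage])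
      (auto simp: compact_group_def)
  then show "continuous_map image_topology image_topology (\<lambda>a. inv\<^bsub>image_group\<^esub> a)"
    by (rule continuous_map_eq) (simp add: inv_image_group)
qed (simp_all add: group_image_group)

lemma group_compactification_image:
  assumes "group_compactification G T \<iota>"
  shows "group_compactification image_group image_topology (j \<circ> \<iota>)"
  unfolding group_compactification_def
proof (intro conjI compact_image_group)
  have hom: "\<iota> \<in> hom integer_group G" and dense: "T closure_of (range \<iota>) = topspace T"
    using assms by (auto simp: group_compactification_def)
  then have "\<iota> k \<in> carrier G" for k by (auto simp: hom_def)
  then show "j \<circ> \<iota> \<in> hom integer_group image_group"
    using hom by (auto simp: hom_def)
  have "homeomorphic_map T image_topology j"
    using homeomorphic_maps_image_topology homeomorphic_map_maps by blast
  then show "image_topology closure_of range (j \<circ> \<iota>) = topspace image_topology"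
    using homeomorphic_map_closure_of[of T image_topology j "range \<iota>"] dense \<open>\<And>k. \<iota> k \<in> carrier G\<close>
    by (auto simp: topspace_T image_comp)
qed

section \<open>Haar measure and realizations under the injection\<close>

definition image_measure :: "'c measure \<Rightarrow> 'd measure" where
  "image_measure M = distr M (sigma (j ` carrier G) {U. openin image_topology U}) j"

lemma openin_image_topology_subset: "{U. openin image_topology U} \<subseteq> Pow (j ` carrier G)"
  using openin_subset[of image_topology] by auto

context
  fixes M :: "'c measure"
  assumes haar: "normalized_haar_measure G T M"
begin

lemma space_M: "space M = carrier G"
  and sets_M: "sets M = sigma_sets (carrier G) {U. openin T U}"
  using haar by (auto simp: normalized_haar_measure_def topspace_T)

lemma space_image_measure [simp]: "space (image_measure M) = j ` carrier G"
  by (simp add: image_measure_def space_measure_of[OF openin_image_topology_subset])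

lemma sets_image_measure: "sets (image_measure M) = sigma_sets (j ` carrier G) {U. openin image_topology U}"
  by (simp add: image_measure_def sets_measure_of[OF openin_image_topology_subset])

lemma measurable_j: "j \<in> measurable M (sigma (j ` carrier G) {U. openin image_topology U})"
proof (rule measurable_measure_of[OF openin_image_topology_subset])
  fix U assume "U \<in> {U. openin image_topology U}"
  then have "openin T {x \<in> topspace T. j x \<in> U}"
    using openin_continuous_map_preimage[OF continuous_j] by blast
  moreover have "{x \<in> topspace T. j x \<in> U} = j -` U \<inter> space M"
    by (auto simp: topspace_T space_M)
  ultimately show "j -` U \<inter> space M \<in> sets M"
    unfolding sets_M by (intro sigma_sets.Basic) simp
qed (auto simp: space_M)

lemma measurable_preimage: "preimage \<in> measurable (image_measure M) M"
  using sets_M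
proof (rule measurable_sigma_sets)
  show "{U. openin T U} \<subseteq> Pow (carrier G)"
    using openin_subset[of T] by (auto simp: topspace_T)
  fix U assume "U \<in> {U. openin T U}"
  then have "openin image_topology {y \<in> topspace image_topology. preimage y \<in> U}"
    using openin_continuous_map_preimage[OF continuous_preimage] by blast
  moreover have "{y \<in> topspace image_topology. preimage y \<in> U} = preimage -` U \<inter> space (image_measure M)"
    by auto
  ultimately show "preimage -` U \<inter> space (image_measure M) \<in> sets (image_measure M)"
    unfolding sets_image_measure by (intro sigma_sets.Basic) simp
qed auto

lemma emeasure_image_measure: "A \<in> sets (image_measure M) \<Longrightarrow> emeasure (image_measure M) A = emeasure M (preimage ` A)"
proof -
  assume A: "A \<in> sets (image_measure M)"
  have "j -` A \<inter> space M = preimage ` A"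
  proof (intro equalityI subsetI)
    fix x assume x: "x \<in> j -` A \<inter> space M"
    then have "x = preimage (j x)" by (simp add: space_M)
    then show "x \<in> preimage ` A" using x by blast
  qed (use sets.sets_into_space[OF A] in \<open>auto simp: space_M subset_iff\<close>)
  then show ?thesis
    using A measurable_j by (simp add: image_measure_def emeasure_distr)
qed

lemma preimage_image_sets: "A \<in> sets (image_measure M) \<Longrightarrow> preimage ` A \<in> sets M"
proof -
  assume A: "A \<in> sets (image_measure M)"
  then have "j -` A \<inter> space M \<in> sets M"
    using measurable_sets[OF measurable_j] by (simp add: image_measure_def)
  moreover have "j -` A \<inter> space M = preimage ` A"
  proof (intro equalityI subsetI)
    fix x assume x: "x \<in> j -` A \<inter> space M"
    then have "x = preimage (j x)" by (simp add: space_M)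
    then show "x \<in> preimage ` A" using x by blast
  qed (use sets.sets_into_space[OF A] in \<open>auto simp: space_M subset_iff\<close>)
  ultimately show ?thesis by simp
qed

lemma normalized_haar_measure_image: "normalized_haar_measure image_group image_topology (image_measure M)"
  unfolding normalized_haar_measure_def
proof (intro conjI ballI)
  interpret group G by (rule group_G)
  show "space (image_measure M) = topspace image_topology" by simp
  show "sets (image_measure M) = sigma_sets (topspace image_topology) {U. openin image_topology U}"
    by (simp add: sets_image_measure)
  have "preimage ` (j ` carrier G) = carrier G" by force
  then show "emeasure (image_measure M) (space (image_measure M)) = 1"
    using emeasure_image_measure[OF sets.top] haar space_M by (simp add: normalized_haar_measure_def topspace_T)
  fix A assume A: "A \<in> sets (image_measure M)"
  have A_sub: "A \<subseteq> j ` carrier G" using sets.sets_into_space[OF A] by simp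
  note bA = preimage_image_sets[OF A]
  have image_preimage: "B = j ` preimage ` B" if "B \<subseteq> j ` carrier G" for B
    using that by (force simp: image_iff)
  have image_meas: "j ` B \<in> sets (image_measure M)" if "B \<in> sets M" for B
  proof -
    have "j ` B = preimage -` B \<inter> space (image_measure M)"
      using sets.sets_into_space[OF that] by (force simp: space_M)
    then show ?thesis
      using measurable_sets[OF measurable_preimage that] by simp
  qed
  show "emeasure (image_measure M) ((\<lambda>x. g \<otimes>\<^bsub>image_group\<^esub> x) ` A) = emeasure (image_measure M) A"
    if g: "g \<in> carrier image_group" for g
  proof -
    have bg: "preimage g \<in> carrier G" using g by simp
    have "(\<lambda>x. g \<otimes>\<^bsub>image_group\<^esub> x) ` A = j ` (\<lambda>x. preimage g \<otimes>\<^bsub>G\<^esub> x) ` preimage ` A"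
      by (simp add: image_image)
    moreover have pull_j_image: "preimage ` j ` B = B" if "B \<subseteq> carrier G" for B
      using that by (force simp: image_iff)
    moreover have "(\<lambda>x. preimage g \<otimes>\<^bsub>G\<^esub> x) ` preimage ` A \<in> sets M"
    proof -
      \<comment> \<open>A translated set is a preimage under the inverse translation, which is
        continuous; this yields its measurability.\<close>
      have "(\<lambda>x. preimage g \<otimes>\<^bsub>G\<^esub> x) ` preimage ` A
        = (\<lambda>x. inv\<^bsub>G\<^esub> preimage g \<otimes>\<^bsub>G\<^esub> x) -` (preimage ` A) \<inter> space M"
      proof (intro equalityI subsetI)
        fix x assume "x \<in> (\<lambda>x. inv\<^bsub>G\<^esub> preimage g \<otimes>\<^bsub>G\<^esub> x) -` (preimage ` A) \<inter> space M"
        then have "inv\<^bsub>G\<^esub> preimage g \<otimes>\<^bsub>G\<^esub> x \<in> preimage ` A"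
          "x = preimage g \<otimes>\<^bsub>G\<^esub> (inv\<^bsub>G\<^esub> preimage g \<otimes>\<^bsub>G\<^esub> x)"
          using bg by (auto simp: space_M simp flip: m_assoc)
        then show "x \<in> (\<lambda>x. preimage g \<otimes>\<^bsub>G\<^esub> x) ` preimage ` A" by blast
      qed (use A_sub bg in \<open>auto simp: space_M subset_iff simp flip: m_assoc\<close>)
      moreover have "(\<lambda>x. inv\<^bsub>G\<^esub> preimage g \<otimes>\<^bsub>G\<^esub> x) \<in> measurable M M"
        using sets_M
      proof (rule measurable_sigma_sets)
        show "{U. openin T U} \<subseteq> Pow (carrier G)"
          using openin_subset[of T] by (auto simp: topspace_T)
        show "(\<lambda>x. inv\<^bsub>G\<^esub> preimage g \<otimes>\<^bsub>G\<^esub> x) \<in> space M \<rightarrow> carrier G"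
          using bg by (auto simp: space_M)
        fix U assume U: "U \<in> {U. openin T U}"
        have "continuous_map T (prod_topology T T) (\<lambda>x. (inv\<^bsub>G\<^esub> preimage g, x))"
          using bg by (simp add: continuous_map_pairwise o_def topspace_T)
        then have "continuous_map T T ((\<lambda>(x, y). x \<otimes>\<^bsub>G\<^esub> y) \<circ> (\<lambda>x. (inv\<^bsub>G\<^esub> preimage g, x)))"
          using cg by (intro continuous_map_compose) (auto simp: compact_group_def)
        then have "openin T {x \<in> topspace T. inv\<^bsub>G\<^esub> preimage g \<otimes>\<^bsub>G\<^esub> x \<in> U}"
          using U by (auto simp: o_def dest: openin_continuous_map_preimage)
        moreover have "{x \<in> topspace T. inv\<^bsub>G\<^esub> preimage g \<otimes>\<^bsub>G\<^esub> x \<in> U}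
          = (\<lambda>x. inv\<^bsub>G\<^esub> preimage g \<otimes>\<^bsub>G\<^esub> x) -` U \<inter> space M"
          by (auto simp: topspace_T space_M)
        ultimately show "(\<lambda>x. inv\<^bsub>G\<^esub> preimage g \<otimes>\<^bsub>G\<^esub> x) -` U \<inter> space M \<in> sets M"
          unfolding sets_M by (intro sigma_sets.Basic) simp
      qed
      ultimately show ?thesis using measurable_sets[OF _ bA] by simp
    qed
    moreover from this have "(\<lambda>x. preimage g \<otimes>\<^bsub>G\<^esub> x) ` preimage ` A \<subseteq> carrier G"
      using sets.sets_into_space space_M by blast
    moreover have "emeasure M ((\<lambda>x. preimage g \<otimes>\<^bsub>G\<^esub> x) ` preimage ` A) = emeasure M (preimage ` A)"
      using haar bg bA by (simp add: normalized_haar_measure_def)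
    ultimately show ?thesis
      using emeasure_image_measure image_meas A by metis
  qed
  have "emeasure (image_measure M) A = emeasure M (preimage ` A)" by (rule emeasure_image_measure[OF A])
  also have "\<dots> = (SUP K\<in>{K. compactin T K \<and> K \<subseteq> preimage ` A}. emeasure M K)"
    using haar bA by (simp add: normalized_haar_measure_def)
  also have "\<dots> \<le> (SUP K\<in>{K. compactin image_topology K \<and> K \<subseteq> A}. emeasure (image_measure M) K)"
  proof (rule SUP_mono)
    fix K assume "K \<in> {K. compactin T K \<and> K \<subseteq> preimage ` A}"
    then have K: "compactin T K" "K \<subseteq> preimage ` A" by auto
    have K_sub: "K \<subseteq> carrier G" using compactin_subset_topspace[OF K(1)] by (simp add: topspace_T)
    \<comment> \<open>Compact sets are closed in a Hausdorff space, hence measurable, so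
      \<open>emeasure_image_measure\<close> applies to the image of \<open>K\<close>.\<close>
    have "closedin T K"
      using compactin_imp_closedin[OF _ K(1)] cg by (simp add: compact_group_def)
    then have "openin T (carrier G - K)" by (simp add: closedin_def topspace_T)
    then have "carrier G - K \<in> sets M" unfolding sets_M by (intro sigma_sets.Basic) simp
    then have "space M - (carrier G - K) \<in> sets M" by (rule sets.compl_sets)
    then have "K \<in> sets M" using K_sub by (simp add: space_M double_diff)
    then have jK: "j ` K \<in> sets (image_measure M)" by (rule image_meas)
    have "preimage ` j ` K = K" using K_sub by (force simp: image_iff)
    then have "emeasure M K = emeasure (image_measure M) (j ` K)" using emeasure_image_measure[OF jK] by simp
    moreover have "j ` K \<subseteq> A"
      using image_mono[OF K(2), of j] image_preimage[OF A_sub] by simp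
    moreover have "compactin image_topology (j ` K)"
      by (rule image_compactin[OF K(1) continuous_j])
    ultimately show "\<exists>K'\<in>{K. compactin image_topology K \<and> K \<subseteq> A}. emeasure M K \<le> emeasure (image_measure M) K'"
      by (intro bexI[of _ "j ` K"]) auto
  qed
  finally show "emeasure (image_measure M) A
      = (SUP K\<in>{K. compactin image_topology K \<and> K \<subseteq> A}. emeasure (image_measure M) K)"
    by (intro antisym SUP_least) (auto intro: emeasure_mono A)
qed

text \<open>A null set of the completion need not be Borel; it is covered by a null set of
  \<open>M\<close>, and this cover is transported.\<close>

lemma null_sets_image_measure:
  assumes "N \<in> null_sets (completion M)"
  shows "preimage -` N \<inter> j ` carrier G \<in> null_sets (completion (image_measure M))"
proof -
  obtain N' where N': "N' \<in> null_sets M" "N \<subseteq> N'"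
    using assms unfolding null_sets_completion_iff2 by blast
  let ?B = "preimage -` N' \<inter> j ` carrier G"
  have B: "?B \<in> sets (image_measure M)"
    using measurable_sets[OF measurable_preimage, of N'] N'(1) by auto
  have "preimage ` ?B \<subseteq> N'" by auto
  then have "emeasure M (preimage ` ?B) \<le> emeasure M N'"
    using N'(1) by (intro emeasure_mono) auto
  then have "?B \<in> null_sets (image_measure M)"
    using B emeasure_image_measure[OF B] N'(1) by (simp add: null_sets_def)
  moreover have "preimage -` N \<inter> j ` carrier G \<subseteq> ?B"
    using N'(2) by (intro Int_mono vimage_mono order_refl)
  ultimately show ?thesis
    unfolding null_sets_completion_iff2 by (rule bexI[rotated])
qed

lemma topcontinuous_at_image_topology:
  assumes y: "y \<in> j ` carrier G" and "topcontinuous_at T euclidean F (preimage y)"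
  shows "topcontinuous_at image_topology euclidean (F \<circ> preimage) y"
  unfolding topcontinuous_at_def
proof (intro conjI allI impI)
  fix V assume "openin euclidean V \<and> (F \<circ> preimage) y \<in> V"
  then obtain U where U: "openin T U" "preimage y \<in> U" "\<forall>x\<in>U. F x \<in> V"
    using assms(2) unfolding topcontinuous_at_def by auto
  have "openin image_topology {y \<in> topspace image_topology. preimage y \<in> U}"
    using openin_continuous_map_preimage[OF continuous_preimage U(1)] .
  then show "\<exists>U. openin image_topology U \<and> y \<in> U \<and> (\<forall>x\<in>U. (F \<circ> preimage) x \<in> V)"
    using U y by (intro exI[of _ "{y \<in> topspace image_topology. preimage y \<in> U}"]) auto
qed (use y in auto)

lemma realized_by_image:
  assumes "realized_by f G T \<iota> M F"
  shows "realized_by f image_group image_topology (j \<circ> \<iota>) (image_measure M) (F \<circ> preimage)"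
  unfolding realized_by_def riemann_integrable_def
proof (intro conjI normalized_haar_measure_image)
  have comp: "group_compactification G T \<iota>" and bounded: "bounded (F ` topspace T)"
    and disc: "{x \<in> topspace T. \<not> topcontinuous_at T euclidean F x} \<in> null_sets (completion M)"
    and f: "f = F \<circ> \<iota>"
    using assms by (auto simp: realized_by_def riemann_integrable_def)
  show "group_compactification image_group image_topology (j \<circ> \<iota>)"
    by (rule group_compactification_image[OF comp])
  show "bounded ((F \<circ> preimage) ` topspace image_topology)"
    by (rule bounded_subset[OF bounded]) (auto simp: topspace_T)
  have "{y \<in> topspace image_topology. \<not> topcontinuous_at image_topology euclidean (F \<circ> preimage) y}
    \<subseteq> preimage -` {x \<in> topspace T. \<not> topcontinuous_at T euclidean F x} \<inter> j ` carrier G"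
    using topcontinuous_at_image_topology by (auto simp: topspace_T)
  then show "{y \<in> topspace image_topology. \<not> topcontinuous_at image_topology euclidean (F \<circ> preimage) y}
      \<in> null_sets (completion (image_measure M))"
    using null_sets_image_measure[OF disc] null_sets_completion_subset by blast
  have "\<iota> k \<in> carrier G" for k
    using comp by (auto simp: group_compactification_def hom_def)
  then show "f = F \<circ> preimage \<circ> (j \<circ> \<iota>)"
    by (simp add: f fun_eq_iff)
qed

end

lemma meager_in_image_topology:
  assumes "meager_in T A"
  shows "meager_in image_topology (j ` A)"
proof -
  obtain N :: "nat \<Rightarrow> 'c set"
    where "(\<forall>n. N n \<subseteq> topspace T \<and> T interior_of (T closure_of N n) = {}) \<and> A = (\<Union>n. N n)"
    using assms unfolding meager_in_def by (elim exE)
  then have N: "N n \<subseteq> topspace T" "T interior_of (T closure_of N n) = {}" "A = (\<Union>n. N n)" for n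
    by auto
  have hm: "homeomorphic_map T image_topology j"
    using homeomorphic_maps_image_topology homeomorphic_map_maps by blast
  have "image_topology interior_of (image_topology closure_of (j ` N n)) = {}" for n
    unfolding homeomorphic_map_closure_of[OF hm N(1)]
      homeomorphic_map_interior_of[OF hm closure_of_subset_topspace] N(2) by simp
  moreover have "j ` N n \<subseteq> topspace image_topology" for n
    using N(1) by (auto simp: topspace_T)
  moreover have "j ` A = (\<Union>n. j ` N n)"
    unfolding N(3) by (rule image_UN)
  ultimately show ?thesis
    unfolding meager_in_def by (intro exI[of _ "\<lambda>n. j ` N n"] conjI allI)
qed

end

text \<open>Neighbourhood traces are injective on a compactification, which provides a copy on the
  type that the Hartman classes quantify over. Supports correspond under the injection, a
  homeomorphism, so meagerness is kept.\<close>

lemma compactification_point_realization: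
  assumes real: "realized_by f G T \<iota> M F" and meager: "meager_in T {x \<in> topspace T. F x \<noteq> 0}"
  obtains G' :: "compactification_point monoid" and T' \<iota>' M' F'
  where "realized_by f G' T' \<iota>' M' F'" and "meager_in T' {x \<in> topspace T'. F' x \<noteq> 0}"
proof -
  have comp: "group_compactification G T \<iota>" and haar: "normalized_haar_measure G T M"
    using real by (auto simp: realized_by_def)
  define j :: "_ \<Rightarrow> compactification_point" where "j x = {\<iota> -` U |U. openin T U \<and> x \<in> U}" for x
  have "inj_on j (topspace T)"
    unfolding j_def by (rule inj_on_neighbourhood_traces[OF comp])
  then interpret transported_group G T j
    using comp by unfold_locales (auto simp: group_compactification_def compact_group_def)
  have support: "{y \<in> topspace image_topology. (F \<circ> preimage) y \<noteq> 0} = j ` {x \<in> topspace T. F x \<noteq> 0}"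
    by (auto simp: topspace_T)
  show ?thesis
    by (rule that[OF realized_by_image[OF haar real]]) (simp only: support meager_in_image_topology[OF meager])
qed

theorem theorem7:
  fixes f :: "int \<Rightarrow> complex"
  assumes f_def: "\<And>k. f k = complex_of_real (\<Prod>j. (cos (2 * pi * (of_int k / 3 ^ Suc j)))\<^sup>2)"
  shows "range f \<subseteq> complex_of_real ` {0..1}
    \<and> f \<in> (hartman_functions_0 \<inter> weakly_almost_periodic) - almost_periodic_plus_c0
    \<and> hartman_mean f = 0
    \<and> (\<exists>M F. realized_by f zadic3 zadic3_topology zadic3_embedding M F)
    \<and> circle_singular cantor_measure
    \<and> circle_singular (circle_convolution cantor_measure cantor_measure)
    \<and> f = fourier_stieltjes (circle_convolution cantor_measure cantor_measure)"
proof -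
  have f: "f = (\<lambda>k. of_real (cos_product k))"
    by (rule ext) (simp only: f_def cos_product_def)
  have fourier: "f = fourier_stieltjes (circle_convolution cantor_measure cantor_measure)"
    by (rule ext) (simp only: f fourier_stieltjes_cantor_convolution cantor_transform_squared)
  have range: "range f \<subseteq> complex_of_real ` {0..1}"
    using cos_product_nonneg cos_product_le_1 by (auto simp: f)
  have sum_le: "(\<Sum>i<3 ^ n. norm (f (m + int i))) \<le> (3 / 2) ^ n" for m n
    using sum_cos_product_le[where m = m and n = n] cos_product_nonneg by (simp add: f)
  have realized: "realized_by f zadic3 zadic3_topology zadic3_embedding zadic3_haar zadic3_extension"
    unfolding f by (rule realized_by_zadic3)
  obtain G :: "compactification_point monoid" and T \<iota> M F
    where real: "realized_by f G T \<iota> M F" and meager: "meager_in T {x \<in> topspace T. F x \<noteq> 0}"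
    using compactification_point_realization[OF realized meager_zadic3_extension] .
  \<comment> \<open>The uniqueness half of the definite description in \<open>hartman_mean\<close>;
    existence comes from the transported 3-adic realization.\<close>
  have mean_0: "integral\<^sup>L (completion M) F = 0" if "realized_by f G T \<iota> M F"
    for G :: "compactification_point monoid" and T \<iota> M F
    by (rule integral_eq_zero_AE[OF realization_AE_zero[OF that sum_le]])
  have "space M = topspace T"
    using real by (simp add: realized_by_def normalized_haar_measure_def)
  moreover obtain N where "{x \<in> space (completion M). \<not> F x = 0} \<subseteq> N" "N \<in> null_sets (completion M)"
    using realization_AE_zero[OF real sum_le] by (auto elim!: AE_E simp: null_sets_def)
  ultimately have "{x \<in> topspace T. F x \<noteq> 0} \<in> null_sets (completion M)"
    using null_sets_completion_subset by simp
  then have "f \<in> hartman_functions_0"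
    unfolding hartman_functions_0_def using real meager by blast
  moreover have "f \<in> weakly_almost_periodic"
    unfolding fourier
    by (rule weakly_almost_periodic_fourier_stieltjes[OF prob_space_circle_convolution sets_circle_convolution])
      (rule prob_space_cantor_measure sets_cantor_measure)+
  moreover have "f \<notin> almost_periodic_plus_c0"
  proof (rule not_almost_periodic_plus_c0[OF sum_le])
    show "f (3 * k) = f k" for k
      unfolding fourier fourier_stieltjes_cantor_convolution of_int_mult of_int_numeral
        cantor_transform_mult_3 ..
    show "f 1 \<noteq> 0"
      by (simp add: f cos_product_nonzero)
  qed
  moreover have "hartman_mean f = 0"
    unfolding hartman_mean_def
  proof (rule the_equality)
    show "\<exists>(G :: compactification_point monoid) T \<iota> M F.
        realized_by f G T \<iota> M F \<and> 0 = integral\<^sup>L (completion M) F"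
      using real mean_0[OF real] by (intro exI conjI) auto
  qed (use mean_0 in auto)
  ultimately show ?thesis
    using range realized fourier circle_singular_cantor_measure circle_singular_cantor_convolution
    by blast
qed

end
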